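(* Let $d\ge1$. The sequence $T_{g_{-1}},T_{g_{0,0,1}},T_{g_{0,0,2}},\dots$ (the functionals $T_g$ for $g$ ranging over the Haar functions of $[0,1]^d$: first $g_{-1}$, then the $g_{n,k,r}$ with indices $(n,k,r)$ in lexicographic order) is a Schauder basis of $SCH([0,1]^d)$. With respect to it, each $\alpha\in SCH([0,1]^d)$ is decomposed as $$\alpha=\alpha(g_{-1})T_{g_{-1}}+\alpha(g_{0,0,1})T_{g_{0,0,1}}+\alpha(g_{0,0,2})T_{g_{0,0,2}}+\cdots,$$ where the convergence of the series (in this order) occurs in the norm of $BV([0,1]^d)^*$.
   Context: $BV([0,1]^d)$ is the space of $u\in BV(\mathbb{R}^d)$ that vanish a.e. outside $[0,1]^d$, with norm $\|u\|_{BV}=\|u\|_1+\|Du\|(\mathbb{R}^d)$, where $\|Du\|$ is the total variation measure of the distributional gradient $Du$. For $f\in L^d([0,1]^d)$, $T_f\in BV([0,1]^d)^*$ is $T_f(u)=\int_{[0,1]^d}fu$. $SCH([0,1]^d)$ is the closure of $\{T_f: f\in L^d([0,1]^d)\}$ in $BV([0,1]^d)^*$ with its operator norm. Haar functions: let $A_1=\begin{pmatrix}1&1\\1&-1\end{pmatrix}$ and $A_{m+1}=\begin{pmatrix}A_m&A_m\\ A_m&-A_m\end{pmatrix}$; the entries of $A_d$ are $(A_d)_{r,\ell}$ with $r,\ell\in\{0,\dots,2^d-1\}$. For each $n\ge0$, let $K_{n,k}$, $k=0,\dots,2^{nd}-1$, be an enumeration of the dyadic cubes $\prod_{i=1}^d[2^{-n}k_i,2^{-n}(k_i+1)]$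 ($0\le k_i\le2^n-1$ integers), chosen so that for all $n,k$ the cubes $K_{n+1,2^dk},\dots,K_{n+1,2^dk+2^d-1}$ are the $2^d$ subcubes of $K_{n,k}$ of side $2^{-(n+1)}$. Set $g_{-1}=1$ on $[0,1]^d$ and, for $n\ge0$, $0\le k\le2^{nd}-1$, $1\le r\le2^d-1$, $g_{n,k,r}=2^{nd/2}\sum_{\ell=0}^{2^d-1}(A_d)_{r,\ell}\mathbf{1}_{K_{n+1,2^dk+\ell}}$. These functions, extended by $0$ outside $[0,1]^d$, belong to $BV([0,1]^d)$. A Schauder basis of a Banach space $X$ is a sequence $(e_n)$ such that every $x\in X$ can be written as $x=\sum_n a_ne_n$ (norm convergence) for a unique scalar sequence $(a_n)$. *)

theory Defs
  imports "HOL-Analysis.Analysis"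
begin

text \<open>The dimension is \<^term>\<open>CARD('n)\<close>. Functions are honest functions, not classes modulo null sets.
  They are taken Borel measurable, which loses nothing, as every Lebesgue measurable function
  is a.e. equal to a Borel measurable one.\<close>

section \<open>The distributional gradient and its total variation\<close>

definition partial_deriv :: "'n::finite \<Rightarrow> (real^'n \<Rightarrow> real) \<Rightarrow> real^'n \<Rightarrow> real" where
  "partial_deriv i f x = frechet_derivative f (at x) (axis i 1)"

primrec Ck :: "nat \<Rightarrow> (real^'n::finite \<Rightarrow> real) \<Rightarrow> bool" where
  "Ck 0 f \<longleftrightarrow> continuous_on UNIV f"
| "Ck (Suc k) f \<longleftrightarrow> f differentiable_on UNIV \<and> (\<forall>i. Ck k (partial_deriv i f))"

definition test_function :: "(real^'n::finite \<Rightarrow> real) \<Rightarrow> bool" where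
  "test_function \<phi> \<longleftrightarrow> (\<forall>k. Ck k \<phi>) \<and> compact (closure {x. \<phi> x \<noteq> 0})"

text \<open>The vector measure \<open>D\<close> is a set function of which only the values on Borel sets matter. Its
  \<open>i\<close>-th component is a finite signed measure, written as a difference \<open>M - N\<close> of finite
  measures so that integration against it is \<open>\<integral>\<phi> dM - \<integral>\<phi> dN\<close>; this value does not depend on the
  choice of \<open>M\<close> and \<open>N\<close>.\<close>

definition is_distr_gradient ::
    "(real^'n::finite \<Rightarrow> real) \<Rightarrow> ((real^'n) set \<Rightarrow> real^'n) \<Rightarrow> bool" where
  "is_distr_gradient u D \<longleftrightarrow>
    (\<forall>i. \<exists>M N. finite_measure M \<and> finite_measure N \<and> sets M = sets borel \<and> sets N = sets borel \<and>
      (\<forall>B\<in>sets borel. D B $ i = measure M B - measure N B) \<and>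
      (\<forall>\<phi>. test_function \<phi> \<longrightarrow>
        (\<integral>x. u x * partial_deriv i \<phi> x \<partial>lborel) = - ((\<integral>x. \<phi> x \<partial>M) - (\<integral>x. \<phi> x \<partial>N))))"

text \<open>Unique on Borel sets whenever it exists.\<close>

definition distr_gradient :: "(real^'n::finite \<Rightarrow> real) \<Rightarrow> (real^'n) set \<Rightarrow> real^'n" where
  "distr_gradient u = (SOME D. is_distr_gradient u D)"

definition total_variation ::
    "((real^'n::finite) set \<Rightarrow> real^'n) \<Rightarrow> (real^'n) set \<Rightarrow> ennreal" where
  "total_variation D E =
    (SUP A \<in> {A :: nat \<Rightarrow> (real^'n) set. range A \<subseteq> sets borel \<and> disjoint_family A \<and> (\<Union>k. A k) = E}.
      (\<Sum>k. ennreal (norm (D (A k)))))"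

section \<open>Functions of bounded variation\<close>

definition BV :: "(real^'n::finite \<Rightarrow> real) set" where
  "BV = {u. integrable lborel u \<and> (\<exists>D. is_distr_gradient u D)}"

abbreviation unit_cube :: "(real^'n::finite) set" where
  "unit_cube \<equiv> cbox 0 1"

definition BV_cube :: "(real^'n::finite \<Rightarrow> real) set" where
  "BV_cube = {u \<in> BV. AE x in lborel. x \<notin> unit_cube \<longrightarrow> u x = 0}"

definition BV_norm :: "(real^'n::finite \<Rightarrow> real) \<Rightarrow> real" where
  "BV_norm u = (\<integral>x. \<bar>u x\<bar> \<partial>lborel) + enn2real (total_variation (distr_gradient u) UNIV)"

section \<open>The dual space and strong charges\<close>

text \<open>Functionals are set to 0 off \<^term>\<open>BV_cube\<close>, so that they are equal as functions iff they
  agree on \<^term>\<open>BV_cube\<close>. Boundedness and linearity force a functional to agree on functions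
  that are equal a.e.\<close>

definition BV_dual :: "((real^'n::finite \<Rightarrow> real) \<Rightarrow> real) set" where
  "BV_dual = {\<alpha>.
     (\<forall>u. u \<notin> BV_cube \<longrightarrow> \<alpha> u = 0) \<and>
     (\<forall>u\<in>BV_cube. \<forall>v\<in>BV_cube. \<alpha> (\<lambda>x. u x + v x) = \<alpha> u + \<alpha> v) \<and>
     (\<forall>c. \<forall>u\<in>BV_cube. \<alpha> (\<lambda>x. c * u x) = c * \<alpha> u) \<and>
     (\<exists>C. \<forall>u\<in>BV_cube. \<bar>\<alpha> u\<bar> \<le> C * BV_norm u)}"

definition dual_norm :: "((real^'n::finite \<Rightarrow> real) \<Rightarrow> real) \<Rightarrow> real" where
  "dual_norm \<alpha> = (SUP u \<in> {u \<in> BV_cube. BV_norm u \<le> 1}. \<bar>\<alpha> u\<bar>)"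

definition Ld_cube :: "(real^'n::finite \<Rightarrow> real) set" where
  "Ld_cube = {f. set_borel_measurable lborel unit_cube f \<and>
                 set_integrable lborel unit_cube (\<lambda>x. \<bar>f x\<bar> ^ CARD('n))}"

definition T :: "(real^'n::finite \<Rightarrow> real) \<Rightarrow> (real^'n \<Rightarrow> real) \<Rightarrow> real" where
  "T f u = (if u \<in> BV_cube then LINT x:unit_cube|lborel. f x * u x else 0)"

definition SCH :: "((real^'n::finite \<Rightarrow> real) \<Rightarrow> real) set" where
  "SCH = {\<alpha> \<in> BV_dual. \<forall>\<epsilon>>0. \<exists>f\<in>Ld_cube. dual_norm (\<lambda>u. \<alpha> u - T f u) < \<epsilon>}"

text \<open>Real scalars, for a space \<open>X\<close> of real-valued functions with pointwise operations and norm \<open>N\<close>.\<close>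

definition schauder_basis ::
    "('b \<Rightarrow> real) set \<Rightarrow> (('b \<Rightarrow> real) \<Rightarrow> real) \<Rightarrow> (nat \<Rightarrow> 'b \<Rightarrow> real) \<Rightarrow> bool" where
  "schauder_basis X N e \<longleftrightarrow> (\<forall>j. e j \<in> X) \<and>
    (\<forall>x\<in>X. \<exists>!a :: nat \<Rightarrow> real. (\<lambda>m. N (\<lambda>u. x u - (\<Sum>j<m. a j * e j u))) \<longlonglongrightarrow> 0)"

section \<open>Haar functions\<close>

text \<open>Rows and columns are numbered from 0. Starting from \<open>A\<^sub>0 = (1)\<close>, the recursion gives
  the 2 by 2 matrix \<open>A\<^sub>1\<close> with rows \<open>(1, 1)\<close> and \<open>(1, -1)\<close>.\<close>

primrec haar_matrix :: "nat \<Rightarrow> nat \<Rightarrow> nat \<Rightarrow> real" where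
  "haar_matrix 0 r l = 1"
| "haar_matrix (Suc m) r l =
    (if 2 ^ m \<le> r \<and> 2 ^ m \<le> l then - 1 else 1) * haar_matrix m (r mod 2 ^ m) (l mod 2 ^ m)"

definition dyadic_cubes :: "nat \<Rightarrow> (real^'n::finite) set set" where
  "dyadic_cubes n = {cbox (\<chi> i. real (k i) / 2 ^ n) (\<chi> i. (real (k i) + 1) / 2 ^ n) | k :: 'n \<Rightarrow> nat.
     \<forall>i. k i \<le> 2 ^ n - 1}"

definition dyadic_enumeration :: "(nat \<Rightarrow> nat \<Rightarrow> (real^'n::finite) set) \<Rightarrow> bool" where
  "dyadic_enumeration K \<longleftrightarrow>
    (\<forall>n. bij_betw (K n) {..<2 ^ (n * CARD('n))} (dyadic_cubes n)) \<and>
    (\<forall>n. \<forall>k<2 ^ (n * CARD('n)).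
      (\<lambda>l. K (Suc n) (2 ^ CARD('n) * k + l)) ` {..<2 ^ CARD('n)} =
        {Q \<in> dyadic_cubes (Suc n). Q \<subseteq> K n k})"

definition haar ::
    "(nat \<Rightarrow> nat \<Rightarrow> (real^'n::finite) set) \<Rightarrow> nat \<times> nat \<times> nat \<Rightarrow> real^'n \<Rightarrow> real" where
  "haar K = (\<lambda>(n, k, r) x. 2 powr (real (n * CARD('n)) / 2) *
     (\<Sum>l<2 ^ CARD('n). haar_matrix CARD('n) r l * indicator (K (Suc n) (2 ^ CARD('n) * k + l)) x))"

text \<open>The successor in the lexicographic order of the triples \<open>(n, k, r)\<close> with
  \<open>k \<le> 2\<^sup>n\<^sup>d - 1\<close> and \<open>1 \<le> r \<le> 2\<^sup>d - 1\<close>.\<close>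

fun next_index :: "nat \<Rightarrow> nat \<times> nat \<times> nat \<Rightarrow> nat \<times> nat \<times> nat" where
  "next_index d (n, k, r) =
    (if r < 2 ^ d - 1 then (n, k, r + 1)
     else if k < 2 ^ (n * d) - 1 then (n, k + 1, 1)
     else (n + 1, 0, 1))"

text \<open>\<open>haar_seq K 0\<close> is the constant 1 on the cube and \<open>haar_seq K 1\<close> has index \<open>(0, 0, 1)\<close>.\<close>

primrec haar_seq :: "(nat \<Rightarrow> nat \<Rightarrow> (real^'n::finite) set) \<Rightarrow> nat \<Rightarrow> real^'n \<Rightarrow> real" where
  "haar_seq K 0 = indicator unit_cube"
| "haar_seq K (Suc j) = haar K ((next_index CARD('n) ^^ j) (0, 0, 1))"

end

theory Submission imports Defs
begin

text \<open>Let \<open>S\<^sub>m u = \<Sum>j<m. \<langle>u, g\<^sub>j\<rangle> g\<^sub>j\<close> be the partial sums of the Haar expansion of a function \<open>u\<close>, where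
  \<open>g\<^sub>j = haar_seq K j\<close>. Since \<open>T g\<^sub>j u = \<langle>u, g\<^sub>j\<rangle>\<close>, linearity of \<open>\<alpha>\<close> turns the \<open>m\<close>-th partial sum of the series
  of \<open>\<alpha>\<close> into \<open>\<alpha> \<circ> S\<^sub>m\<close> (\<open>dual_partial\<close>). So the claim is that \<open>\<alpha> \<circ> S\<^sub>m\<close> tends to \<open>\<alpha>\<close> in the dual norm for
  every \<open>\<alpha>\<close> in \<open>SCH\<close>. Three facts give it.

  The operators \<open>S\<^sub>m\<close> are uniformly bounded on \<open>BV_cube\<close> (\<open>partial_bounded\<close>). For \<open>m = 2\<^sup>n\<^sup>d\<close>, orthogonality of the
  sign matrix shows that \<open>S\<^sub>m u\<close> is the function obtained by averaging \<open>u\<close> over the dyadic cubes of side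
  \<open>2\<^sup>-\<^sup>n\<close> (\<open>partial_level\<close>). Any other \<open>S\<^sub>m\<close> with \<open>m > 0\<close> differs from such an average by finitely many terms of a
  single level, and even the sum of the norms of all terms of one level is at most a constant times the
  variation of \<open>u\<close> (\<open>level_bound\<close>). The averages and the levels are both controlled by one inequality,
  \<open>sum_jumps_le_var\<close>: for cubes of side \<open>h\<close> and a coordinate direction \<open>i\<close>, the differences between the integrals of
  \<open>u\<close> over a cube and over its neighbour in direction \<open>i\<close> have absolute values that add up to at most \<open>h\<close> times
  the variation. Indeed such a difference is the integral, against the gradient measure, of a tent function of
  height \<open>h\<close>, and all tents together add up to at most \<open>h\<close> at every point.

  Functionals of dyadic step functions are dense in \<open>SCH\<close> (\<open>T_approx_step\<close>). This follows from Sobolev's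
  inequality \<open>\<bar>T f u\<bar> \<le> \<parallel>f\<parallel>\<^sub>d var u\<close> (lemma \<open>sobolev\<close>), as dyadic step functions are dense in \<open>L\<^sup>d\<close>. If \<open>f\<close>
  is itself a step function, the inequality involves only the integrals of \<open>u\<close> over grid cubes, and it follows from
  the bound on the jumps by the argument of Gagliardo, Nirenberg, Loomis and Whitney
  (\<open>discrete_sobolev\<close>).

  Finally \<open>S\<^sub>m\<close> preserves the integrals over the cubes of level \<open>n\<close> as soon as \<open>m \<ge> 2\<^sup>n\<^sup>d\<close>
  (\<open>cell_int_partial\<close>), so a functional \<open>\<sigma>\<close> of a step function of level \<open>n\<close> satisfies
  \<open>\<sigma> \<circ> S\<^sub>m = \<sigma>\<close>. Hence \<open>\<alpha> - \<alpha> \<circ> S\<^sub>m = (\<alpha> - \<sigma>) - (\<alpha> - \<sigma>) \<circ> S\<^sub>m\<close>, which is small if \<open>\<sigma>\<close> is close to \<open>\<alpha>\<close>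
  (\<open>expansion_converges\<close>).

  The coefficients are unique because the Haar functions are orthonormal: evaluating an expansion of
  \<open>\<alpha>\<close> at \<open>g\<^sub>i\<close> leaves its \<open>i\<close>-th coefficient (\<open>expansion_unique\<close>).\<close>

section \<open>Smooth functions of one variable\<close>

primrec diff_upto :: "nat \<Rightarrow> (real \<Rightarrow> real) \<Rightarrow> bool" where
  "diff_upto 0 f \<longleftrightarrow> True"
| "diff_upto (Suc k) f \<longleftrightarrow> (\<exists>f'. (\<forall>x. (f has_real_derivative f' x) (at x)) \<and> diff_upto k f')"

definition smooth :: "(real \<Rightarrow> real) \<Rightarrow> bool" where
  "smooth f \<longleftrightarrow> (\<forall>k. diff_upto k f)"

lemma diff_upto_Suc: "diff_upto (Suc k) f \<Longrightarrow> diff_upto k f"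
proof (induction k arbitrary: f)
  case (Suc k)
  then show ?case by (metis diff_upto.simps(2))
qed simp

lemma diff_upto_const: "diff_upto k (\<lambda>x. c)"
proof (induction k arbitrary: c)
  case (Suc k)
  then show ?case by (auto intro!: exI[of _ "\<lambda>x. 0"])
qed simp

lemma diff_upto_add: "diff_upto k f \<Longrightarrow> diff_upto k g \<Longrightarrow> diff_upto k (\<lambda>x. f x + g x)"
proof (induction k arbitrary: f g)
  case (Suc k)
  then obtain f' g' where "\<forall>x. (f has_real_derivative f' x) (at x)" "diff_upto k f'"
    "\<forall>x. (g has_real_derivative g' x) (at x)" "diff_upto k g'" by auto
  with Suc.IH show ?case
    by (auto intro!: exI[of _ "\<lambda>x. f' x + g' x"] derivative_intros)
qed simp

lemma diff_upto_mult: "diff_upto k f \<Longrightarrow> diff_upto k g \<Longrightarrow> diff_upto k (\<lambda>x. f x * g x)"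
proof (induction k arbitrary: f g)
  case (Suc k)
  then obtain f' g' where d: "\<forall>x. (f has_real_derivative f' x) (at x)" "diff_upto k f'"
    "\<forall>x. (g has_real_derivative g' x) (at x)" "diff_upto k g'" by auto
  have "diff_upto k (\<lambda>x. f' x * g x + g' x * f x)"
    using Suc.IH Suc.prems d by (intro diff_upto_add Suc.IH diff_upto_Suc[of k f] diff_upto_Suc[of k g])
  with d show ?case
    by (auto intro!: exI[of _ "\<lambda>x. f' x * g x + g' x * f x"] DERIV_mult)
qed simp

lemma diff_upto_affine: "diff_upto k f \<Longrightarrow> diff_upto k (\<lambda>x. f (a * x + b))"
proof (induction k arbitrary: f)
  case (Suc k)
  then obtain f' where d: "\<forall>x. (f has_real_derivative f' x) (at x)" "diff_upto k f'" by auto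
  have "((\<lambda>x. f (a * x + b)) has_real_derivative f' (a * x + b) * a) (at x)" for x
    by (rule DERIV_chain2[where f=f]) (auto intro!: derivative_eq_intros d(1)[rule_format])
  moreover have "diff_upto k (\<lambda>x. f' (a * x + b) * a)"
    by (rule diff_upto_mult[OF Suc.IH[OF d(2)] diff_upto_const])
  ultimately show ?case by (auto intro!: exI[of _ "\<lambda>x. f' (a * x + b) * a"])
qed simp

lemma smooth_mult: "smooth f \<Longrightarrow> smooth g \<Longrightarrow> smooth (\<lambda>x. f x * g x)"
  by (simp add: smooth_def diff_upto_mult)

lemma smooth_affine: "smooth f \<Longrightarrow> smooth (\<lambda>x. f (a * x + b))"
  by (simp add: smooth_def diff_upto_affine)

lemma smooth_diff: "smooth f \<Longrightarrow> smooth g \<Longrightarrow> smooth (\<lambda>x. f x - g x)"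
  using diff_upto_add[of _ f "\<lambda>x. (-1) * g x"] diff_upto_mult[OF diff_upto_const, of _ g "-1"]
  by (simp add: smooth_def)

lemma smooth_antideriv:
  assumes "\<And>x. (F has_real_derivative f x) (at x)" "smooth f"
  shows "smooth F"
  unfolding smooth_def
proof
  fix k show "diff_upto k F"
    using assms by (cases k) (auto simp: smooth_def)
qed

lemma smooth_deriv:
  assumes "smooth f" "\<And>x. (f has_real_derivative f' x) (at x)"
  shows "smooth f'"
  unfolding smooth_def
proof
  fix k
  have "diff_upto (Suc k) f" using assms(1) by (simp add: smooth_def)
  then obtain g where g: "\<forall>x. (f has_real_derivative g x) (at x)" "diff_upto k g" by auto
  then have "g = f'" using assms(2) DERIV_unique by blast
  with g show "diff_upto k f'" by simp
qed

lemma smooth_has_deriv: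
  assumes "smooth f"
  shows "(f has_real_derivative deriv f x) (at x)" "smooth (deriv f)"
proof -
  have "diff_upto 1 f" using assms by (simp add: smooth_def)
  then have d: "(f has_real_derivative deriv f x) (at x)" for x
    by (auto simp: DERIV_imp_deriv dest: spec[of _ x])
  then show "(f has_real_derivative deriv f x) (at x)" .
  show "smooth (deriv f)" using smooth_deriv[OF assms d] .
qed

text \<open>The functions \<open>p (1/x) exp (-1/x)\<close> for \<open>x > 0\<close>, extended by \<open>0\<close>. Keeping the polynomial \<open>p\<close> general makes the
  family closed under differentiation, so smoothness needs a single induction.\<close>

definition flat :: "real poly \<Rightarrow> real \<Rightarrow> real" where
  "flat p x = (if 0 < x then poly p (inverse x) * exp (- inverse x) else 0)"

text \<open>The exponential beats every polynomial; at \<open>y = 1/x\<close> this gives all the flatness needed at \<open>0\<close>.\<close>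

lemma poly_exp_tendsto_0: "((\<lambda>y. poly p y * exp (- y)) \<longlongrightarrow> (0::real)) at_top"
proof -
  have "((\<lambda>y. \<Sum>i\<le>degree p. coeff p i * (y ^ i / exp y)) \<longlongrightarrow> (\<Sum>i\<le>degree p. coeff p i * 0)) at_top"
    by (intro tendsto_intros tendsto_power_div_exp_0)
  then show ?thesis
    by (simp add: poly_altdef sum_distrib_right sum_divide_distrib exp_minus field_simps)
qed

lemma flat_at_0: "((\<lambda>x. flat p x / x) \<longlongrightarrow> 0) (at 0)"
proof -
  have "((\<lambda>x. poly (pCons 0 p) (inverse x) * exp (- inverse x)) \<longlongrightarrow> 0) (at_right 0)"
    by (rule filterlim_compose[OF poly_exp_tendsto_0 filterlim_inverse_at_top_right])
  then have "((\<lambda>x. flat p x / x) \<longlongrightarrow> 0) (at_right 0)"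
    by (rule Lim_transform_eventually) (auto simp: flat_def eventually_at_filter field_simps)
  moreover have "((\<lambda>x. flat p x / x) \<longlongrightarrow> 0) (at_left 0)"
    by (rule tendsto_eventually) (auto simp: flat_def eventually_at_filter)
  ultimately show ?thesis by (simp add: filterlim_at_split)
qed

lemma flat_deriv:
  "(flat p has_real_derivative flat (monom 1 2 * (p - pderiv p)) x) (at x)"
proof -
  consider "x > 0" | "x < 0" | "x = 0" by linarith
  then show ?thesis
  proof cases
    case 1
    \<comment> \<open>with \<open>y = 1/x\<close>: the derivative of \<open>p(y) exp(-y)\<close> in \<open>x\<close> is \<open>y\<^sup>2 (p - p')(y) exp(-y)\<close>\<close>
    have "((\<lambda>x. poly p (inverse x) * exp (- inverse x)) has_real_derivative
       flat (monom 1 2 * (p - pderiv p)) x) (at x)"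
      using 1 by (auto intro!: derivative_eq_intros DERIV_chain2[OF poly_DERIV] simp: flat_def poly_monom field_simps power2_eq_square)
    then show ?thesis
      by (rule has_field_derivative_transform_within[where d=x]) (use 1 in \<open>auto simp: flat_def dist_real_def\<close>)
  next
    case 2
    have "((\<lambda>x. 0) has_real_derivative flat (monom 1 2 * (p - pderiv p)) x) (at x)"
      using 2 by (auto simp: flat_def)
    then show ?thesis
      by (rule has_field_derivative_transform_within[where d="-x"]) (use 2 in \<open>auto simp: flat_def dist_real_def\<close>)
  next
    case 3
    then show ?thesis using flat_at_0[of p] by (simp add: DERIV_def flat_def[of _ 0])
  qed
qed

lemma smooth_flat: "smooth (flat p)"
proof -
  have "diff_upto k (flat p)" for k
  proof (induction k arbitrary: p)
    case (Suc k)
    then show ?case using flat_deriv by auto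
  qed simp
  then show ?thesis by (simp add: smooth_def)
qed

text \<open>As \<open>n\<close> grows these smooth functions, supported in \<open>[a, b]\<close>, increase to the indicator of the open interval;
  \<open>flat 1\<close> is \<open>exp (-1/x)\<close> for positive \<open>x\<close>.\<close>

definition bump :: "nat \<Rightarrow> real \<Rightarrow> real \<Rightarrow> real \<Rightarrow> real" where
  "bump n a b t = flat 1 (real n * t + - (real n * a)) * flat 1 (- real n * t + real n * b)"

lemma smooth_bump: "smooth (bump n a b)"
  unfolding bump_def[abs_def] by (intro smooth_mult smooth_affine smooth_flat)

lemma flat_1_bounds: "0 \<le> flat 1 x" "flat 1 x \<le> 1"
  by (auto simp: flat_def)

lemma bump_bounds: "0 \<le> bump n a b t" "bump n a b t \<le> 1"
  unfolding bump_def using flat_1_bounds by (auto intro: mult_le_one)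

lemma bump_outside: "t \<notin> {a<..<b} \<Longrightarrow> bump n a b t = 0"
proof -
  assume "t \<notin> {a<..<b}"
  then have "real n * t + - (real n * a) \<le> 0 \<or> - real n * t + real n * b \<le> 0"
    by (auto simp: mult_left_mono)
  then show ?thesis by (auto simp: bump_def flat_def)
qed

lemma flat_1_tendsto: "c > 0 \<Longrightarrow> (\<lambda>n. flat 1 (real n * c)) \<longlonglongrightarrow> 1"
proof -
  assume c: "c > 0"
  have "filterlim (\<lambda>n. c * real n) at_top sequentially"
    by (rule filterlim_tendsto_pos_mult_at_top[OF tendsto_const c filterlim_real_sequentially])
  then have "(\<lambda>n. exp (- inverse (c * real n))) \<longlonglongrightarrow> exp (- 0)"
    by (intro tendsto_intros tendsto_inverse_0_at_top) auto
  then have "(\<lambda>n. exp (- inverse (c * real n))) \<longlonglongrightarrow> 1" by simp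
  then show ?thesis
    by (rule Lim_transform_eventually[of _ 1])
      (use c in \<open>auto simp: flat_def mult_ac intro!: eventually_sequentiallyI[of 1]\<close>)
qed

lemma bump_tendsto: "(\<lambda>n. bump n a b t) \<longlonglongrightarrow> indicator {a<..<b} t"
proof (cases "t \<in> {a<..<b}")
  case True
  have "(\<lambda>n. flat 1 (real n * (t - a)) * flat 1 (real n * (b - t))) \<longlonglongrightarrow> 1 * 1"
    using True by (intro tendsto_mult flat_1_tendsto) auto
  then show ?thesis using True by (simp add: bump_def algebra_simps)
next
  case False
  then show ?thesis using bump_outside[OF False] by simp
qed

section \<open>Products of functions of one variable\<close>

text \<open>Products of functions of single coordinates are the only test functions that are ever constructed. Their partial
  derivatives are products of the same kind.\<close>

definition prod_fun :: "('n::finite \<Rightarrow> real \<Rightarrow> real) \<Rightarrow> real^'n \<Rightarrow> real" where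
  "prod_fun f x = (\<Prod>j\<in>UNIV. f j (x $ j))"

lemma prod_fun_deriv:
  fixes f :: "'n::finite \<Rightarrow> real \<Rightarrow> real"
  assumes "\<And>j x. (f j has_real_derivative f' j x) (at x)"
  shows "prod_fun f differentiable (at x)"
    and "partial_deriv i (prod_fun f) x = prod_fun (f(i := f' i)) x"
proof -
  have nth: "((\<lambda>x::real^'n. f j (x $ j)) has_derivative (\<lambda>y. f' j (x $ j) * y $ j)) (at x)" for j
    using has_derivative_compose[OF _ assms[unfolded has_field_derivative_def], of "\<lambda>x::real^'n. x $ j" "\<lambda>y. y $ j" x UNIV j]
    by (simp add: bounded_linear_vec_nth bounded_linear_imp_has_derivative)
  have d: "(prod_fun f has_derivative (\<lambda>y. \<Sum>i\<in>UNIV. f' i (x $ i) * y $ i * (\<Prod>j\<in>UNIV - {i}. f j (x $ j)))) (at x)"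
    unfolding prod_fun_def[abs_def] by (rule has_derivative_prod[OF nth])
  show "prod_fun f differentiable (at x)" using d by (auto simp: differentiable_def)
  have "partial_deriv i (prod_fun f) x = (\<Sum>k\<in>UNIV. f' k (x $ k) * axis i 1 $ k * (\<Prod>j\<in>UNIV - {k}. f j (x $ j)))"
    unfolding partial_deriv_def by (subst frechet_derivative_at[OF d, symmetric]) (rule refl)
  also have "\<dots> = f' i (x $ i) * (\<Prod>j\<in>UNIV - {i}. f j (x $ j))"
    by (subst sum.remove[of _ i]) (auto simp: axis_def)
  also have "\<dots> = prod_fun (f(i := f' i)) x"
    unfolding prod_fun_def by (subst (2) prod.remove[of _ i]) (auto intro!: prod.cong)
  finally show "partial_deriv i (prod_fun f) x = prod_fun (f(i := f' i)) x" .
qed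

lemma Ck_prod_fun:
  fixes f :: "'n::finite \<Rightarrow> real \<Rightarrow> real"
  assumes "\<And>j. smooth (f j)"
  shows "Ck k (prod_fun f)"
  using assms
proof (induction k arbitrary: f)
  case 0
  have "continuous_on UNIV (prod_fun f)"
    using prod_fun_deriv(1)[of f, OF smooth_has_deriv(1)[OF 0]]
    by (simp add: continuous_on_eq_continuous_within differentiable_imp_continuous_within)
  then show ?case by simp
next
  case (Suc k)
  note d = prod_fun_deriv[of f, OF smooth_has_deriv(1)[OF Suc.prems]]
  have "partial_deriv i (prod_fun f) = prod_fun (f(i := deriv (f i)))" for i
    using d(2) by blast
  moreover have "Ck k (prod_fun (f(i := deriv (f i))))" for i
    using Suc.prems by (intro Suc.IH) (auto simp: smooth_has_deriv)
  ultimately show ?case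
    using d(1) by (auto simp: differentiable_on_def)
qed

lemma test_function_prod_fun:
  fixes f :: "'n::finite \<Rightarrow> real \<Rightarrow> real"
  assumes "\<And>j. smooth (f j)" and supp: "\<And>j t. t \<notin> {a j..b j} \<Longrightarrow> f j t = 0"
  shows "test_function (prod_fun f)"
proof -
  have "{x. prod_fun f x \<noteq> 0} \<subseteq> cbox (\<chi> j. a j) (\<chi> j. b j)"
  proof
    fix x assume "x \<in> {x. prod_fun f x \<noteq> 0}"
    then have "f j (x $ j) \<noteq> 0" for j by (auto simp: prod_fun_def)
    then have "x $ j \<in> {a j..b j}" for j using supp by blast
    then show "x \<in> cbox (\<chi> j. a j) (\<chi> j. b j)" by (auto simp: mem_box_cart)
  qed
  then have "bounded (closure {x. prod_fun f x \<noteq> 0})"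
    using bounded_closure bounded_cbox bounded_subset by metis
  then show ?thesis
    using Ck_prod_fun[of f, OF assms(1)] by (simp add: test_function_def compact_eq_bounded_closed)
qed

section \<open>Integrals against the gradient measure\<close>

lemma integrable_finite_bounded:
  assumes "finite_measure M" "sets M = sets borel" "\<psi> \<in> borel_measurable borel" "\<And>x. \<bar>\<psi> x\<bar> \<le> (c::real)"
  shows "integrable M \<psi>"
proof -
  interpret finite_measure M by fact
  show ?thesis
    using assms measurable_cong_sets[OF assms(2) refl, of borel]
    by (intro integrable_const_bound[of _ c]) auto
qed

text \<open>On a set where \<open>N\<close> is dominated by \<open>M\<close> as a measure, integrals of the nonnegative function \<open>c - \<psi>\<close> compare.\<close>

lemma signed_integral_le_on:
  assumes fin: "finite_measure M" "finite_measure N" and s: "sets M = sets borel" "sets N = sets borel"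
    and Y: "Y \<in> sets borel" and le: "\<And>X. X \<in> sets borel \<Longrightarrow> X \<subseteq> Y \<Longrightarrow> emeasure N X \<le> emeasure M X"
    and psi: "\<psi> \<in> borel_measurable borel" "\<And>x. \<bar>\<psi> x\<bar> \<le> (c::real)"
  shows "(\<integral>x. indicator Y x * \<psi> x \<partial>M) - (\<integral>x. indicator Y x * \<psi> x \<partial>N) \<le> c * (measure M Y - measure N Y)"
proof -
  interpret M: finite_measure M by fact
  interpret N: finite_measure N by fact
  have c: "0 \<le> c" using psi(2)[of undefined] by linarith
  define g where "g x = indicator Y x * (c - \<psi> x)" for x
  have g0: "0 \<le> g x" and gc: "\<bar>g x\<bar> \<le> 2 * c" and gp: "ennreal (g x) = indicator Y x * ennreal (c - \<psi> x)" for x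
    using psi(2)[of x] c by (auto simp: g_def indicator_def)
  have gm: "g \<in> borel_measurable borel" unfolding g_def using psi(1) Y by measurable
  have ig: "integrable M' g" "integrable M' (\<lambda>x. indicator Y x * \<psi> x)" "integrable M' (\<lambda>x. indicator Y x * c)"
    "(\<integral>x. indicator Y x * c \<partial>M') = c * measure M' Y" if "finite_measure M'" "sets M' = sets borel" for M' :: "'a measure"
  proof -
    show "integrable M' g" by (rule integrable_finite_bounded[OF that gm gc])
    show "integrable M' (\<lambda>x. indicator Y x * \<psi> x)"
      using psi Y c by (intro integrable_finite_bounded[OF that, where c=c]) (auto simp: indicator_def)
    show "integrable M' (\<lambda>x. indicator Y x * c)"
      using Y c by (intro integrable_finite_bounded[OF that, where c=c]) (auto simp: indicator_def)
    show "(\<integral>x. indicator Y x * c \<partial>M') = c * measure M' Y"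
      using that Y by (simp add: sets_eq_imp_space_eq[of M' borel])
  qed
  have le': "density N (indicator Y) \<le> density M (indicator Y)"
  proof (subst le_measure)
    show "\<forall>A\<in>sets (density N (indicator Y)). emeasure (density N (indicator Y)) A \<le> emeasure (density M (indicator Y)) A"
    proof
      fix A assume "A \<in> sets (density N (indicator Y))"
      then have A: "A \<in> sets borel" using s by simp
      have "emeasure (density M' (indicator Y)) A = emeasure M' (Y \<inter> A)" if "sets M' = sets borel" for M' :: "'a measure"
        using A Y that by (subst emeasure_density) (auto simp: indicator_inter_arith[symmetric] cong: measurable_cong_sets)
      then show "emeasure (density N (indicator Y)) A \<le> emeasure (density M (indicator Y)) A"
        using s le[of "Y \<inter> A"] A Y by simp
    qed
  qed (use s in simp)
  have "(\<integral>\<^sup>+x. ennreal (g x) \<partial>N) = (\<integral>\<^sup>+x. ennreal (c - \<psi> x) \<partial>density N (indicator Y))"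
    using s psi Y by (subst nn_integral_density) (auto simp: gp cong: measurable_cong_sets)
  also have "\<dots> \<le> (\<integral>\<^sup>+x. ennreal (c - \<psi> x) \<partial>density M (indicator Y))"
    using le' s by (intro nn_integral_mono_measure) auto
  also have "\<dots> = (\<integral>\<^sup>+x. ennreal (g x) \<partial>M)"
    using s psi Y by (subst nn_integral_density) (auto simp: gp cong: measurable_cong_sets)
  finally have "ennreal (\<integral>x. g x \<partial>N) \<le> ennreal (\<integral>x. g x \<partial>M)"
    using ig(1) fin s g0 by (simp add: nn_integral_eq_integral)
  then have "(\<integral>x. g x \<partial>N) \<le> (\<integral>x. g x \<partial>M)"
    using g0 by (simp add: ennreal_le_iff integral_nonneg_AE)
  moreover have "(\<integral>x. g x \<partial>M') = c * measure M' Y - (\<integral>x. indicator Y x * \<psi> x \<partial>M')"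
    if "finite_measure M'" "sets M' = sets borel" for M' :: "'a measure"
    unfolding g_def right_diff_distrib using ig[OF that] by simp
  ultimately show ?thesis using fin s by (simp add: algebra_simps)
qed

text \<open>The partition of the space into \<open>Y\<close>, its complement, and empty sets is one of those in the supremum.\<close>

lemma total_variation_ge_two:
  assumes "Y \<in> sets borel"
  shows "ennreal (norm (D Y)) + ennreal (norm (D (- Y))) \<le> total_variation D UNIV"
proof -
  define A :: "nat \<Rightarrow> (real^'a) set" where "A k = (if k = 0 then Y else if k = 1 then - Y else {})" for k
  have "range A \<subseteq> sets borel" "disjoint_family A" "(\<Union>k. A k) = UNIV"
    using assms by (auto simp: A_def disjoint_family_on_def)
  then have "(\<Sum>k. ennreal (norm (D (A k)))) \<le> total_variation D UNIV"
    unfolding total_variation_def by (intro SUP_upper) auto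
  moreover have "(\<Sum>k\<in>{0,1}. ennreal (norm (D (A k)))) \<le> (\<Sum>k. ennreal (norm (D (A k))))"
    by (intro sum_le_suminf) auto
  ultimately show ?thesis by (simp add: A_def)
qed

text \<open>A vector measure dominated by a positive measure has at most the total mass of that measure as its variation.
  The dominating measure is given as a positive combination.\<close>

lemma total_variation_le:
  assumes "\<And>B. B \<in> sets borel \<Longrightarrow> norm (D B) \<le> (\<Sum>a\<in>F. c a * measure (\<mu> a) B)"
    and "\<And>a. a \<in> F \<Longrightarrow> finite_measure (\<mu> a)" "\<And>a. a \<in> F \<Longrightarrow> sets (\<mu> a) = sets borel"
    and c: "\<And>a. a \<in> F \<Longrightarrow> 0 \<le> c a"
  shows "total_variation D UNIV \<le> ennreal (\<Sum>a\<in>F. c a * measure (\<mu> a) UNIV)"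
  unfolding total_variation_def
proof (rule SUP_least, clarsimp)
  fix A :: "nat \<Rightarrow> (real^'a) set"
  assume A: "range A \<subseteq> sets borel" "disjoint_family A" "(\<Union>k. A k) = UNIV"
  have "(\<Sum>k. ennreal (norm (D (A k)))) \<le> (\<Sum>k. \<Sum>a\<in>F. ennreal (c a) * emeasure (\<mu> a) (A k))"
  proof (intro suminf_le)
    fix k
    have "ennreal (norm (D (A k))) \<le> ennreal (\<Sum>a\<in>F. c a * measure (\<mu> a) (A k))"
      using assms(1)[of "A k"] A by (intro ennreal_leI) auto
    also have "\<dots> = (\<Sum>a\<in>F. ennreal (c a) * emeasure (\<mu> a) (A k))"
      using assms(2) c by (simp add: sum_ennreal[symmetric] ennreal_mult finite_measure.emeasure_eq_measure cong: sum.cong)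
    finally show "ennreal (norm (D (A k))) \<le> (\<Sum>a\<in>F. ennreal (c a) * emeasure (\<mu> a) (A k))" .
  qed auto
  also have "\<dots> = (\<Sum>a\<in>F. \<Sum>k. ennreal (c a) * emeasure (\<mu> a) (A k))"
    by (rule suminf_sum) auto
  also have "\<dots> = (\<Sum>a\<in>F. ennreal (c a) * emeasure (\<mu> a) UNIV)"
    using A assms(3) by (auto simp: suminf_emeasure cong: sum.cong intro!: sum.cong)
  also have "\<dots> = ennreal (\<Sum>a\<in>F. c a * measure (\<mu> a) UNIV)"
    using assms(2) c by (simp add: sum_ennreal[symmetric] ennreal_mult finite_measure.emeasure_eq_measure cong: sum.cong)
  finally show "(\<Sum>k. ennreal (norm (D (A k)))) \<le> ennreal (\<Sum>a\<in>F. c a * measure (\<mu> a) UNIV)" .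
qed

lemma is_distr_gradientE:
  assumes "is_distr_gradient u D"
  obtains M N where "finite_measure M" "finite_measure N" "sets M = sets borel" "sets N = sets borel"
    "\<And>B. B \<in> sets borel \<Longrightarrow> D B $ i = measure M B - measure N B"
    "\<And>\<phi>. test_function \<phi> \<Longrightarrow> (\<integral>x. u x * partial_deriv i \<phi> x \<partial>lborel) = - ((\<integral>x. \<phi> x \<partial>M) - (\<integral>x. \<phi> x \<partial>N))"
  using assms unfolding is_distr_gradient_def by (elim allE[of _ i] exE conjE) (rule that; blast)

text \<open>Each component is a difference of two finite measures, and the sum of all of them dominates.\<close>

lemma total_variation_finite:
  assumes "is_distr_gradient u D"
  shows "total_variation D UNIV < top"
proof -
  obtain M N where MN: "\<And>i. finite_measure (M i) \<and> finite_measure (N i) \<and> sets (M i) = sets borel \<and> sets (N i) = sets borel \<and>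
      (\<forall>B\<in>sets borel. D B $ i = measure (M i) B - measure (N i) B)"
    using assms unfolding is_distr_gradient_def by metis
  define \<mu> where "\<mu> p = (if snd p then M (fst p) else N (fst p))" for p
  have "total_variation D UNIV \<le> ennreal (\<Sum>p\<in>UNIV\<times>UNIV. 1 * measure (\<mu> p) UNIV)"
  proof (rule total_variation_le)
    fix B :: "(real^'a) set" assume "B \<in> sets borel"
    then have "norm (D B) \<le> (\<Sum>i\<in>UNIV. \<bar>measure (M i) B - measure (N i) B\<bar>)"
      using norm_le_l1_cart[of "D B"] MN by simp
    also have "\<dots> \<le> (\<Sum>i\<in>UNIV. measure (M i) B + measure (N i) B)"
      by (intro sum_mono) (simp add: abs_le_iff)
    also have "\<dots> = (\<Sum>p\<in>UNIV\<times>UNIV. 1 * measure (\<mu> p) B)"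
      by (simp add: sum.cartesian_product' UNIV_bool \<mu>_def add.commute del: UNIV_Times_UNIV)
    finally show "norm (D B) \<le> (\<Sum>p\<in>UNIV\<times>UNIV. 1 * measure (\<mu> p) B)" .
  qed (use MN in \<open>auto simp: \<mu>_def\<close>)
  then show ?thesis by (metis ennreal_less_top le_less_trans)
qed

text \<open>One component of \<open>D\<close> is compared with the total variation by a Hahn decomposition \<open>Y\<close>, \<open>-Y\<close> of that component:
  on each of the two sets the component has a sign, and the partition into these two sets already bounds the
  variation from below.\<close>

lemma signed_integral_le:
  assumes fin: "finite_measure M" "finite_measure N" and s: "sets M = sets borel" "sets N = sets borel"
    and D: "\<And>B. B \<in> sets borel \<Longrightarrow> D B $ i = measure M B - measure N B"
    and psi: "\<psi> \<in> borel_measurable borel" "\<And>x. \<bar>\<psi> x\<bar> \<le> (c::real)"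
    and TV: "total_variation D UNIV < top"
  shows "\<bar>(\<integral>x. \<psi> x \<partial>M) - (\<integral>x. \<psi> x \<partial>N)\<bar> \<le> c * enn2real (total_variation D UNIV)"
proof -
  have c: "0 \<le> c" using psi(2)[of undefined] by linarith
  obtain Y where Y: "Y \<in> sets borel" "\<And>X. X \<in> sets borel \<Longrightarrow> X \<subseteq> Y \<Longrightarrow> emeasure N X \<le> emeasure M X"
    "\<And>X. X \<in> sets borel \<Longrightarrow> X \<subseteq> - Y \<Longrightarrow> emeasure M X \<le> emeasure N X"
    using unsigned_Hahn_decomposition[of N M UNIV] fin s
    by (auto simp: finite_measure.emeasure_finite disjoint_eq_subset_Compl)
  have *: "(\<integral>x. \<psi> x \<partial>M) - (\<integral>x. \<psi> x \<partial>N) \<le> c * enn2real (total_variation D UNIV)"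
    if psi: "\<psi> \<in> borel_measurable borel" "\<And>x. \<bar>\<psi> x\<bar> \<le> c" for \<psi>
  proof -
    have split: "(\<integral>x. \<psi> x \<partial>M') = (\<integral>x. indicator Y x * \<psi> x \<partial>M') - (\<integral>x. indicator (- Y) x * - \<psi> x \<partial>M')"
      if "finite_measure M'" "sets M' = sets borel" for M' :: "(real^'a) measure"
    proof -
      have "(\<integral>x. \<psi> x \<partial>M') = (\<integral>x. indicator Y x * \<psi> x - indicator (- Y) x * - \<psi> x \<partial>M')"
        by (intro Bochner_Integration.integral_cong) (auto simp: indicator_def)
      also have "\<dots> = (\<integral>x. indicator Y x * \<psi> x \<partial>M') - (\<integral>x. indicator (- Y) x * - \<psi> x \<partial>M')"
        using psi Y(1) c that
        by (intro Bochner_Integration.integral_diff integrable_finite_bounded[where c=c]) (auto simp: indicator_def)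
      finally show ?thesis .
    qed
    have "(\<integral>x. indicator Y x * \<psi> x \<partial>M) - (\<integral>x. indicator Y x * \<psi> x \<partial>N) \<le> c * (measure M Y - measure N Y)"
      by (rule signed_integral_le_on[OF fin s Y(1,2) psi])
    moreover have "(\<integral>x. indicator (-Y) x * - \<psi> x \<partial>N) - (\<integral>x. indicator (-Y) x * - \<psi> x \<partial>M) \<le> c * (measure N (-Y) - measure M (-Y))"
      using psi Y by (intro signed_integral_le_on[OF fin(2,1) s(2,1)]) auto
    ultimately have "(\<integral>x. \<psi> x \<partial>M) - (\<integral>x. \<psi> x \<partial>N) \<le> c * (D Y $ i - D (- Y) $ i)"
      using Y(1) by (simp add: split[OF fin(1) s(1)] split[OF fin(2) s(2)] D algebra_simps)
    also have "\<dots> \<le> c * (norm (D Y) + norm (D (- Y)))"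
      using component_le_norm_cart[of "D Y" i] component_le_norm_cart[of "D (-Y)" i] c
      by (intro mult_left_mono) auto
    also have "norm (D Y) + norm (D (- Y)) \<le> enn2real (total_variation D UNIV)"
      using enn2real_mono[OF total_variation_ge_two[OF Y(1), of D] TV]
      by (simp add: ennreal_plus[symmetric] del: ennreal_plus)
    finally show ?thesis using c by (simp add: mult_left_mono)
  qed
  show ?thesis
    using *[OF psi] *[of "\<lambda>x. - \<psi> x"] psi by (auto simp: abs_le_iff)
qed

section \<open>The test identity for limits of test functions\<close>

lemma prod_fun_tendsto:
  assumes "\<And>j t. (\<lambda>n. F n j t) \<longlonglongrightarrow> G j t"
  shows "(\<lambda>n. prod_fun (F n) x) \<longlonglongrightarrow> prod_fun G x"
  unfolding prod_fun_def by (intro tendsto_prod assms)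

lemma prod_fun_bound:
  fixes f :: "'n::finite \<Rightarrow> real \<Rightarrow> real"
  assumes "\<And>j t. \<bar>f j t\<bar> \<le> C"
  shows "\<bar>prod_fun f x\<bar> \<le> C ^ CARD('n)"
  unfolding prod_fun_def abs_prod using prod_mono[of UNIV "\<lambda>j. \<bar>f j (x $ j)\<bar>" "\<lambda>_. C"] assms by simp

lemma prod_fun_measurable:
  fixes f :: "'n::finite \<Rightarrow> real \<Rightarrow> real"
  assumes "\<And>j. f j \<in> borel_measurable borel"
  shows "prod_fun f \<in> borel_measurable borel"
proof -
  have "(\<lambda>x::real^'n. f j (x $ j)) \<in> borel_measurable borel" for j
    using assms[of j] by measurable
  then show ?thesis unfolding prod_fun_def[abs_def] by (intro borel_measurable_prod) auto
qed

lemma smooth_measurable: "smooth f \<Longrightarrow> f \<in> borel_measurable borel"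
  using smooth_has_deriv(1)[of f]
  by (intro borel_measurable_continuous_onI) (auto intro!: DERIV_isCont simp: continuous_on_eq_continuous_at)

lemma bounded_integral_tendsto:
  fixes \<psi> :: "nat \<Rightarrow> 'a::topological_space \<Rightarrow> real"
  assumes "finite_measure M" "sets M = sets borel"
    "\<And>n. \<psi> n \<in> borel_measurable borel" "\<psi>' \<in> borel_measurable borel" "\<And>n x. \<bar>\<psi> n x\<bar> \<le> c"
    "\<And>x. (\<lambda>n. \<psi> n x) \<longlonglongrightarrow> \<psi>' x"
  shows "(\<lambda>n. \<integral>x. \<psi> n x \<partial>M) \<longlonglongrightarrow> (\<integral>x. \<psi>' x \<partial>M)"
proof -
  interpret finite_measure M by fact
  show ?thesis
    using assms measurable_cong_sets[OF assms(2) refl, of borel]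
    by (intro integral_dominated_convergence[where w="\<lambda>_. c"]) auto
qed

text \<open>The defining identity of the gradient passes to bounded pointwise limits of test functions and of their
  derivatives. This admits as test functions products of a Lipschitz function of \<open>x\<^sub>i\<close> and indicators of
  intervals in the other coordinates.\<close>

lemma distr_gradient_prod_fun:
  fixes F :: "nat \<Rightarrow> 'n::finite \<Rightarrow> real \<Rightarrow> real" and u :: "real^'n \<Rightarrow> real"
  assumes fin: "finite_measure M" "finite_measure N" and s: "sets M = sets borel" "sets N = sets borel"
    and D: "\<And>\<phi>. test_function \<phi> \<Longrightarrow> 
       (\<integral>x. u x * partial_deriv i \<phi> x \<partial>lborel) = - ((\<integral>x. \<phi> x \<partial>M) - (\<integral>x. \<phi> x \<partial>N))"
    and u: "integrable lborel u"
    and sm: "\<And>n j. smooth (F n j)" and supp: "\<And>n j t. t \<notin> {a j..b j} \<Longrightarrow> F n j t = 0"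
    and d: "\<And>n t. (F n i has_real_derivative F' n t) (at t)"
    and bd: "\<And>n j t. \<bar>F n j t\<bar> \<le> C" "\<And>n t. \<bar>F' n t\<bar> \<le> C"
    and lim: "\<And>j t. (\<lambda>n. F n j t) \<longlonglongrightarrow> G j t" "\<And>t. (\<lambda>n. F' n t) \<longlonglongrightarrow> G' t"
  shows "(\<integral>x. u x * prod_fun (G(i := G')) x \<partial>lborel) = - ((\<integral>x. prod_fun G x \<partial>M) - (\<integral>x. prod_fun G x \<partial>N))"
proof -
  have smF': "smooth (F' n)" for n using smooth_deriv[OF sm d] .
  have meas: "prod_fun (F n) \<in> borel_measurable borel" "prod_fun ((F n)(i := F' n)) \<in> borel_measurable borel" for n
    by (auto intro!: prod_fun_measurable smooth_measurable sm smF')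
  have limP: "(\<lambda>n. prod_fun (F n) x) \<longlonglongrightarrow> prod_fun G x" 
     "(\<lambda>n. prod_fun ((F n)(i := F' n)) x) \<longlonglongrightarrow> prod_fun (G(i := G')) x" for x
    by (auto intro!: prod_fun_tendsto lim)
  have bP: "\<bar>prod_fun (F n) x\<bar> \<le> C ^ CARD('n)" "\<bar>prod_fun ((F n)(i := F' n)) x\<bar> \<le> C ^ CARD('n)" for n x
    by (auto intro!: prod_fun_bound bd)
  have measG: "prod_fun G \<in> borel_measurable borel" "prod_fun (G(i:=G')) \<in> borel_measurable borel"
    using borel_measurable_LIMSEQ_real[OF limP(1) meas(1)] borel_measurable_LIMSEQ_real[OF limP(2) meas(2)] by auto
  have id: "(\<integral>x. u x * prod_fun ((F n)(i := F' n)) x \<partial>lborel) = - ((\<integral>x. prod_fun (F n) x \<partial>M) - (\<integral>x. prod_fun (F n) x \<partial>N))" for n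
  proof -
    have "partial_deriv i (prod_fun (F n)) x = prod_fun ((F n)(i := F' n)) x" for x
      using prod_fun_deriv(2)[of "F n" "\<lambda>j. if j = i then F' n else deriv (F n j)" i x] d smooth_has_deriv(1)[OF sm]
      by simp
    with D[OF test_function_prod_fun[of "F n", OF sm supp]] show ?thesis by simp
  qed
  have "(\<lambda>n. (\<integral>x. u x * prod_fun ((F n)(i := F' n)) x \<partial>lborel)) \<longlonglongrightarrow> (\<integral>x. u x * prod_fun (G(i := G')) x \<partial>lborel)"
  proof (rule integral_dominated_convergence[where w="\<lambda>x. \<bar>u x\<bar> * C ^ CARD('n)"])
    show "AE x in lborel. (\<lambda>n. u x * prod_fun ((F n)(i := F' n)) x) \<longlonglongrightarrow> u x * prod_fun (G(i := G')) x"
      by (intro AE_I2 tendsto_mult limP tendsto_const)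
    show "AE x in lborel. norm (u x * prod_fun ((F n)(i := F' n)) x) \<le> \<bar>u x\<bar> * C ^ CARD('n)" for n
      by (intro AE_I2) (auto simp: abs_mult intro!: mult_left_mono bP)
  qed (use u meas measG in \<open>auto intro!: integrable_mult_left\<close>)
  moreover have "(\<lambda>n. - ((\<integral>x. prod_fun (F n) x \<partial>M) - (\<integral>x. prod_fun (F n) x \<partial>N))) \<longlonglongrightarrow>
     - ((\<integral>x. prod_fun G x \<partial>M) - (\<integral>x. prod_fun G x \<partial>N))"
    by (intro tendsto_intros bounded_integral_tendsto[where c="C ^ CARD('n)"] fin s meas measG bP limP)
  ultimately show ?thesis unfolding id by (rule LIMSEQ_unique)
qed

text \<open>The bump functions of a box converge to its indicator, so two gradients agree on open boxes, which form a
  generator of the Borel sets that is stable under intersection.\<close>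

lemma distr_gradient_unique:
  fixes u :: "real^'n::finite \<Rightarrow> real"
  assumes "is_distr_gradient u D" "is_distr_gradient u E" "B \<in> sets borel"
  shows "D B = E B"
proof -
  have "D B $ i = E B $ i" for i
  proof -
    obtain M N where M: "finite_measure M" "finite_measure N" "sets M = sets borel" "sets N = sets borel"
      "\<And>B. B \<in> sets borel \<Longrightarrow> D B $ i = measure M B - measure N B"
      "\<And>\<phi>. test_function \<phi> \<Longrightarrow> (\<integral>x. u x * partial_deriv i \<phi> x \<partial>lborel) = - ((\<integral>x. \<phi> x \<partial>M) - (\<integral>x. \<phi> x \<partial>N))"
      by (rule is_distr_gradientE[OF assms(1)]) blast
    obtain P Q where P: "finite_measure P" "finite_measure Q" "sets P = sets borel" "sets Q = sets borel"
      "\<And>B. B \<in> sets borel \<Longrightarrow> E B $ i = measure P B - measure Q B"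
      "\<And>\<phi>. test_function \<phi> \<Longrightarrow> (\<integral>x. u x * partial_deriv i \<phi> x \<partial>lborel) = - ((\<integral>x. \<phi> x \<partial>P) - (\<integral>x. \<phi> x \<partial>Q))"
      by (rule is_distr_gradientE[OF assms(2)]) blast
    interpret M: finite_measure M by fact
    interpret N: finite_measure N by fact
    interpret P: finite_measure P by fact
    interpret Q: finite_measure Q by fact
    have sp: "space M = UNIV" "space N = UNIV" "space P = UNIV" "space Q = UNIV"
      using M P by (auto dest!: sets_eq_imp_space_eq)
    \<comment> \<open>The sets on which the two components agree are those with \<open>bad B = 0\<close>; they contain the open boxes and are
      closed under complements and disjoint countable unions.\<close>
    define bad where "bad B = (measure M B - measure N B) - (measure P B - measure Q B)" for B
    have box: "bad (box a b) = 0" for a b :: "real^'n"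
    proof -
      define F :: "nat \<Rightarrow> 'n \<Rightarrow> real \<Rightarrow> real" where "F n j = bump n (a $ j) (b $ j)" for n j
      have G: "prod_fun (\<lambda>j. indicator {a $ j<..<b $ j}) = (indicator (box a b) :: real^'n \<Rightarrow> real)"
        by (rule ext) (auto simp: prod_fun_def indicator_def mem_box_cart prod_zero_iff)
      have L: "(\<lambda>n. \<integral>x. prod_fun (F n) x \<partial>M') \<longlonglongrightarrow> measure M' (box a b)" if "finite_measure M'" "sets M' = sets borel" for M'
      proof -
        have "(\<lambda>n. \<integral>x. prod_fun (F n) x \<partial>M') \<longlonglongrightarrow> (\<integral>x. prod_fun (\<lambda>j. indicator {a $ j<..<b $ j}) x \<partial>M')"
        proof (intro bounded_integral_tendsto[where c="1 ^ CARD('n)"] prod_fun_bound prod_fun_tendsto)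
          show "\<bar>F n j t\<bar> \<le> 1" for n j t using bump_bounds by (simp add: F_def)
          show "(\<lambda>n. F n j t) \<longlonglongrightarrow> indicator {a $ j<..<b $ j} t" for j t by (simp add: F_def bump_tendsto)
          show "prod_fun (F n) \<in> borel_measurable borel" for n
            by (simp add: F_def prod_fun_measurable smooth_measurable smooth_bump)
        qed (use that in \<open>auto intro!: prod_fun_measurable\<close>)
        then show ?thesis using that by (simp add: G sets_eq_imp_space_eq[of M' borel])
      qed
      have "test_function (prod_fun (F n))" for n
        using smooth_bump bump_outside by (intro test_function_prod_fun[where a="\<lambda>j. a $ j" and b="\<lambda>j. b $ j"]) (auto simp: F_def)
      note tf = this
      have z: "((\<integral>x. prod_fun (F n) x \<partial>M) - (\<integral>x. prod_fun (F n) x \<partial>N)) - ((\<integral>x. prod_fun (F n) x \<partial>P) - (\<integral>x. prod_fun (F n) x \<partial>Q)) = 0" for n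
        using M(6)[OF tf] P(6)[OF tf] by (metis diff_self neg_equal_iff_equal)
      have "(\<lambda>n. ((\<integral>x. prod_fun (F n) x \<partial>M) - (\<integral>x. prod_fun (F n) x \<partial>N)) - ((\<integral>x. prod_fun (F n) x \<partial>P) - (\<integral>x. prod_fun (F n) x \<partial>Q)))
        \<longlonglongrightarrow> bad (box a b)"
        unfolding bad_def by (intro tendsto_diff L M P)
      then show ?thesis unfolding z by (simp add: LIMSEQ_const_iff)
    qed
    have un: "bad (\<Union>i. A i) = 0" if "disjoint_family A" "range A \<subseteq> sets borel" "\<And>i. bad (A i) = 0" for A :: "nat \<Rightarrow> (real^'n) set"
    proof -
      have "(\<lambda>i. bad (A i)) sums bad (\<Union>i. A i)"
        unfolding bad_def using that M P
        by (intro sums_diff M.finite_measure_UNION N.finite_measure_UNION P.finite_measure_UNION Q.finite_measure_UNION) auto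
      then have "(\<lambda>i. 0) sums bad (\<Union>i. A i)" using that(3) by simp
      then show ?thesis using sums_zero sums_unique2 by blast
    qed
    have UN: "bad UNIV = 0"
    proof -
      have inc: "incseq (\<lambda>n. box (- real n *\<^sub>R One) (real n *\<^sub>R One :: real^'n))"
        unfolding incseq_def
      proof (intro allI impI subsetI)
        fix m n :: nat and x :: "real^'n"
        assume "m \<le> n" and x: "x \<in> box (- real m *\<^sub>R One) (real m *\<^sub>R One)"
        then have "real m \<le> real n" by simp
        with x show "x \<in> box (- real n *\<^sub>R One) (real n *\<^sub>R One)"
          unfolding mem_box by (force simp: inner_minus_left)
      qed
      have "(\<Union>n. box (- real n *\<^sub>R One) (real n *\<^sub>R One :: real^'n)) = UNIV"
        using UN_box_eq_UNIV[where 'a="real^'n"] by (simp only: scaleR_minus_left)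
      then have "(\<lambda>n. bad (box (- real n *\<^sub>R One) (real n *\<^sub>R One))) \<longlonglongrightarrow> bad UNIV"
      proof -
        assume U: "(\<Union>n. box (- real n *\<^sub>R One) (real n *\<^sub>R One :: real^'n)) = UNIV"
        have L: "(\<lambda>n. measure M' (box (- real n *\<^sub>R One) (real n *\<^sub>R One))) \<longlonglongrightarrow> measure M' UNIV"
          if "finite_measure M'" "sets M' = sets borel" for M' :: "(real^'n) measure"
        proof -
          have "range (\<lambda>n. box (- real n *\<^sub>R One) (real n *\<^sub>R One :: real^'n)) \<subseteq> sets M'"
            unfolding that(2) by (rule image_subsetI) (rule borel_open[OF open_box])
          from finite_measure.finite_Lim_measure_incseq[OF that(1) this inc] show ?thesis unfolding U .
        qed
        show ?thesis unfolding bad_def by (intro tendsto_diff L M P)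
      qed
      then show ?thesis by (simp add: box LIMSEQ_const_iff)
    qed
    have "bad B = 0"
    proof (rule sigma_sets_induct_disjoint[of "range (\<lambda>(a, b). box a b :: (real^'n) set)" UNIV B])
      show "Int_stable (range (\<lambda>(a, b). box a b :: (real^'n) set))"
        by (auto simp: Int_stable_def box_Int_box)
      show "B \<in> sigma_sets UNIV (range (\<lambda>(a, b). box a b))"
        using assms(3) unfolding borel_eq_box by simp
      show "bad {} = 0" by (simp add: bad_def)
      fix A :: "(real^'n) set" assume A: "A \<in> sigma_sets UNIV (range (\<lambda>(a, b). box a b))" "bad A = 0"
      then have "A \<in> sets borel" unfolding borel_eq_box by simp
      then have "bad (UNIV - A) = bad UNIV - bad A"
        unfolding bad_def using M P sp
          M.finite_measure_compl[of A] N.finite_measure_compl[of A] P.finite_measure_compl[of A] Q.finite_measure_compl[of A]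
        by simp
      then show "bad (UNIV - A) = 0" using A UN by simp
    next
      fix A :: "nat \<Rightarrow> (real^'n) set" assume "disjoint_family A" "range A \<subseteq> sigma_sets UNIV (range (\<lambda>(a, b). box a b))" "\<And>i. bad (A i) = 0"
      then show "bad (\<Union>i. A i) = 0"
        by (intro un) (auto simp: borel_eq_box)
    qed (auto simp: box)
    with M(5) P(5) assms(3) show ?thesis by (simp add: bad_def)
  qed
  then show ?thesis by (simp add: vec_eq_iff)
qed

section \<open>Tent functions and jumps between neighbouring cubes\<close>

definition ramp :: "real \<Rightarrow> real \<Rightarrow> real" where
  "ramp h t = max 0 (min h t)"

text \<open>Primitives of the bumps are smooth approximations of the ramp, with the bounds needed for dominated convergence.\<close>

lemma bump_primitive:
  assumes h: "h > 0"
  obtains B where "\<And>n t. (B n has_real_derivative bump n 0 h t) (at t)"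
    "\<And>n t. t \<le> 0 \<Longrightarrow> B n t = 0" "\<And>n t. t \<ge> h \<Longrightarrow> B n t = B n h"
    "\<And>n t. 0 \<le> B n t" "\<And>n t. B n t \<le> h" "\<And>t. (\<lambda>n. B n t) \<longlonglongrightarrow> ramp h t"
proof -
  have cont: "isCont (bump n 0 h) x" for n x
    by (rule DERIV_isCont[OF smooth_has_deriv(1)[OF smooth_bump]])
  have "\<exists>F. \<forall>x. (F has_vector_derivative bump n 0 h x) (at x)" for n
    using einterval_antiderivative[of "-\<infinity>" "\<infinity>" "bump n 0 h"] cont by auto
  then obtain F where F: "\<And>n x. (F n has_vector_derivative bump n 0 h x) (at x)" by metis
  define B where "B n t = F n t - F n 0" for n t
  have d: "(B n has_real_derivative bump n 0 h t) (at t)" for n t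
    using F[of n t] unfolding B_def has_real_derivative_iff_has_vector_derivative
    by (auto intro!: derivative_eq_intros)
  have d0: "(B n has_real_derivative 0) (at x)" if "x < 0 \<or> h < x" for n x
    using d[of n x] bump_outside[of x 0 h n] that by auto
  have z: "B n t = 0" if "t \<le> 0" for n t
  proof -
    have "B n 0 = B n t" if "t < 0"
      using d0 that by (intro DERIV_isconst_end continuous_at_imp_continuous_on ballI DERIV_isCont[OF d]) auto
    then show ?thesis using that by (cases "t = 0") (auto simp: B_def)
  qed
  have c: "B n t = B n h" if "t \<ge> h" for n t
  proof (cases "t = h")
    case False
    then show ?thesis using that d0
      by (intro DERIV_isconst_end continuous_at_imp_continuous_on ballI DERIV_isCont[OF d]) auto
  qed simp
  have hi: "(bump n 0 h has_integral B n t) {0..t}" if "0 \<le> t" for n t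
    using fundamental_theorem_of_calculus[of 0 t "B n" "bump n 0 h"] that d z[of 0 n]
    by (auto simp: has_real_derivative_iff_has_vector_derivative has_vector_derivative_at_within)
  have lim1: "(\<lambda>n. B n t) \<longlonglongrightarrow> ramp h t" and bd1: "0 \<le> B n t" "B n t \<le> h" if t: "0 \<le> t" "t \<le> h" for t n
  proof -
    have "((\<lambda>s. 1::real) has_integral t) {0..t}"
      using has_integral_const_real[of "1::real" 0 t] t by simp
    then have "(indicator {0<..<h} has_integral t) {0..t}"
      by (rule has_integral_spike_finite[of "{0, t}", rotated 2]) (use t in \<open>auto simp: indicator_def\<close>)
    moreover have "(\<lambda>n. integral {0..t} (bump n 0 h)) \<longlonglongrightarrow> integral {0..t} (indicator {0<..<h})"
      by (rule dominated_convergence(2)[where h="\<lambda>_. 1"])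
         (use hi[OF t(1)] bump_bounds bump_tendsto in \<open>auto simp: integrable_on_def\<close>)
    ultimately show "(\<lambda>n. B n t) \<longlonglongrightarrow> ramp h t"
      using t integral_unique[OF hi[OF t(1)]] by (simp add: integral_unique ramp_def)
    show "0 \<le> B n t" using has_integral_nonneg[OF hi[OF t(1)]] bump_bounds by blast
    have "B n t \<le> t"
      using has_integral_le[OF hi[OF t(1)] \<open>((\<lambda>s. 1::real) has_integral t) {0..t}\<close>] bump_bounds by blast
    then show "B n t \<le> h" using t by simp
  qed
  show ?thesis
  proof
    fix t :: real and n :: nat
    consider "t < 0" | "0 \<le> t" "t \<le> h" | "h < t" by linarith
    note cs = this
    show "0 \<le> B n t" using cs by cases (use bd1[of t n] bd1[of h n] h z[of t n] c[of t n] in auto)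
    show "B n t \<le> h" using cs by cases (use bd1[of t n] bd1[of h n] h z[of t n] c[of t n] in auto)
    show "(\<lambda>n. B n t) \<longlonglongrightarrow> ramp h t"
      using cs
    proof cases
      case 3
      then show ?thesis using lim1[of h] c[of t] h by (simp add: ramp_def)
    qed (use lim1 z h in \<open>auto simp: ramp_def\<close>)
    show "(B n has_real_derivative bump n 0 h t) (at t)" by (rule d)
    show "t \<le> 0 \<Longrightarrow> B n t = 0" by (rule z)
    show "h \<le> t \<Longrightarrow> B n t = B n h" by (rule c)
  qed
qed

text \<open>The tent over \<open>[0, 2h]\<close>: slope \<open>1\<close> up to height \<open>h\<close>, then slope \<open>-1\<close> down to \<open>0\<close>.\<close>

definition tent :: "real \<Rightarrow> real \<Rightarrow> real" where
  "tent h t = ramp h t - ramp h (t - h)"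

text \<open>A tent in direction \<open>i\<close> over two adjacent cubes of side \<open>h\<close>, namely the cube with lower corner \<open>a\<close> and its
  neighbour in direction \<open>i\<close>. Its partial derivative in direction \<open>i\<close> is the indicator of the first cube minus that
  of the second.\<close>

definition tent_fun :: "real \<Rightarrow> 'n \<Rightarrow> ('n \<Rightarrow> real) \<Rightarrow> real^'n::finite \<Rightarrow> real" where
  "tent_fun h i a = prod_fun (\<lambda>j t. if j = i then tent h (t - a j) else indicator {a j<..<a j + h} t)"

text \<open>The test identity for the tent, by smooth approximation: in direction \<open>i\<close> by differences of primitives of
  bumps, in the other directions by bumps.\<close>

lemma distr_gradient_tent:
  fixes u :: "real^'n::finite \<Rightarrow> real"
  assumes fin: "finite_measure M" "finite_measure N" and s: "sets M = sets borel" "sets N = sets borel"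
    and D: "\<And>\<phi>. test_function \<phi> \<Longrightarrow> 
       (\<integral>x. u x * partial_deriv i \<phi> x \<partial>lborel) = - ((\<integral>x. \<phi> x \<partial>M) - (\<integral>x. \<phi> x \<partial>N))"
    and u: "integrable lborel u" and h: "h > 0"
  shows "(\<integral>x. tent_fun h i a x \<partial>M) - (\<integral>x. tent_fun h i a x \<partial>N) =
    (\<integral>x. u x * indicator (box (\<chi> j. (a(i := a i + h)) j) (\<chi> j. (a(i := a i + h)) j + h)) x \<partial>lborel)
    - (\<integral>x. u x * indicator (box (\<chi> j. a j) (\<chi> j. a j + h)) x \<partial>lborel)"
proof -
  obtain B where B: "\<And>n t. (B n has_real_derivative bump n 0 h t) (at t)"
    "\<And>n t. t \<le> 0 \<Longrightarrow> B n t = 0" "\<And>n t. t \<ge> h \<Longrightarrow> B n t = B n h"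
    "\<And>n t. 0 \<le> B n t" "\<And>n t. B n t \<le> h" "\<And>t. (\<lambda>n. B n t) \<longlonglongrightarrow> ramp h t"
    by (rule bump_primitive[OF h]) blast
  define F :: "nat \<Rightarrow> 'n \<Rightarrow> real \<Rightarrow> real" where
    "F n j t = (if j = i then B n (t - a i) - B n (t - (a i + h)) else bump n (a j) (a j + h) t)" for n j t
  define F' where "F' n t = bump n 0 h (t - a i) - bump n 0 h (t - (a i + h))" for n t
  define G where "G j t = (if j = i then tent h (t - a j) else indicator {a j<..<a j + h} t)" for j t
  define G' where "G' t = indicator {0<..<h} (t - a i) - (indicator {0<..<h} (t - (a i + h)) :: real)" for t
  have smB: "smooth (\<lambda>t. B n (t - b))" for n b
    using smooth_affine[OF smooth_antideriv[OF B(1) smooth_bump], of n 1 "- b"] by simp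
  have "(\<integral>x. u x * prod_fun (G(i := G')) x \<partial>lborel) = - ((\<integral>x. prod_fun G x \<partial>M) - (\<integral>x. prod_fun G x \<partial>N))"
  proof (rule distr_gradient_prod_fun[OF fin s D u, where F=F and F'=F' and a=a and b="\<lambda>j. a j + 2 * h" and C="max 1 h"])
    show "smooth (F n j)" for n j
    proof (cases "j = i")
      case True
      then show ?thesis using smooth_diff[OF smB[of n "a i"] smB[of n "a i + h"]] by (simp add: F_def[abs_def])
    qed (simp add: F_def[abs_def] smooth_bump)
    show "F n j t = 0" if "t \<notin> {a j..a j + 2 * h}" for n j t
      using that h B(2)[of "t - a i" n] B(2)[of "t - (a i + h)" n] B(3)[of "t - a i" n] B(3)[of "t - (a i + h)" n] bump_outside[of t "a j" "a j + h" n]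
      by (cases "j = i"; cases "t < a j") (auto simp: F_def)
    show "(F n i has_real_derivative F' n t) (at t)" for n t
      unfolding F_def F'_def
      by (auto intro!: derivative_eq_intros DERIV_chain2[OF B(1)])
    show "\<bar>F n j t\<bar> \<le> max 1 h" for n j t
    proof (cases "j = i")
      case True
      then show ?thesis
        using B(4)[of n "t - a i"] B(4)[of n "t - (a i + h)"] B(5)[of n "t - a i"] B(5)[of n "t - (a i + h)"]
        unfolding F_def abs_le_iff max_def by (simp; linarith)
    next
      case False
      then show ?thesis using bump_bounds[of n "a j" "a j + h" t] by (simp add: F_def)
    qed
    show "\<bar>F' n t\<bar> \<le> max 1 h" for n t
      using bump_bounds[of n 0 h "t - a i"] bump_bounds[of n 0 h "t - (a i + h)"]
      unfolding F'_def abs_le_iff max_def by (simp; linarith)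
    show "(\<lambda>n. F n j t) \<longlonglongrightarrow> G j t" for j t
      unfolding F_def G_def tent_def using B(6) bump_tendsto
      by (auto intro!: tendsto_diff simp: algebra_simps)
    show "(\<lambda>n. F' n t) \<longlonglongrightarrow> G' t" for t
      unfolding F'_def G'_def by (intro tendsto_diff bump_tendsto)
  qed
  moreover have "prod_fun (G(i := G')) x = indicator (box (\<chi> j. a j) (\<chi> j. a j + h)) x - indicator (box (\<chi> j. (a(i := a i + h)) j) (\<chi> j. (a(i := a i + h)) j + h)) x" for x
  proof -
    have ind: "indicator (box (\<chi> j. b j) (\<chi> j. b j + h)) x = (\<Prod>j\<in>UNIV. indicator {b j<..<b j + h} (x $ j) :: real)" for b :: "'n \<Rightarrow> real"
      by (auto simp: indicator_def mem_box_cart prod_zero_iff)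
    show ?thesis
      unfolding prod_fun_def ind
      by (simp add: prod.remove[of UNIV i] G_def G'_def algebra_simps)
        (auto simp: indicator_def algebra_simps)
  qed
  moreover have "integrable lborel (\<lambda>x. u x * indicator (box a b) x)" for a b :: "real^'n"
    using integrable_real_mult_indicator[OF _ u, of "box a b"] by simp
  ultimately show ?thesis
    unfolding tent_fun_def G_def by (simp add: right_diff_distrib)
qed

section \<open>Cubes of the regular grid\<close>

definition grid :: "nat \<Rightarrow> ('n \<Rightarrow> nat) set" where
  "grid N = {k. \<forall>i. k i < N}"

text \<open>The cubes are closed, as the dyadic cubes are; distinct ones overlap in null sets.\<close>

definition cell :: "nat \<Rightarrow> ('n::finite \<Rightarrow> nat) \<Rightarrow> (real^'n) set" where
  "cell N k = cbox (\<chi> i. real (k i) / real N) (\<chi> i. (real (k i) + 1) / real N)"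

definition cell_int :: "nat \<Rightarrow> (real^'n \<Rightarrow> real) \<Rightarrow> ('n::finite \<Rightarrow> nat) \<Rightarrow> real" where
  "cell_int N u k = (\<integral>x. u x * indicator (cell N k) x \<partial>lborel)"

lemma grid_PiE: "grid N = (UNIV \<rightarrow>\<^sub>E {..<N})"
  by (auto simp: grid_def PiE_def extensional_def)

lemma finite_grid [simp]: "finite (grid N :: ('n::finite \<Rightarrow> nat) set)"
  unfolding grid_PiE by (intro finite_PiE) auto

lemma AE_box_cbox: "AE x in lborel. indicator (cbox a b) x = (indicator (box a b) x :: real)"
proof -
  have "cbox a b - box a b \<in> null_sets lebesgue"
    using negligible_frontier_interval[of a b] by (simp add: negligible_iff_null_sets)
  then have "cbox a b - box a b \<in> null_sets lborel"
    by (simp add: null_sets_completion_iff)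
  then show ?thesis
    by (rule AE_I') (auto simp: indicator_def dest: subsetD[OF box_subset_cbox])
qed

text \<open>The intervals are disjoint. The induction needs that the sum vanishes from the end of the last interval on.\<close>

lemma sum_indicator_le:
  assumes h: "h > 0"
  shows "(\<Sum>s<n. indicator {real s * h<..<real s * h + h} t) \<le> (of_bool (t < real n * h) :: real)"
proof (induction n)
  case (Suc n)
  have "indicator {real n * h<..<real n * h + h} t \<le> (of_bool (t < real (Suc n) * h) - of_bool (t < real n * h) :: real)"
    using h by (auto simp: indicator_def algebra_simps)
  with Suc show ?case by simp
qed simp

text \<open>Tents over shifted intervals telescope to a difference of ramps, hence are bounded by \<open>h\<close> independently of
  their number.\<close>

lemma sum_tent: "(\<Sum>s<n. tent h (t - real s * h)) = ramp h t - ramp h (t - real n * h)"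
  by (induction n) (auto simp: tent_def algebra_simps)

lemma tent_nonneg: "h > 0 \<Longrightarrow> 0 \<le> tent h t"
  by (auto simp: tent_def ramp_def)

text \<open>The sum over the grid factors into one sum per coordinate: a telescoping sum of tents in direction \<open>i\<close>, and
  indicators of disjoint intervals in the others.\<close>

lemma sum_tent_fun_le:
  fixes x :: "real^'n::finite"
  assumes h: "h > 0"
  shows "(\<Sum>k\<in>grid N. tent_fun h i (\<lambda>j. real (k j) * h) x) \<le> h"
proof -
  let ?f = "\<lambda>j s. if j = i then tent h (x $ j - real s * h) else indicator {real s * h<..<real s * h + h} (x $ j)"
  have "(\<Sum>k\<in>grid N. tent_fun h i (\<lambda>j. real (k j) * h) x) = (\<Prod>j\<in>UNIV. \<Sum>s<N. ?f j s)"
    unfolding grid_PiE tent_fun_def prod_fun_def by (subst prod_sum_PiE) auto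
  also have "\<dots> \<le> (\<Prod>j\<in>UNIV. if j = i then h else 1)"
  proof (intro prod_mono conjI)
    fix j
    show "0 \<le> (\<Sum>s<N. ?f j s)" using tent_nonneg[OF h] by (auto intro!: sum_nonneg)
    show "(\<Sum>s<N. ?f j s) \<le> (if j = i then h else 1)"
      using sum_indicator_le[OF h, of "x $ j" N] h
      by (auto simp: sum_tent ramp_def intro: order_trans)
  qed
  also have "\<dots> = h" by (simp add: prod.delta)
  finally show ?thesis .
qed

lemma tent_fun_nonneg: "h > 0 \<Longrightarrow> 0 \<le> tent_fun h i a x"
  unfolding tent_fun_def prod_fun_def by (intro prod_nonneg) (auto simp: tent_nonneg)

lemma tent_fun_measurable: "tent_fun h i a \<in> borel_measurable borel"
  unfolding tent_fun_def
proof (rule prod_fun_measurable)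
  show "(\<lambda>t. if j = i then tent h (t - a j) else indicator {a j<..<a j + h} t) \<in> borel_measurable borel" for j
    unfolding tent_def ramp_def by (cases "j = i") simp_all
qed

text \<open>Testing the gradient with the tents, each multiplied by the sign of the corresponding jump, adds up the absolute
  values of the jumps. The resulting function is bounded by \<open>1/N\<close>.\<close>

lemma sum_jumps_le:
  fixes u :: "real^'n::finite \<Rightarrow> real"
  assumes D: "is_distr_gradient u D" and u: "integrable lborel u" and N: "N > 0"
  shows "(\<Sum>k\<in>grid N. \<bar>cell_int N u (k(i := k i + 1)) - cell_int N u k\<bar>) \<le> enn2real (total_variation D UNIV) / real N"
proof -
  obtain P Q where P: "finite_measure P" "finite_measure Q" "sets P = sets borel" "sets Q = sets borel"
      "\<And>B. B \<in> sets borel \<Longrightarrow> D B $ i = measure P B - measure Q B"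
      "\<And>\<phi>. test_function \<phi> \<Longrightarrow> (\<integral>x. u x * partial_deriv i \<phi> x \<partial>lborel) = - ((\<integral>x. \<phi> x \<partial>P) - (\<integral>x. \<phi> x \<partial>Q))"
    by (rule is_distr_gradientE[OF D]) blast
  define h where "h = 1 / real N"
  have h: "h > 0" using N by (simp add: h_def)
  define \<psi> where "\<psi> k = tent_fun h i (\<lambda>j. real (k j) * h)" for k
  define b where "b k = cell_int N u (k(i := k i + 1)) - cell_int N u k" for k
  \<comment> \<open>\<open>b k\<close> is the jump across the upper face of the cube \<open>k\<close>, and \<open>\<Psi>\<close> the function that detects all jumps.\<close>
  define \<Psi> where "\<Psi> x = (\<Sum>k\<in>grid N. sgn (b k) * \<psi> k x)" for x
  have cb: "cell_int N u k = (\<integral>x. u x * indicator (box (\<chi> j. real (k j) * h) (\<chi> j. real (k j) * h + h)) x \<partial>lborel)" for k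
  proof -
    have "(\<integral>x. u x * indicator (cell N k) x \<partial>lborel) = (\<integral>x. u x * indicator (box (\<chi> j. real (k j) * h) (\<chi> j. real (k j) * h + h)) x \<partial>lborel)"
    proof (rule integral_cong_AE)
      show "AE x in lborel. u x * indicator (cell N k) x = u x * indicator (box (\<chi> j. real (k j) * h) (\<chi> j. real (k j) * h + h)) x"
        using AE_box_cbox[of "\<chi> j. real (k j) * h" "\<chi> j. real (k j) * h + h"]
        by eventually_elim (simp add: cell_def h_def add_divide_distrib)
    qed (use u in \<open>auto simp: cell_def\<close>)
    then show ?thesis by (simp add: cell_int_def)
  qed
  have bk: "b k = (\<integral>x. \<psi> k x \<partial>P) - (\<integral>x. \<psi> k x \<partial>Q)" for k
  proof -
    have eq: "((\<lambda>j. real (k j) * h)(i := real (k i) * h + h)) j = real ((k(i := k i + 1)) j) * h" for j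
      by (auto simp: algebra_simps)
    show ?thesis
      using distr_gradient_tent[OF P(1-4) P(6) u h, of "\<lambda>j. real (k j) * h"]
      unfolding \<psi>_def b_def cb eq by (rule sym)
  qed
  have psi: "0 \<le> \<psi> k x" "\<psi> k \<in> borel_measurable borel" for k x
    unfolding \<psi>_def by (auto simp: tent_fun_nonneg h tent_fun_measurable)
  have psih: "\<psi> k x \<le> h" if "k \<in> grid N" for k x
    using sum_tent_fun_le[OF h, where N=N and i=i and x=x] member_le_sum[OF that, of "\<lambda>k. \<psi> k x"] psi(1)
    by (auto simp: \<psi>_def[symmetric])
  have bPsi: "\<bar>\<Psi> x\<bar> \<le> h" for x
  proof -
    have "\<bar>\<Psi> x\<bar> \<le> (\<Sum>k\<in>grid N. \<psi> k x)"
      unfolding \<Psi>_def using psi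
      by (intro order_trans[OF sum_abs] sum_mono) (auto simp: abs_mult abs_sgn_eq)
    also have "\<dots> \<le> h" unfolding \<psi>_def by (rule sum_tent_fun_le[OF h])
    finally show ?thesis .
  qed
  have int: "(\<integral>x. \<Psi> x \<partial>R) = (\<Sum>k\<in>grid N. sgn (b k) * (\<integral>x. \<psi> k x \<partial>R))" if "finite_measure R" "sets R = sets borel" for R
  proof -
    have "integrable R (\<psi> k)" if "k \<in> grid N" for k
      using psi psih[OF that] by (intro integrable_finite_bounded[OF \<open>finite_measure R\<close> \<open>sets R = _\<close>, where c=h]) auto
    then show ?thesis unfolding \<Psi>_def by (subst Bochner_Integration.integral_sum) auto
  qed
  have "(\<Sum>k\<in>grid N. \<bar>b k\<bar>) = (\<Sum>k\<in>grid N. sgn (b k) * b k)"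
    by (intro sum.cong refl) (simp add: abs_sgn mult.commute)
  also have "\<dots> = (\<integral>x. \<Psi> x \<partial>P) - (\<integral>x. \<Psi> x \<partial>Q)"
    using int P by (simp add: bk right_diff_distrib sum_subtractf)
  also have "\<dots> \<le> h * enn2real (total_variation D UNIV)"
  proof -
    have "\<Psi> \<in> borel_measurable borel" unfolding \<Psi>_def using psi(2) by measurable
    from signed_integral_le[OF P(1-5) this bPsi total_variation_finite[OF D]] show ?thesis by linarith
  qed
  finally show ?thesis by (simp add: b_def h_def)
qed

section \<open>Sums of measures\<close>

text \<open>The gradient of a sum is represented componentwise by sums of the measures that represent the summands.\<close>

definition add_measure :: "'a::topological_space measure \<Rightarrow> 'a measure \<Rightarrow> 'a measure" where
  "add_measure M N = measure_of UNIV (sets borel) (\<lambda>A. emeasure M A + emeasure N A)"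

lemma sets_add_measure [simp]: "sets (add_measure M N) = sets borel"
  unfolding add_measure_def using sets.sigma_sets_eq[of borel] by (simp add: sets_measure_of)

lemma space_add_measure [simp]: "space (add_measure M N) = UNIV"
  using sets_eq_imp_space_eq[OF sets_add_measure] by simp

lemma emeasure_add_measure:
  assumes "sets M = sets borel" "sets N = sets borel" "A \<in> sets borel"
  shows "emeasure (add_measure M N) A = emeasure M A + emeasure N A"
  unfolding add_measure_def
proof (rule emeasure_measure_of_sigma)
  show "sigma_algebra UNIV (sets (borel :: 'a measure))"
    using sets.sigma_algebra_axioms[of "borel :: 'a measure"] by simp
  show "countably_additive (sets borel) (\<lambda>A. emeasure M A + emeasure N A)"
    using assms(1,2)
    by (auto simp: countably_additive_def suminf_add[symmetric] suminf_emeasure)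
qed (use assms in \<open>auto simp: positive_def\<close>)

text \<open>By induction over the construction of nonnegative Borel functions.\<close>

lemma nn_integral_add_measure:
  assumes s: "sets M = sets borel" "sets N = sets borel" and f: "f \<in> borel_measurable borel"
  shows "(\<integral>\<^sup>+x. f x \<partial>add_measure M N) = (\<integral>\<^sup>+x. f x \<partial>M) + (\<integral>\<^sup>+x. f x \<partial>N)"
proof -
  have sp: "space M = UNIV" "space N = UNIV" using s by (auto dest: sets_eq_imp_space_eq)
  have m: "g \<in> borel_measurable M" "g \<in> borel_measurable N" "g \<in> borel_measurable (add_measure M N)"
    if "g \<in> borel_measurable borel" for g :: "'a \<Rightarrow> ennreal"
    using that s by (auto cong: measurable_cong_sets)
  show ?thesis
    using f
  proof (induction rule: borel_measurable_induct)
    case (cong f g)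
    then have "f = g" by (intro ext) simp
    with cong show ?case by simp
  next
    case (set A)
    then show ?case using s by (simp add: emeasure_add_measure)
  next
    case (mult u c)
    note mu = m[OF mult(2)]
    show ?case unfolding nn_integral_cmult[OF mu(1)] nn_integral_cmult[OF mu(2)] nn_integral_cmult[OF mu(3)] mult.IH distrib_left ..
  next
    case (add u v)
    note mu = m[OF add(1)] and mv = m[OF add(3)]
    show ?case unfolding nn_integral_add[OF mv(1) mu(1)] nn_integral_add[OF mv(2) mu(2)] nn_integral_add[OF mv(3) mu(3)] add.IH by (simp only: add_ac)
  next
    case (seq U)
    have i: "incseq U" by fact
    have inc: "incseq (\<lambda>i. \<integral>\<^sup>+x. U i x \<partial>R)" for R :: "'a measure"
      using i by (auto simp: incseq_def le_fun_def intro!: nn_integral_mono)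
    have e: "(SUP i. U i) x = (SUP i. U i x)" for x by (rule SUP_apply)
    show ?case
      unfolding e nn_integral_monotone_convergence_SUP[OF i m(1)[OF seq(1)]]
        nn_integral_monotone_convergence_SUP[OF i m(2)[OF seq(1)]]
        nn_integral_monotone_convergence_SUP[OF i m(3)[OF seq(1)]] seq.IH
      by (rule ennreal_SUP_add[OF inc inc])
  qed
qed

lemma finite_add_measure:
  assumes "finite_measure M" "finite_measure N" "sets M = sets borel" "sets N = sets borel"
  shows "finite_measure (add_measure M N)"
  by (rule finite_measureI) (use assms in \<open>simp add: emeasure_add_measure finite_measure.emeasure_finite\<close>)

lemma measure_add_measure:
  assumes "finite_measure M" "finite_measure N" "sets M = sets borel" "sets N = sets borel" "B \<in> sets borel"
  shows "measure (add_measure M N) B = measure M B + measure N B"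
proof -
  have "emeasure M B < top" "emeasure N B < top"
    using finite_measure.emeasure_finite[OF assms(1), of B] finite_measure.emeasure_finite[OF assms(2), of B]
    by (simp_all add: less_top)
  then show ?thesis
    unfolding measure_def emeasure_add_measure[OF assms(3-5)] by (rule enn2real_plus)
qed

lemma integral_add_measure:
  fixes f :: "'a::topological_space \<Rightarrow> real"
  assumes fin: "finite_measure M" "finite_measure N" and s: "sets M = sets borel" "sets N = sets borel" 
    and f: "f \<in> borel_measurable borel" "\<And>x. \<bar>f x\<bar> \<le> c"
  shows "(\<integral>x. f x \<partial>add_measure M N) = (\<integral>x. f x \<partial>M) + (\<integral>x. f x \<partial>N)"
proof -
  have i: "integrable M f" "integrable N f" "integrable (add_measure M N) f"
    using assms by (auto intro!: integrable_finite_bounded[where c=c] finite_add_measure)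
  have fi: "(\<integral>\<^sup>+x. ennreal (f x) \<partial>R) < top" "(\<integral>\<^sup>+x. ennreal (- f x) \<partial>R) < top" if "integrable R f" for R
    using that unfolding real_integrable_def by (auto simp: less_top)
  show ?thesis
    using f(1) fi[OF i(1)] fi[OF i(2)]
    by (simp add: real_lebesgue_integral_def i nn_integral_add_measure[OF s] enn2real_plus)
qed

section \<open>Test functions are bounded with bounded derivatives\<close>

lemma test_function_C1:
  assumes "test_function \<phi>"
  shows "\<phi> differentiable (at x)" "continuous_on UNIV \<phi>" "continuous_on UNIV (partial_deriv i \<phi>)"
proof -
  have 1: "Ck (Suc 0) \<phi>" using assms unfolding test_function_def by blast
  then show d: "\<phi> differentiable (at x)" for x by (simp add: differentiable_on_def)
  then show "continuous_on UNIV \<phi>"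
    by (simp add: continuous_on_eq_continuous_within differentiable_imp_continuous_within)
  show "continuous_on UNIV (partial_deriv i \<phi>)" using 1 by simp
qed

lemma bounded_of_compact_support:
  fixes f :: "'a::metric_space \<Rightarrow> real"
  assumes "compact K" "continuous_on UNIV f" "\<And>x. x \<notin> K \<Longrightarrow> f x = 0"
  shows "\<exists>c. \<forall>x. \<bar>f x\<bar> \<le> c"
proof -
  have "bounded (f ` K)"
    using assms by (intro compact_imp_bounded compact_continuous_image) (auto intro: continuous_on_subset)
  then obtain c where "\<And>x. x \<in> K \<Longrightarrow> \<bar>f x\<bar> \<le> c" by (auto simp: bounded_real)
  then have "\<bar>f x\<bar> \<le> max c 0" for x using assms(3)[of x] by (cases "x \<in> K") (force simp: max_def)+
  then show ?thesis by blast
qed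

lemma zero_outside_support: "x \<notin> closure {x. \<phi> x \<noteq> 0} \<Longrightarrow> \<phi> x = 0"
  using closure_subset[THEN subsetD, of x "{x. \<phi> x \<noteq> 0}"] by blast

lemma test_function_bounded:
  assumes "test_function \<phi>"
  shows "\<exists>c. \<forall>x. \<bar>\<phi> x\<bar> \<le> c"
proof (rule bounded_of_compact_support[of "closure {x. \<phi> x \<noteq> 0}" \<phi>])
  show "\<phi> x = 0" if "x \<notin> closure {x. \<phi> x \<noteq> 0}" for x
    using that by (rule zero_outside_support)
  show "compact (closure {x. \<phi> x \<noteq> 0})" using assms by (simp add: test_function_def)
qed (rule test_function_C1(2)[OF assms])

lemma partial_deriv_bounded:
  assumes "test_function \<phi>"
  shows "\<exists>c. \<forall>x. \<bar>partial_deriv i \<phi> x\<bar> \<le> c"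
proof (rule bounded_of_compact_support[of "closure {x. \<phi> x \<noteq> 0}" "partial_deriv i \<phi>"])
  show "partial_deriv i \<phi> x = 0" if "x \<notin> closure {x. \<phi> x \<noteq> 0}" for x
  proof -
    have "(\<phi> has_derivative (\<lambda>_. 0)) (at x)"
    proof (rule has_derivative_transform_within_open[of "\<lambda>_. 0" "\<lambda>_. 0" x UNIV "- closure {x. \<phi> x \<noteq> 0}"])
      show "0 = \<phi> y" if "y \<in> - closure {x. \<phi> x \<noteq> 0}" for y
        using that zero_outside_support[of y \<phi>] by simp
    qed (use that in auto)
    then show ?thesis unfolding partial_deriv_def by (subst frechet_derivative_at[symmetric]) auto
  qed
  show "compact (closure {x. \<phi> x \<noteq> 0})" using assms by (simp add: test_function_def)
qed (rule test_function_C1(3)[OF assms])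

lemma integrable_times_bounded:
  fixes u f :: "'a::euclidean_space \<Rightarrow> real"
  assumes "integrable lborel u" "f \<in> borel_measurable borel" "\<And>x. \<bar>f x\<bar> \<le> c"
  shows "integrable lborel (\<lambda>x. u x * f x)"
proof (rule Bochner_Integration.integrable_bound[of _ "\<lambda>x. u x * c"])
  show "AE x in lborel. norm (u x * f x) \<le> norm (u x * c)"
  proof (rule AE_I2)
    fix x
    have "\<bar>f x\<bar> \<le> \<bar>c\<bar>" using assms(3)[of x] by linarith
    then show "norm (u x * f x) \<le> norm (u x * c)" by (simp add: abs_mult mult_left_mono)
  qed
qed (use assms in \<open>auto intro: integrable_mult_left\<close>)

lemma integrable_times_partial_deriv:
  assumes "integrable lborel u" "test_function \<phi>"
  shows "integrable lborel (\<lambda>x. u x * partial_deriv i \<phi> x)"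
proof -
  obtain c where "\<And>x. \<bar>partial_deriv i \<phi> x\<bar> \<le> c" using partial_deriv_bounded[OF assms(2)] by blast
  then show ?thesis
    using assms test_function_C1(3)[OF assms(2)]
    by (intro integrable_times_bounded) (auto intro: borel_measurable_continuous_onI)
qed

section \<open>Linearity of the gradient\<close>

lemma is_distr_gradient_add:
  assumes u: "integrable lborel u" "is_distr_gradient u D" and v: "integrable lborel v" "is_distr_gradient v E"
  shows "is_distr_gradient (\<lambda>x. u x + v x) (\<lambda>B. D B + E B)"
  unfolding is_distr_gradient_def
proof
  fix i
  obtain M N where M: "finite_measure M" "finite_measure N" "sets M = sets borel" "sets N = sets borel"
    "\<And>B. B \<in> sets borel \<Longrightarrow> D B $ i = measure M B - measure N B"
    "\<And>\<phi>. test_function \<phi> \<Longrightarrow> (\<integral>x. u x * partial_deriv i \<phi> x \<partial>lborel) = - ((\<integral>x. \<phi> x \<partial>M) - (\<integral>x. \<phi> x \<partial>N))"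
    by (rule is_distr_gradientE[OF u(2)]) blast
  obtain P Q where P: "finite_measure P" "finite_measure Q" "sets P = sets borel" "sets Q = sets borel"
    "\<And>B. B \<in> sets borel \<Longrightarrow> E B $ i = measure P B - measure Q B"
    "\<And>\<phi>. test_function \<phi> \<Longrightarrow> (\<integral>x. v x * partial_deriv i \<phi> x \<partial>lborel) = - ((\<integral>x. \<phi> x \<partial>P) - (\<integral>x. \<phi> x \<partial>Q))"
    by (rule is_distr_gradientE[OF v(2)]) blast
  have "(\<integral>x. (u x + v x) * partial_deriv i \<phi> x \<partial>lborel) =
       - ((\<integral>x. \<phi> x \<partial>add_measure M P) - (\<integral>x. \<phi> x \<partial>add_measure N Q))" if t: "test_function \<phi>" for \<phi>
  proof -
    obtain b where b: "\<And>x. \<bar>\<phi> x\<bar> \<le> b" using test_function_bounded[OF t] by blast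
    have m: "\<phi> \<in> borel_measurable borel"
      using test_function_C1(2)[OF t] by (rule borel_measurable_continuous_onI)
    have "(\<integral>x. (u x + v x) * partial_deriv i \<phi> x \<partial>lborel) =
      (\<integral>x. u x * partial_deriv i \<phi> x \<partial>lborel) + (\<integral>x. v x * partial_deriv i \<phi> x \<partial>lborel)"
      unfolding distrib_right
      by (intro Bochner_Integration.integral_add integrable_times_partial_deriv u v t)
    then show ?thesis
      by (simp add: M(6)[OF t] P(6)[OF t] integral_add_measure[OF M(1) P(1) M(3) P(3) m b] integral_add_measure[OF M(2) P(2) M(4) P(4) m b])
  qed
  then show "\<exists>M N. finite_measure M \<and> finite_measure N \<and> sets M = sets borel \<and> sets N = sets borel \<and>
      (\<forall>B\<in>sets borel. (D B + E B) $ i = measure M B - measure N B) \<and>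
      (\<forall>\<phi>. test_function \<phi> \<longrightarrow>
        (\<integral>x. (u x + v x) * partial_deriv i \<phi> x \<partial>lborel) = - ((\<integral>x. \<phi> x \<partial>M) - (\<integral>x. \<phi> x \<partial>N)))"
    using M P by (intro exI[of _ "add_measure M P"] exI[of _ "add_measure N Q"])
      (simp add: finite_add_measure measure_add_measure)
qed

lemma is_distr_gradient_scale:
  assumes u: "is_distr_gradient u D"
  shows "is_distr_gradient (\<lambda>x. c * u x) (\<lambda>B. c *\<^sub>R D B)"
  unfolding is_distr_gradient_def
proof
  fix i
  obtain M N where M: "finite_measure M" "finite_measure N" "sets M = sets borel" "sets N = sets borel"
    "\<And>B. B \<in> sets borel \<Longrightarrow> D B $ i = measure M B - measure N B"
    "\<And>\<phi>. test_function \<phi> \<Longrightarrow> (\<integral>x. u x * partial_deriv i \<phi> x \<partial>lborel) = - ((\<integral>x. \<phi> x \<partial>M) - (\<integral>x. \<phi> x \<partial>N))"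
    by (rule is_distr_gradientE[OF u]) blast
  define S where "S R = density R (\<lambda>_. ennreal \<bar>c\<bar>)" for R :: "(real^'a) measure"
  have S: "finite_measure (S R)" "sets (S R) = sets borel" "B \<in> sets borel \<Longrightarrow> measure (S R) B = \<bar>c\<bar> * measure R B"
    "\<phi> \<in> borel_measurable borel \<Longrightarrow> (\<integral>x. \<phi> x \<partial>S R) = \<bar>c\<bar> * (\<integral>x. \<phi> x \<partial>R)"
    if "finite_measure R" "sets R = sets borel" for R B and \<phi> :: "real^'a \<Rightarrow> real"
  proof -
    have sp: "space R = UNIV" using that sets_eq_imp_space_eq by fastforce
    show "finite_measure (S R)"
      using that by (intro finite_measureI) (auto simp: S_def emeasure_density_const ennreal_mult_eq_top_iff finite_measure.emeasure_finite sp)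
    show "sets (S R) = sets borel" using that by (simp add: S_def)
    show "B \<in> sets borel \<Longrightarrow> measure (S R) B = \<bar>c\<bar> * measure R B"
      using that by (simp add: S_def measure_def emeasure_density_const enn2real_mult)
    show "\<phi> \<in> borel_measurable borel \<Longrightarrow> (\<integral>x. \<phi> x \<partial>S R) = \<bar>c\<bar> * (\<integral>x. \<phi> x \<partial>R)"
      using that unfolding S_def by (subst integral_real_density) (auto cong: measurable_cong_sets)
  qed
  \<comment> \<open>a negative factor exchanges the positive and the negative part\<close>
  define M' where "M' = (if c \<ge> 0 then S M else S N)"
  define N' where "N' = (if c \<ge> 0 then S N else S M)"
  have "(\<integral>x. (c * u x) * partial_deriv i \<phi> x \<partial>lborel) = - ((\<integral>x. \<phi> x \<partial>M') - (\<integral>x. \<phi> x \<partial>N'))" if t: "test_function \<phi>" for \<phi>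
  proof -
    have "\<phi> \<in> borel_measurable borel"
      using test_function_C1(2)[OF t] by (rule borel_measurable_continuous_onI)
    then show ?thesis
      using M(1-4) by (auto simp: M'_def N'_def S mult.assoc M(6)[OF t] right_diff_distrib)
  qed
  note id = this
  have D: "(c *\<^sub>R D B) $ i = measure M' B - measure N' B" if B: "B \<in> sets borel" for B
    using M(1-4) B by (auto simp: M'_def N'_def S M(5)[OF B] right_diff_distrib)
  have fin: "finite_measure M'" "finite_measure N'" "sets M' = sets borel" "sets N' = sets borel"
    using M(1-4) by (auto simp: M'_def N'_def S)
  show "\<exists>M N. finite_measure M \<and> finite_measure N \<and> sets M = sets borel \<and> sets N = sets borel \<and>
      (\<forall>B\<in>sets borel. (c *\<^sub>R D B) $ i = measure M B - measure N B) \<and>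
      (\<forall>\<phi>. test_function \<phi> \<longrightarrow>
        (\<integral>x. c * u x * partial_deriv i \<phi> x \<partial>lborel) = - ((\<integral>x. \<phi> x \<partial>M) - (\<integral>x. \<phi> x \<partial>N)))"
    using fin D id by blast
qed

lemma is_distr_gradient_cong_AE:
  assumes "is_distr_gradient u D" "AE x in lborel. u x = v x" "u \<in> borel_measurable borel" "v \<in> borel_measurable borel"
  shows "is_distr_gradient v D"
proof -
  have "(\<integral>x. u x * partial_deriv i \<phi> x \<partial>lborel) = (\<integral>x. v x * partial_deriv i \<phi> x \<partial>lborel)" if "test_function \<phi>" for i \<phi>
    using assms borel_measurable_continuous_onI[OF test_function_C1(3)[OF that, of i]]
    by (intro integral_cong_AE) auto
  then show ?thesis using assms(1) unfolding is_distr_gradient_def by simp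
qed

section \<open>The variation of a function\<close>

text \<open>The second summand of the norm. By \<open>var_eq\<close> it can be computed from any gradient, not only from the one
  that is chosen in the definition of the norm.\<close>

definition var :: "(real^'n::finite \<Rightarrow> real) \<Rightarrow> real" where
  "var u = enn2real (total_variation (distr_gradient u) UNIV)"

lemma var_eq:
  assumes "is_distr_gradient u D"
  shows "var u = enn2real (total_variation D UNIV)"
proof -
  have "is_distr_gradient u (distr_gradient u)"
    unfolding distr_gradient_def by (rule someI[of "is_distr_gradient u", OF assms])
  then have "distr_gradient u B = D B" if "B \<in> sets borel" for B
    using assms that by (rule distr_gradient_unique)
  then have "total_variation (distr_gradient u) UNIV = total_variation D UNIV"
    unfolding total_variation_def by (intro SUP_cong refl suminf_cong) (auto simp: image_subset_iff)
  then show ?thesis by (simp add: var_def)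
qed

lemma var_nonneg: "0 \<le> var u"
  by (simp add: var_def)

lemma total_variation_add: "total_variation (\<lambda>B. D B + E B) UNIV \<le> total_variation D UNIV + total_variation E UNIV"
  unfolding total_variation_def[of "\<lambda>B. D B + E B"]
proof (rule SUP_least)
  fix A :: "nat \<Rightarrow> (real^'a) set"
  assume A: "A \<in> {A. range A \<subseteq> sets borel \<and> disjoint_family A \<and> (\<Union>k. A k) = UNIV}"
  have "(\<Sum>k. ennreal (norm (D (A k) + E (A k)))) \<le> (\<Sum>k. ennreal (norm (D (A k))) + ennreal (norm (E (A k))))"
    by (intro suminf_le) (auto simp: ennreal_plus[symmetric] norm_triangle_ineq simp del: ennreal_plus)
  also have "\<dots> = (\<Sum>k. ennreal (norm (D (A k)))) + (\<Sum>k. ennreal (norm (E (A k))))"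
    by (rule suminf_add[symmetric]) auto
  also have "\<dots> \<le> total_variation D UNIV + total_variation E UNIV"
    unfolding total_variation_def by (intro add_mono SUP_upper A)
  finally show "(\<Sum>k. ennreal (norm (D (A k) + E (A k)))) \<le> total_variation D UNIV + total_variation E UNIV" .
qed

lemma total_variation_scale: "total_variation (\<lambda>B. c *\<^sub>R D B) UNIV \<le> ennreal \<bar>c\<bar> * total_variation D UNIV"
  unfolding total_variation_def[of "\<lambda>B. c *\<^sub>R D B"]
proof (rule SUP_least)
  fix A :: "nat \<Rightarrow> (real^'a) set"
  assume A: "A \<in> {A. range A \<subseteq> sets borel \<and> disjoint_family A \<and> (\<Union>k. A k) = UNIV}"
  have "(\<Sum>k. ennreal (norm (c *\<^sub>R D (A k)))) = ennreal \<bar>c\<bar> * (\<Sum>k. ennreal (norm (D (A k))))"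
    by (simp add: ennreal_mult)
  also have "\<dots> \<le> ennreal \<bar>c\<bar> * total_variation D UNIV"
    unfolding total_variation_def by (intro mult_left_mono SUP_upper A) auto
  finally show "(\<Sum>k. ennreal (norm (c *\<^sub>R D (A k)))) \<le> ennreal \<bar>c\<bar> * total_variation D UNIV" .
qed

lemma BV_cubeE:
  assumes "u \<in> BV_cube"
  obtains D where "integrable lborel u" "is_distr_gradient u D" "AE x in lborel. x \<notin> unit_cube \<longrightarrow> u x = 0"
  using assms by (auto simp: BV_cube_def BV_def)

lemma BV_cubeI:
  assumes "integrable lborel u" "is_distr_gradient u D" "AE x in lborel. x \<notin> unit_cube \<longrightarrow> u x = 0"
  shows "u \<in> BV_cube"
  using assms by (auto simp: BV_cube_def BV_def)

lemma BV_cube_integrable: "u \<in> BV_cube \<Longrightarrow> integrable lborel u"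
  by (auto simp: BV_cube_def BV_def)

lemma BV_norm_eq: "BV_norm u = (\<integral>x. \<bar>u x\<bar> \<partial>lborel) + var u"
  by (simp add: BV_norm_def var_def)

lemma BV_norm_nonneg: "0 \<le> BV_norm u"
  by (simp add: BV_norm_eq var_nonneg)

lemma BV_cube_add:
  assumes "u \<in> BV_cube" "v \<in> BV_cube"
  shows "(\<lambda>x. u x + v x) \<in> BV_cube" "BV_norm (\<lambda>x. u x + v x) \<le> BV_norm u + BV_norm v"
proof -
  obtain D where u: "integrable lborel u" "is_distr_gradient u D" "AE x in lborel. x \<notin> unit_cube \<longrightarrow> u x = 0"
    using BV_cubeE[OF assms(1)] .
  obtain E where v: "integrable lborel v" "is_distr_gradient v E" "AE x in lborel. x \<notin> unit_cube \<longrightarrow> v x = 0"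
    using BV_cubeE[OF assms(2)] .
  note g = is_distr_gradient_add[OF u(1,2) v(1,2)]
  show "(\<lambda>x. u x + v x) \<in> BV_cube"
    using u(3) v(3) by (intro BV_cubeI[OF _ g]) (use u(1) v(1) in \<open>auto\<close>)
  have "var (\<lambda>x. u x + v x) \<le> var u + var v"
    unfolding var_eq[OF g] var_eq[OF u(2)] var_eq[OF v(2)]
    using enn2real_mono[OF total_variation_add[of D E]] total_variation_finite[OF u(2)] total_variation_finite[OF v(2)]
    by (simp add: enn2real_plus)
  moreover have "(\<integral>x. \<bar>u x + v x\<bar> \<partial>lborel) \<le> (\<integral>x. \<bar>u x\<bar> + \<bar>v x\<bar> \<partial>lborel)"
    using u(1) v(1) by (intro integral_mono) auto
  ultimately show "BV_norm (\<lambda>x. u x + v x) \<le> BV_norm u + BV_norm v"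
    using u(1) v(1) by (simp add: BV_norm_eq)
qed

lemma BV_cube_scale:
  assumes "u \<in> BV_cube"
  shows "(\<lambda>x. c * u x) \<in> BV_cube" "BV_norm (\<lambda>x. c * u x) \<le> \<bar>c\<bar> * BV_norm u"
proof -
  obtain D where u: "integrable lborel u" "is_distr_gradient u D" "AE x in lborel. x \<notin> unit_cube \<longrightarrow> u x = 0"
    using BV_cubeE[OF assms(1)] .
  note g = is_distr_gradient_scale[OF u(2), of c]
  show "(\<lambda>x. c * u x) \<in> BV_cube"
    using u(3) by (intro BV_cubeI[OF _ g]) (use u(1) in \<open>auto\<close>)
  have "var (\<lambda>x. c * u x) \<le> \<bar>c\<bar> * var u"
    unfolding var_eq[OF g] var_eq[OF u(2)]
    using enn2real_mono[OF total_variation_scale[of c D]] total_variation_finite[OF u(2)]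
    by (simp add: enn2real_mult ennreal_mult_less_top)
  then show "BV_norm (\<lambda>x. c * u x) \<le> \<bar>c\<bar> * BV_norm u"
    by (simp add: BV_norm_eq abs_mult distrib_left)
qed

section \<open>Integrating along coordinate lines\<close>

definition upd :: "real^'n \<Rightarrow> 'n \<Rightarrow> real \<Rightarrow> real^'n::finite" where
  "upd x i t = (\<chi> j. if j = i then t else x $ j)"

lemma upd_nth [simp]: "upd x i t $ j = (if j = i then t else x $ j)"
  by (simp add: upd_def)

lemma upd_alt: "upd x i t = upd x i 0 + t *\<^sub>R axis i 1"
  by (simp add: vec_eq_iff axis_def)

lemma continuous_upd: "continuous_on UNIV (\<lambda>x. upd x i t)"
  unfolding upd_def
proof (rule continuous_on_vec_lambda)
  show "continuous_on UNIV (\<lambda>x::real^'a. if j = i then t else x $ j)" for j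
    by (cases "j = i") (simp_all add: continuous_on_component)
qed

lemma measurable_upd [measurable]: "(\<lambda>x. upd x i t) \<in> borel_measurable borel"
  by (intro borel_measurable_continuous_onI continuous_upd)

text \<open>Fubini's theorem in the form used here: the integral over the line through \<open>x\<close> in direction \<open>i\<close> does not depend on the
  \<open>i\<close>-th coordinate of \<open>x\<close>, so it can be integrated over the remaining coordinates.\<close>

lemma integral_eq_of_lines:
  fixes F G :: "real^'n::finite \<Rightarrow> real"
  assumes "integrable lborel F" "integrable lborel G"
    and eq: "\<And>x. (\<integral>t. F (upd x i t) \<partial>lborel) = (\<integral>t. G (upd x i t) \<partial>lborel)"
  shows "(\<integral>x. F x \<partial>lborel) = (\<integral>x. G x \<partial>lborel)"
proof -
  interpret product_sigma_finite "\<lambda>_::real^'n. lborel :: real measure" by unfold_locales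
  define e :: "real^'n" where "e = axis i 1"
  let ?P = "\<Pi>\<^sub>M b\<in>(Basis::(real^'n) set). (lborel :: real measure)"
  \<comment> \<open>\<open>\<Phi>\<close> carries the product measure on coordinate families to the Lebesgue measure\<close>
  define \<Phi> :: "(real^'n \<Rightarrow> real) \<Rightarrow> real^'n" where "\<Phi> f = (\<Sum>b\<in>Basis. f b *\<^sub>R b)" for f
  have e: "e \<in> Basis" by (auto simp: e_def Basis_vec_def)
  have leq: "(lborel :: (real^'n) measure) = distr ?P borel \<Phi>"
    unfolding \<Phi>_def[abs_def] by (rule lborel_eq)
  have \<Phi>m: "\<Phi> \<in> measurable ?P borel" unfolding \<Phi>_def[abs_def] by measurable
  have comp: "\<Phi> f $ j = f (axis j 1)" for f j
  proof -
    have "\<Phi> f $ j = \<Phi> f \<bullet> axis j 1" by (simp add: cart_eq_inner_axis)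
    also have "\<dots> = f (axis j 1)"
      unfolding \<Phi>_def by (rule inner_sum_left_Basis) (auto simp: Basis_vec_def)
    finally show ?thesis .
  qed
  have up: "\<Phi> (f(e := t)) = upd (\<Phi> f) i t" for f t
  proof (subst vec_eq_iff, rule allI)
    fix j
    have "axis j 1 = (axis i 1 :: real^'n) \<longleftrightarrow> j = i" by (simp add: axis_eq_axis)
    then show "\<Phi> (f(e := t)) $ j = upd (\<Phi> f) i t $ j" by (simp add: comp e_def)
  qed
  have key: "(\<integral>x. H x \<partial>lborel) = (\<integral>f. (\<integral>t. H (upd (\<Phi> f) i t) \<partial>lborel) \<partial>(\<Pi>\<^sub>M b\<in>Basis - {e}. lborel))"
    if H: "integrable lborel H" for H :: "real^'n \<Rightarrow> real"
  proof -
    have Hm: "H \<in> borel_measurable borel" using borel_measurable_integrable[OF H] by simp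
    have "integrable ?P (\<lambda>f. H (\<Phi> f))"
      using H unfolding leq by (subst (asm) integrable_distr_eq[OF \<Phi>m Hm])
    then have int: "integrable (Pi\<^sub>M (insert e (Basis - {e})) (\<lambda>_. lborel)) (\<lambda>f. H (\<Phi> f))"
      using e by (simp add: insert_absorb)
    have "(\<integral>x. H x \<partial>lborel) = (\<integral>f. H (\<Phi> f) \<partial>?P)"
      unfolding leq by (rule integral_distr[OF \<Phi>m Hm])
    also have "\<dots> = (\<integral>f. H (\<Phi> f) \<partial>(Pi\<^sub>M (insert e (Basis - {e})) (\<lambda>_. lborel)))"
      using e by (simp add: insert_absorb)
    also have "\<dots> = (\<integral>f. (\<integral>t. H (\<Phi> (f(e := t))) \<partial>lborel) \<partial>(\<Pi>\<^sub>M b\<in>Basis - {e}. lborel))"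
      by (rule product_integral_insert[OF _ _ int]) auto
    finally show ?thesis by (simp add: up)
  qed
  show ?thesis unfolding key[OF assms(1)] key[OF assms(2)] eq ..
qed

section \<open>The gradient of a cell\<close>

text \<open>The cube \<open>cell N k\<close> with its \<open>i\<close>-th side replaced by \<open>[0, 1]\<close>. As that side has length \<open>1\<close>, integrals over the slab
  of functions that do not depend on the \<open>i\<close>-th coordinate are integrals over a face of the cube, so Hausdorff
  measures are avoided.\<close>

definition slab :: "nat \<Rightarrow> 'n \<Rightarrow> ('n \<Rightarrow> nat) \<Rightarrow> (real^'n::finite) set" where
  "slab N i k = cbox (upd (\<chi> j. real (k j) / real N) i 0) (upd (\<chi> j. (real (k j) + 1) / real N) i 1)"

text \<open>The area measure on the face of \<open>cell N k\<close> in the hyperplane \<open>x\<^sub>i = s / N\<close>. It does not depend on \<open>k i\<close>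
  (\<open>face_upd\<close>), so a cube and its neighbour share the measure of their common face, and the gradients of adjacent
  cubes cancel there exactly.\<close>

definition face :: "nat \<Rightarrow> 'n \<Rightarrow> ('n \<Rightarrow> nat) \<Rightarrow> nat \<Rightarrow> (real^'n::finite) measure" where
  "face N i k s = distr (density lborel (indicator (slab N i k))) borel (\<lambda>x. upd x i (real s / real N))"

lemma face_upd [simp]: "face N i (k(i := t)) s = face N i k s"
proof -
  have "slab N i (k(i := t)) = slab N i k"
    unfolding slab_def by (intro arg_cong2[where f=cbox]) (auto simp: vec_eq_iff)
  then show ?thesis by (simp add: face_def)
qed

lemma sets_face [simp]: "sets (face N i k s) = sets borel"
  by (simp add: face_def)

lemma slab_sets [measurable]: "slab N i k \<in> sets borel" by (simp add: slab_def)

lemma emeasure_face_UNIV: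
  fixes k :: "'n::finite \<Rightarrow> nat"
  assumes "N > 0"
  shows "emeasure (face N i k s) UNIV = ennreal ((1 / real N) ^ (CARD('n) - 1))"
proof -
  have "emeasure (face N i k s) UNIV = emeasure lborel (slab N i k)"
    unfolding face_def by (subst emeasure_distr) (auto simp: emeasure_density)
  also have "\<dots> = ennreal (\<Prod>b\<in>Basis. (upd (\<chi> j. (real (k j) + 1) / real N) i 1 - upd (\<chi> j. real (k j) / real N) i 0) \<bullet> b)"
    unfolding slab_def using assms
    by (intro emeasure_lborel_cbox) (auto simp: Basis_vec_def inner_axis divide_right_mono)
  also have "(\<Prod>b\<in>Basis. (upd (\<chi> j. (real (k j) + 1) / real N) i 1 - upd (\<chi> j. real (k j) / real N) i 0) \<bullet> b)
    = (\<Prod>j\<in>UNIV. if j = i then 1 else 1 / real N)"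
  proof -
    have B: "(Basis :: (real^'n) set) = range (\<lambda>j. axis j 1)" by (auto simp: Basis_vec_def)
    show ?thesis
      unfolding B by (subst prod.reindex) (auto simp: inj_on_def axis_eq_axis inner_axis add_divide_distrib intro!: prod.cong)
  qed
  also have "\<dots> = (1 / real N) ^ (CARD('n) - 1)"
    by (subst prod.remove[of _ i]) (auto simp: card_Diff_singleton)
  finally show ?thesis .
qed

lemma finite_face: "N > 0 \<Longrightarrow> finite_measure (face N i k s)"
  by (rule finite_measureI) (simp add: emeasure_face_UNIV sets_eq_imp_space_eq[OF sets_face])

lemma measure_face_UNIV: "N > 0 \<Longrightarrow> measure (face N i (k::'n::finite \<Rightarrow> nat) s) UNIV = (1 / real N) ^ (CARD('n) - 1)"
  by (simp add: measure_def emeasure_face_UNIV)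

lemma integral_face:
  fixes \<phi> :: "real^'n::finite \<Rightarrow> real"
  assumes "\<phi> \<in> borel_measurable borel"
  shows "(\<integral>x. \<phi> x \<partial>face N i k s) = (\<integral>x. indicator (slab N i k) x * \<phi> (upd x i (real s / real N)) \<partial>lborel)"
proof -
  have "(\<integral>x. \<phi> x \<partial>face N i k s) = (\<integral>x. \<phi> (upd x i (real s / real N)) \<partial>density lborel (indicator (slab N i k)))"
  proof -
    have "(\<lambda>x. upd x i (real s / real N)) \<in> measurable (density lborel (indicator (slab N i k))) borel" by simp
    from integral_distr[OF this assms] show ?thesis unfolding face_def .
  qed
  also have "density lborel (indicator (slab N i k)) = density lborel (\<lambda>x. ennreal (indicator (slab N i k) x))"
    by (intro arg_cong2[where f=density] refl ext) (simp add: indicator_def)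
  also have "(\<integral>x. \<phi> (upd x i (real s / real N)) \<partial>density lborel (\<lambda>x. ennreal (indicator (slab N i k) x)))
     = (\<integral>x. indicator (slab N i k) x * \<phi> (upd x i (real s / real N)) \<partial>lborel)"
    using assms by (subst integral_real_density) auto
  finally show ?thesis .
qed

lemma deriv_along_line:
  assumes "\<phi> differentiable (at (upd x i t))"
  shows "((\<lambda>t. \<phi> (upd x i t)) has_real_derivative partial_deriv i \<phi> (upd x i t)) (at t)"
proof -
  have "((\<lambda>t. upd x i t) has_derivative (\<lambda>s. s *\<^sub>R axis i 1)) (at t)"
    by (subst upd_alt) (auto intro!: derivative_eq_intros)
  moreover have d: "(\<phi> has_derivative frechet_derivative \<phi> (at (upd x i t))) (at (upd x i t))"
    using assms by (simp add: frechet_derivative_works)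
  ultimately have "((\<lambda>t. \<phi> (upd x i t)) has_derivative (\<lambda>s. frechet_derivative \<phi> (at (upd x i t)) (s *\<^sub>R axis i 1))) (at t)"
    by (rule has_derivative_compose)
  also have "(\<lambda>s. frechet_derivative \<phi> (at (upd x i t)) (s *\<^sub>R axis i 1)) = (*) (partial_deriv i \<phi> (upd x i t))"
    unfolding partial_deriv_def
    by (rule ext) (simp only: linear_cmul[OF has_derivative_linear[OF d]] real_scaleR_def mult.commute)
  finally show ?thesis unfolding has_field_derivative_def .
qed

text \<open>The divergence theorem on a cube: on every line in direction \<open>i\<close> it is the fundamental theorem of calculus.\<close>

lemma cell_gradient:
  fixes k :: "'n::finite \<Rightarrow> nat"
  assumes N: "N > 0" and t: "test_function \<phi>"
  shows "(\<integral>x. indicator (cell N k) x * partial_deriv i \<phi> x \<partial>lborel) =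
    (\<integral>x. \<phi> x \<partial>face N i k (k i + 1)) - (\<integral>x. \<phi> x \<partial>face N i k (k i))"
proof -
  let ?a = "real (k i) / real N" and ?b = "real (k i + 1) / real N"
  have ab: "?a \<le> ?b" using N by (simp add: divide_right_mono)
  note c = test_function_C1(2)[OF t] test_function_C1(3)[OF t]
  have cu: "continuous_on UNIV (\<lambda>x. \<phi> (upd x i s))" for s
    using continuous_on_compose[OF continuous_upd continuous_on_subset[OF c(1)], of i s] by (simp add: o_def)
  have int1: "integrable lborel (\<lambda>x. indicator (cell N k) x * partial_deriv i \<phi> x)"
    using borel_integrable_compact[of "cell N k" "partial_deriv i \<phi>"] continuous_on_subset[OF c(2)]
    by (simp add: cell_def)
  have int2: "integrable lborel (\<lambda>x. indicator (slab N i k) x * \<phi> (upd x i s))" for s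
    using borel_integrable_compact[of "slab N i k" "\<lambda>x. \<phi> (upd x i s)"] continuous_on_subset[OF cu]
    by (simp add: slab_def)
  have "(\<integral>x. indicator (cell N k) x * partial_deriv i \<phi> x \<partial>lborel) =
    (\<integral>x. indicator (slab N i k) x * \<phi> (upd x i ?b) - indicator (slab N i k) x * \<phi> (upd x i ?a) \<partial>lborel)"
  proof (rule integral_eq_of_lines[OF int1 Bochner_Integration.integrable_diff[OF int2 int2], where i=i])
    fix x :: "real^'n"
    define R where "R = (\<forall>j. j \<noteq> i \<longrightarrow> real (k j) / real N \<le> x $ j \<and> x $ j \<le> (real (k j) + 1) / real N)"
    have ic: "indicator (cell N k) (upd x i t) = of_bool R * (indicator {?a..?b} t :: real)" for t
      by (auto simp: R_def cell_def mem_box_cart indicator_def add.commute)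
    have isl: "indicator (slab N i k) (upd x i t) = of_bool R * (indicator {0..1} t :: real)" for t
      by (auto simp: R_def slab_def mem_box_cart indicator_def)
    have uu: "upd (upd x i t) i s = upd x i s" for t s by (simp add: vec_eq_iff)
    have "(\<integral>t. partial_deriv i \<phi> (upd x i t) * indicator {?a..?b} t \<partial>lborel) = \<phi> (upd x i ?b) - \<phi> (upd x i ?a)"
    proof (rule integral_FTC_Icc_real[OF ab])
      show "((\<lambda>t. \<phi> (upd x i t)) has_real_derivative partial_deriv i \<phi> (upd x i t)) (at t)" for t
        by (rule deriv_along_line[OF test_function_C1(1)[OF t]])
      have "continuous_on UNIV (\<lambda>t. upd x i t)"
        by (subst upd_alt) (intro continuous_intros)
      from continuous_on_compose[OF this continuous_on_subset[OF c(2)]]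
      show "isCont (\<lambda>t. partial_deriv i \<phi> (upd x i t)) s" for s
        by (simp add: o_def continuous_on_eq_continuous_at)
    qed
    then show "(\<integral>t. indicator (cell N k) (upd x i t) * partial_deriv i \<phi> (upd x i t) \<partial>lborel) =
      (\<integral>t. indicator (slab N i k) (upd x i t) * \<phi> (upd (upd x i t) i ?b) - indicator (slab N i k) (upd x i t) * \<phi> (upd (upd x i t) i ?a) \<partial>lborel)"
      unfolding ic isl uu by (cases R) (simp_all add: mult.commute left_diff_distrib[symmetric] right_diff_distrib[symmetric])
  qed
  also have "\<dots> = (\<integral>x. indicator (slab N i k) x * \<phi> (upd x i ?b) \<partial>lborel) - (\<integral>x. indicator (slab N i k) x * \<phi> (upd x i ?a) \<partial>lborel)"
    by (rule Bochner_Integration.integral_diff[OF int2 int2])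
  also have "\<dots> = (\<integral>x. \<phi> x \<partial>face N i k (k i + 1)) - (\<integral>x. \<phi> x \<partial>face N i k (k i))"
    using borel_measurable_continuous_onI[OF c(1)] by (simp add: integral_face)
  finally show ?thesis .
qed

definition cell_grad :: "nat \<Rightarrow> ('n \<Rightarrow> nat) \<Rightarrow> (real^'n) set \<Rightarrow> real^'n::finite" where
  "cell_grad N k B = (\<chi> i. measure (face N i k (k i)) B - measure (face N i k (k i + 1)) B)"

lemma integrable_cell: "integrable lborel (indicator (cell N k) :: _ \<Rightarrow> real)"
  by (rule integrable_real_indicator) (simp_all add: cell_def emeasure_lborel_cbox_finite[unfolded infinity_ennreal_def])

lemma is_distr_gradient_cell:
  assumes "N > 0"
  shows "is_distr_gradient (indicator (cell N k)) (cell_grad N k)"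
  unfolding is_distr_gradient_def
proof
  fix i
  show "\<exists>M P. finite_measure M \<and> finite_measure P \<and> sets M = sets borel \<and> sets P = sets borel \<and>
     (\<forall>B\<in>sets borel. cell_grad N k B $ i = measure M B - measure P B) \<and>
     (\<forall>\<phi>. test_function \<phi> \<longrightarrow>
        (\<integral>x. indicator (cell N k) x * partial_deriv i \<phi> x \<partial>lborel) = - ((\<integral>x. \<phi> x \<partial>M) - (\<integral>x. \<phi> x \<partial>P)))"
    using assms
    by (intro exI[of _ "face N i k (k i)"] exI[of _ "face N i k (k i + 1)"])
       (simp add: finite_face cell_gradient[OF assms] cell_grad_def)
qed

section \<open>Step functions on the grid\<close>

definition step :: "nat \<Rightarrow> (('n \<Rightarrow> nat) \<Rightarrow> real) \<Rightarrow> real^'n::finite \<Rightarrow> real" where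
  "step N c x = (\<Sum>k\<in>grid N. c k * indicator (cell N k) x)"

lemma integrable_step: "integrable lborel (step N c)"
  unfolding step_def[abs_def] by (intro Bochner_Integration.integrable_sum integrable_mult_right integrable_cell)

lemma is_distr_gradient_step:
  assumes "N > 0"
  shows "is_distr_gradient (step N c) (\<lambda>B. \<Sum>k\<in>grid N. c k *\<^sub>R cell_grad N k B)"
proof -
  have "is_distr_gradient (\<lambda>x. \<Sum>k\<in>K. c k * indicator (cell N k) x) (\<lambda>B. \<Sum>k\<in>K. c k *\<^sub>R cell_grad N k B)" if "finite K" for K
    using that
  proof induction
    case empty
    have "is_distr_gradient (\<lambda>x. 0 * indicator (cell N undefined) x) (\<lambda>B. 0 *\<^sub>R cell_grad N undefined B)"
      by (rule is_distr_gradient_scale[OF is_distr_gradient_cell[OF assms]])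
    then show ?case by simp
  next
    case (insert k K)
    have int: "integrable lborel (\<lambda>x. \<Sum>k\<in>K. c k * indicator (cell N k) x)"
      by (intro Bochner_Integration.integrable_sum integrable_mult_right integrable_cell)
    show ?case unfolding sum.insert[OF insert.hyps]
      by (rule is_distr_gradient_add[OF integrable_mult_right[OF integrable_cell] is_distr_gradient_scale[OF is_distr_gradient_cell[OF assms]] int insert.IH])
  qed
  from this[OF finite_grid] show ?thesis by (simp add: step_def[abs_def])
qed

lemma grid_lines:
  fixes G :: "('n::finite \<Rightarrow> nat) \<Rightarrow> 'b::comm_monoid_add"
  assumes "N > 0"
  shows "(\<Sum>k\<in>{k\<in>grid N. k i = 0}. \<Sum>s<N. G (k(i := s))) = (\<Sum>k\<in>grid N. G k)"
proof -
  have "(\<Sum>k\<in>{k\<in>grid N. k i = 0}. \<Sum>s<N. G (k(i := s))) = (\<Sum>(k, s)\<in>{k\<in>grid N. k i = 0} \<times> {..<N}. G (k(i := s)))"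
    by (rule sum.cartesian_product)
  also have "\<dots> = (\<Sum>k\<in>grid N. G k)"
    by (rule sum.reindex_bij_witness[where j="\<lambda>(k, s). k(i := s)" and i="\<lambda>k. (k(i := 0), k i)"])
       (use assms in \<open>auto simp: grid_def\<close>)
  finally show ?thesis .
qed

text \<open>Shifting the summation index along direction \<open>i\<close> when the summand vanishes at the upper end.\<close>

lemma grid_shift:
  fixes F :: "('n::finite \<Rightarrow> nat) \<Rightarrow> real"
  assumes N: "N > 0" and z: "\<And>k. k i = N \<Longrightarrow> F k = 0"
  shows "(\<Sum>k\<in>grid N. F k) = (\<Sum>k\<in>{k\<in>grid N. k i = 0}. F k) + (\<Sum>k\<in>grid N. F (k(i := k i + 1)))"
proof -
  have line: "(\<Sum>s<N. F (k(i := s))) = F k + (\<Sum>s<N. F (k(i := s + 1)))" if "k i = 0" for k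
  proof -
    have "(\<Sum>s<N. F (k(i := s))) = (\<Sum>s<Suc N. F (k(i := s)))" using z[of "k(i := N)"] by simp
    also have "\<dots> = F (k(i := 0)) + (\<Sum>s<N. F (k(i := Suc s)))" by (rule sum.lessThan_Suc_shift)
    finally show ?thesis using fun_upd_triv[of k i] that by simp
  qed
  have "(\<Sum>k\<in>grid N. F k) = (\<Sum>k\<in>{k\<in>grid N. k i = 0}. F k + (\<Sum>s<N. F (k(i := s + 1))))"
    unfolding grid_lines[OF N, where i=i and G=F, symmetric] by (intro sum.cong refl line) auto
  also have "\<dots> = (\<Sum>k\<in>{k\<in>grid N. k i = 0}. F k) + (\<Sum>k\<in>grid N. F (k(i := k i + 1)))"
    unfolding sum.distrib using grid_lines[OF N, where i=i and G="\<lambda>k. F (k(i := k i + 1))"] by simp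
  finally show ?thesis .
qed

text \<open>Coefficients are indexed by all of \<open>nat\<close> in each direction and vanish for indices off the grid, so the jump at
  \<open>k i = N - 1\<close> is the one across the upper boundary of the unit cube.\<close>

definition jump :: "'n \<Rightarrow> (('n \<Rightarrow> nat) \<Rightarrow> real) \<Rightarrow> ('n \<Rightarrow> nat) \<Rightarrow> real" where
  "jump i c k = c (k(i := k i + 1)) - c k"

text \<open>Telescoping from \<open>k\<close> to the upper end of its line, where \<open>c\<close> vanishes.\<close>

lemma abs_le_line_jumps:
  assumes k: "k \<in> grid N" and z: "\<And>k. k i = N \<Longrightarrow> c k = 0"
  shows "\<bar>c k\<bar> \<le> (\<Sum>s<N. \<bar>jump i c (k(i := s))\<bar>)"
proof -
  have ki: "k i < N" using k by (simp add: grid_def)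
  have "(\<Sum>s=k i..<N. c (k(i := Suc s)) - c (k(i := s))) = c (k(i := N)) - c (k(i := k i))"
    by (rule sum_Suc_diff') (use ki in simp)
  then have "c k = - (\<Sum>s=k i..<N. jump i c (k(i := s)))"
    using z[of "k(i := N)"] by (simp add: jump_def)
  then have "\<bar>c k\<bar> \<le> (\<Sum>s=k i..<N. \<bar>jump i c (k(i := s))\<bar>)"
    using sum_abs[of "\<lambda>s. jump i c (k(i := s))" "{k i..<N}"] by simp
  also have "\<dots> \<le> (\<Sum>s<N. \<bar>jump i c (k(i := s))\<bar>)"
    by (rule sum_mono2) auto
  finally show ?thesis .
qed

lemma sum_le_jumps:
  fixes c :: "('n::finite \<Rightarrow> nat) \<Rightarrow> real"
  assumes N: "N > 0" and z: "\<And>k. k i = N \<Longrightarrow> c k = 0"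
  shows "(\<Sum>k\<in>grid N. \<bar>c k\<bar>) \<le> real N * (\<Sum>k\<in>grid N. \<bar>jump i c k\<bar>)"
proof -
  have "(\<Sum>k\<in>grid N. \<bar>c k\<bar>) \<le> (\<Sum>k\<in>grid N. \<Sum>s<N. \<bar>jump i c (k(i := s))\<bar>)"
    by (intro sum_mono abs_le_line_jumps z)
  also have "\<dots> = real N * (\<Sum>k\<in>{k\<in>grid N. k i = 0}. \<Sum>s<N. \<bar>jump i c (k(i := s))\<bar>)"
    unfolding grid_lines[OF N, where i=i and G="\<lambda>k. \<Sum>s<N. \<bar>jump i c (k(i := s))\<bar>", symmetric] by (simp add: sum_distrib_left)
  also have "\<dots> = real N * (\<Sum>k\<in>grid N. \<bar>jump i c k\<bar>)"
    by (simp only: grid_lines[OF N, where i=i and G="\<lambda>k. \<bar>jump i c k\<bar>"])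
  finally show ?thesis .
qed

text \<open>Summation by parts: the gradient of a step function is a combination of face measures whose coefficients are
  the jumps, except at the lower boundary of the unit cube, where the coefficient is \<open>c k\<close> itself. The latter is at most
  the sum of the jumps along its line, whence the factor \<open>2\<close>.\<close>

lemma var_step_le:
  fixes c :: "('n::finite \<Rightarrow> nat) \<Rightarrow> real"
  assumes N: "N > 0" and z: "\<And>i k. k i = N \<Longrightarrow> c k = 0"
  shows "var (step N c) \<le> 2 * (1 / real N) ^ (CARD('n) - 1) * (\<Sum>i\<in>UNIV. \<Sum>k\<in>grid N. \<bar>jump i c k\<bar>)"
proof -
  define D where "D B = (\<Sum>k\<in>grid N. c k *\<^sub>R cell_grad N k B)" for B :: "(real^'n) set"
  \<comment> \<open>the Boolean tells the upper face of a cube from a face in the lower boundary of the unit cube\<close>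
  define w :: "'n \<times> ('n \<Rightarrow> nat) \<times> bool \<Rightarrow> real" where "w = (\<lambda>(i, k, b). if b then \<bar>jump i c k\<bar> else of_bool (k i = 0) * \<bar>c k\<bar>)"
  define \<mu> :: "'n \<times> ('n \<Rightarrow> nat) \<times> bool \<Rightarrow> (real^'n) measure" where "\<mu> = (\<lambda>(i, k, b). face N i k (if b then k i + 1 else 0))"
  define F where "F = (UNIV :: 'n set) \<times> (grid N :: ('n \<Rightarrow> nat) set) \<times> (UNIV :: bool set)"
  have Fsum: "(\<Sum>a\<in>F. g a) = (\<Sum>i\<in>UNIV. \<Sum>k\<in>grid N. g (i, k, False) + g (i, k, True))" for g :: "_ \<Rightarrow> real"
    unfolding F_def sum.cartesian_product' UNIV_bool by (simp add: add.commute)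
  have TV: "total_variation D UNIV \<le> ennreal (\<Sum>a\<in>F. w a * measure (\<mu> a) UNIV)"
  proof (rule total_variation_le)
    fix B :: "(real^'n) set" assume B: "B \<in> sets borel"
    have "\<bar>D B $ i\<bar> \<le> (\<Sum>k\<in>grid N. of_bool (k i = 0) * \<bar>c k\<bar> * measure (face N i k 0) B + \<bar>jump i c k\<bar> * measure (face N i k (k i + 1)) B)" for i
    proof -
      have "D B $ i = (\<Sum>k\<in>grid N. c k * measure (face N i k (k i)) B) - (\<Sum>k\<in>grid N. c k * measure (face N i k (k i + 1)) B)"
        by (simp add: D_def cell_grad_def right_diff_distrib sum_subtractf)
      also have "(\<Sum>k\<in>grid N. c k * measure (face N i k (k i)) B) = (\<Sum>k\<in>{k\<in>grid N. k i = 0}. c k * measure (face N i k 0) B)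
        + (\<Sum>k\<in>grid N. c (k(i := k i + 1)) * measure (face N i k (k i + 1)) B)"
        using grid_shift[OF N, of i "\<lambda>k. c k * measure (face N i k (k i)) B"] z by simp
      also have "(\<Sum>k\<in>{k\<in>grid N. k i = 0}. c k * measure (face N i k 0) B) = (\<Sum>k\<in>grid N. of_bool (k i = 0) * c k * measure (face N i k 0) B)"
        by (rule sum.mono_neutral_cong_left) auto
      finally have "D B $ i = (\<Sum>k\<in>grid N. of_bool (k i = 0) * c k * measure (face N i k 0) B + jump i c k * measure (face N i k (k i + 1)) B)"
        by (simp only: jump_def sum.distrib sum_subtractf left_diff_distrib add_diff_eq)
      then have "\<bar>D B $ i\<bar> \<le> (\<Sum>k\<in>grid N. \<bar>of_bool (k i = 0) * c k * measure (face N i k 0) B + jump i c k * measure (face N i k (k i + 1)) B\<bar>)"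
        by (simp only: sum_abs)
      also have "\<dots> \<le> (\<Sum>k\<in>grid N. of_bool (k i = 0) * \<bar>c k\<bar> * measure (face N i k 0) B + \<bar>jump i c k\<bar> * measure (face N i k (k i + 1)) B)"
      proof (rule sum_mono)
        fix k
        show "\<bar>of_bool (k i = 0) * c k * measure (face N i k 0) B + jump i c k * measure (face N i k (k i + 1)) B\<bar>
          \<le> of_bool (k i = 0) * \<bar>c k\<bar> * measure (face N i k 0) B + \<bar>jump i c k\<bar> * measure (face N i k (k i + 1)) B"
          using abs_triangle_ineq[of "of_bool (k i = 0) * c k * measure (face N i k 0) B" "jump i c k * measure (face N i k (k i + 1)) B"]
          by (simp add: abs_mult)
      qed
      finally show ?thesis .
    qed
    then have "norm (D B) \<le> (\<Sum>i\<in>UNIV. \<Sum>k\<in>grid N. of_bool (k i = 0) * \<bar>c k\<bar> * measure (face N i k 0) B + \<bar>jump i c k\<bar> * measure (face N i k (k i + 1)) B)"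
      by (intro order_trans[OF norm_le_l1_cart] sum_mono)
    also have "\<dots> = (\<Sum>a\<in>F. w a * measure (\<mu> a) B)"
      by (simp add: Fsum w_def \<mu>_def)
    finally show "norm (D B) \<le> (\<Sum>a\<in>F. w a * measure (\<mu> a) B)" .
  qed (use N in \<open>auto simp: \<mu>_def w_def finite_face\<close>)
  have bnd: "(\<Sum>a\<in>F. w a * measure (\<mu> a) UNIV) \<le> (1 / real N) ^ (CARD('n) - 1) * (\<Sum>i\<in>UNIV. 2 * (\<Sum>k\<in>grid N. \<bar>jump i c k\<bar>))"
  proof -
    have "(\<Sum>a\<in>F. w a * measure (\<mu> a) UNIV) = (1 / real N) ^ (CARD('n) - 1) * (\<Sum>i\<in>UNIV. \<Sum>k\<in>grid N. of_bool (k i = 0) * \<bar>c k\<bar> + \<bar>jump i c k\<bar>)"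
      by (simp add: Fsum w_def \<mu>_def measure_face_UNIV[OF N] sum_distrib_left algebra_simps)
    also have "\<dots> \<le> (1 / real N) ^ (CARD('n) - 1) * (\<Sum>i\<in>UNIV. 2 * (\<Sum>k\<in>grid N. \<bar>jump i c k\<bar>))"
    proof (intro mult_left_mono sum_mono)
      fix i
      have "(\<Sum>k\<in>grid N. of_bool (k i = 0) * \<bar>c k\<bar>) = (\<Sum>k\<in>{k\<in>grid N. k i = 0}. \<bar>c k\<bar>)"
        by (rule sum.mono_neutral_cong_right) auto
      also have "\<dots> \<le> (\<Sum>k\<in>{k\<in>grid N. k i = 0}. \<Sum>s<N. \<bar>jump i c (k(i := s))\<bar>)"
        using z by (intro sum_mono abs_le_line_jumps) auto
      also have "\<dots> = (\<Sum>k\<in>grid N. \<bar>jump i c k\<bar>)" by (rule grid_lines[OF N])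
      finally show "(\<Sum>k\<in>grid N. of_bool (k i = 0) * \<bar>c k\<bar> + \<bar>jump i c k\<bar>) \<le> 2 * (\<Sum>k\<in>grid N. \<bar>jump i c k\<bar>)"
        by (simp add: sum.distrib)
    qed auto
    finally show ?thesis .
  qed
  have "var (step N c) = enn2real (total_variation D UNIV)"
    unfolding D_def by (rule var_eq[OF is_distr_gradient_step[OF N]])
  also have "\<dots> \<le> (\<Sum>a\<in>F. w a * measure (\<mu> a) UNIV)"
    using TV by (intro enn2real_leI) (auto simp: w_def intro!: sum_nonneg)
  also note bnd
  finally show ?thesis by (simp only: sum_distrib_left[symmetric] mult_ac)
qed

lemma AE_cell_box: "AE x in lborel. indicator (cell N k) x = (indicator (box (\<chi> i. real (k i) / real N) (\<chi> i. (real (k i) + 1) / real N)) x :: real)"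
  unfolding cell_def by (rule AE_box_cbox)

lemma cell_subset_cube: "N > 0 \<Longrightarrow> k \<in> grid N \<Longrightarrow> cell N k \<subseteq> unit_cube"
proof
  fix x assume N: "N > 0" and k: "k \<in> grid N" and x: "x \<in> cell N k"
  have "0 \<le> x $ i \<and> x $ i \<le> 1" for i
  proof -
    have "real (k i) / real N \<le> x $ i" "x $ i \<le> (real (k i) + 1) / real N" "0 \<le> real (k i) / real N"
      using x by (auto simp: cell_def mem_box_cart)
    moreover have "(real (k i) + 1) / real N \<le> 1"
    proof -
      have "real (Suc (k i)) \<le> real N" using k by (simp only: of_nat_le_iff grid_def mem_Collect_eq Suc_le_eq)
      then show ?thesis using N by simp
    qed
    ultimately show ?thesis by linarith
  qed
  then show "x \<in> unit_cube" by (simp add: mem_box_cart)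
qed

lemma step_in_BV_cube: "N > 0 \<Longrightarrow> step N c \<in> BV_cube"
proof (rule BV_cubeI[OF integrable_step is_distr_gradient_step])
  assume N: "N > 0"
  have "step N c x = 0" if "x \<notin> unit_cube" for x
    unfolding step_def using cell_subset_cube[OF N] that by (intro sum.neutral) (auto simp: indicator_def)
  then show "AE x in lborel. x \<notin> unit_cube \<longrightarrow> step N c x = 0" by simp
qed

lemma cell_int_outside:
  assumes u: "u \<in> BV_cube" and N: "N > 0" and k: "N \<le> k i"
  shows "cell_int N u k = 0"
proof -
  have "AE x in lborel. x \<notin> unit_cube \<longrightarrow> u x = 0" using u by (rule BV_cubeE)
  then have "AE x in lborel. u x * indicator (cell N k) x = 0"
    using AE_cell_box[of N k]
  proof eventually_elim
    case (elim x)
    have "u x = 0" if "x \<in> box (\<chi> i. real (k i) / real N) (\<chi> i. (real (k i) + 1) / real N)"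
    proof -
      have "real (k i) / real N < x $ i" using that by (simp add: mem_box_cart)
      moreover have "1 \<le> real (k i) / real N" using k N by simp
      ultimately have "x \<notin> unit_cube" by (auto simp: mem_box_cart intro!: exI[of _ i])
      with elim show ?thesis by simp
    qed
    with elim show ?case by (auto simp: indicator_def)
  qed
  then show ?thesis unfolding cell_int_def by (rule integral_eq_zero_AE)
qed

lemma measure_cell:
  fixes k :: "'n::finite \<Rightarrow> nat"
  assumes "N > 0"
  shows "measure lborel (cell N k) = (1 / real N) ^ CARD('n)"
proof -
  have "cell N k \<noteq> {}" using assms by (auto simp: cell_def interval_ne_empty_cart divide_right_mono)
  then have "measure lborel (cell N k) = (\<Prod>i\<in>UNIV. (real (k i) + 1) / real N - real (k i) / real N)"
    unfolding cell_def by (subst content_cbox_cart) auto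
  also have "\<dots> = (1 / real N) ^ CARD('n)" by (simp add: add_divide_distrib)
  finally show ?thesis .
qed

text \<open>The basic estimate, from which the bound on averages, the bound on the levels of the Haar expansion and Sobolev's
  inequality are all derived.\<close>

lemma sum_jumps_le_var:
  assumes "u \<in> BV_cube" "N > 0"
  shows "(\<Sum>k\<in>grid N. \<bar>jump i (cell_int N u) k\<bar>) \<le> var u / real N"
proof -
  obtain D where "integrable lborel u" "is_distr_gradient u D"
    using BV_cubeE[OF assms(1)] .
  then show ?thesis using sum_jumps_le[of u D N i] assms(2) by (simp add: var_eq jump_def)
qed

section \<open>Averages over the cubes of a grid\<close>

definition average :: "nat \<Rightarrow> (real^'n \<Rightarrow> real) \<Rightarrow> real^'n::finite \<Rightarrow> real" where
  "average N u = step N (\<lambda>k. real N ^ CARD('n) * cell_int N u k)"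

text \<open>The jumps of the averages are the jumps of the integrals over the cubes, divided by the volume. The bound
  \<open>var_step_le\<close> on the variation and the bound \<open>sum_jumps_le_var\<close> on the jumps have compensating powers of \<open>N\<close>. The
  integral is bounded by the variation as well, since the function vanishes outside the cube.\<close>

lemma BV_norm_average:
  fixes u :: "real^'n::finite \<Rightarrow> real"
  assumes u: "u \<in> BV_cube" and N: "N > 0"
  shows "BV_norm (average N u) \<le> (1 + 2 * CARD('n)) * var u"
proof -
  let ?v = "cell_int N u" and ?m = "real N ^ CARD('n)"
  have z: "?v k = 0" if "k i = N" for i k
    by (rule cell_int_outside[OF u N, where k=k and i=i]) (simp add: that)
  have e: "(1 / real N) ^ (CARD('n) - 1) * ?m = real N"
    using N by (simp add: power_minus_mult[of "CARD('n)" "real N", symmetric] power_one_over)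
  have j: "(\<Sum>k\<in>grid N. \<bar>jump i ?v k\<bar>) \<le> var u / real N" for i by (rule sum_jumps_le_var[OF u N])
  have "(\<integral>x. \<bar>average N u x\<bar> \<partial>lborel) \<le> (\<integral>x. (\<Sum>k\<in>grid N. ?m * \<bar>?v k\<bar> * indicator (cell N k) x) \<partial>lborel)"
    unfolding average_def
  proof (rule integral_mono)
    show "\<bar>step N (\<lambda>k. ?m * ?v k) x\<bar> \<le> (\<Sum>k\<in>grid N. ?m * \<bar>?v k\<bar> * indicator (cell N k) x)" for x
      unfolding step_def by (rule order_trans[OF sum_abs]) (simp add: abs_mult)
  qed (intro integrable_abs integrable_step Bochner_Integration.integrable_sum integrable_mult_right integrable_cell)+
  also have "\<dots> = (\<Sum>k\<in>grid N. ?m * \<bar>?v k\<bar> * measure lborel (cell N k))"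
    by (subst Bochner_Integration.integral_sum) (auto simp: integrable_cell)
  also have "\<dots> = (\<Sum>k\<in>grid N. \<bar>?v k\<bar>)"
    using N by (simp add: measure_cell power_one_over)
  \<comment> \<open>any coordinate direction serves\<close>
  also have "\<dots> \<le> real N * (\<Sum>k\<in>grid N. \<bar>jump undefined ?v k\<bar>)"
    by (rule sum_le_jumps[OF N z])
  also have "\<dots> \<le> real N * (var u / real N)" using j by (intro mult_left_mono) auto
  finally have L1: "(\<integral>x. \<bar>average N u x\<bar> \<partial>lborel) \<le> var u" using N by simp
  have "var (average N u) \<le> 2 * (1 / real N) ^ (CARD('n) - 1) * (\<Sum>i\<in>UNIV. \<Sum>k\<in>grid N. \<bar>jump i (\<lambda>k. ?m * ?v k) k\<bar>)"
    unfolding average_def by (rule var_step_le[OF N]) (simp add: z)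
  also have "\<dots> = 2 * (1 / real N) ^ (CARD('n) - 1) * ?m * (\<Sum>i\<in>UNIV. \<Sum>k\<in>grid N. \<bar>jump i ?v k\<bar>)"
    by (simp add: jump_def right_diff_distrib[symmetric] abs_mult sum_distrib_left[symmetric])
  also have "\<dots> = 2 * ((1 / real N) ^ (CARD('n) - 1) * ?m) * (\<Sum>i\<in>UNIV. \<Sum>k\<in>grid N. \<bar>jump i ?v k\<bar>)"
    by (simp only: mult.assoc)
  also note e
  also have "2 * real N * (\<Sum>i\<in>UNIV. \<Sum>k\<in>grid N. \<bar>jump i ?v k\<bar>) \<le> 2 * real N * (\<Sum>i\<in>(UNIV::'n set). var u / real N)"
    using j by (intro mult_left_mono sum_mono) auto
  also have "\<dots> = 2 * CARD('n) * var u" using N by simp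
  finally show ?thesis using L1 by (simp add: BV_norm_eq algebra_simps)
qed

lemma BV_norm_cell:
  fixes k :: "'n::finite \<Rightarrow> nat"
  assumes N: "N > 0"
  shows "BV_norm (indicator (cell N k)) \<le> (1 + 2 * CARD('n)) * (1 / real N) ^ (CARD('n) - 1)"
proof -
  let ?F = "(UNIV :: 'n set) \<times> (UNIV :: bool set)"
  define \<mu> where "\<mu> = (\<lambda>(i, b). face N i k (if b then k i + 1 else k i))"
  have "total_variation (cell_grad N k) UNIV \<le> ennreal (\<Sum>a\<in>?F. 1 * measure (\<mu> a) UNIV)"
  proof (rule total_variation_le)
    fix B :: "(real^'n) set"
    have "norm (cell_grad N k B) \<le> (\<Sum>i\<in>UNIV. \<bar>cell_grad N k B $ i\<bar>)" by (rule norm_le_l1_cart)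
    also have "\<dots> \<le> (\<Sum>i\<in>UNIV. measure (face N i k (k i)) B + measure (face N i k (k i + 1)) B)"
      by (intro sum_mono) (simp add: cell_grad_def abs_le_iff)
    also have "\<dots> = (\<Sum>a\<in>?F. 1 * measure (\<mu> a) B)"
      unfolding sum.cartesian_product' UNIV_bool by (simp add: \<mu>_def add.commute)
    finally show "norm (cell_grad N k B) \<le> (\<Sum>a\<in>?F. 1 * measure (\<mu> a) B)" .
  qed (use N in \<open>auto simp: \<mu>_def finite_face\<close>)
  also have "(\<Sum>a\<in>?F. 1 * measure (\<mu> a) UNIV) = 2 * CARD('n) * (1 / real N) ^ (CARD('n) - 1)"
    unfolding sum.cartesian_product' UNIV_bool by (simp add: \<mu>_def measure_face_UNIV[OF N])
  finally have "var (indicator (cell N k)) \<le> 2 * CARD('n) * (1 / real N) ^ (CARD('n) - 1)"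
    unfolding var_eq[OF is_distr_gradient_cell[OF N]] by (intro enn2real_leI) auto
  moreover have "(\<integral>x. \<bar>indicator (cell N k) x :: real\<bar> \<partial>lborel) \<le> (1 / real N) ^ (CARD('n) - 1)"
  proof -
    have "(\<integral>x. \<bar>indicator (cell N k) x :: real\<bar> \<partial>lborel) = (1 / real N) ^ CARD('n)"
      using measure_cell[OF N, of k] by simp
    also have "\<dots> \<le> (1 / real N) ^ (CARD('n) - 1)" using N by (intro power_decreasing) auto
    finally show ?thesis .
  qed
  ultimately show ?thesis by (simp add: BV_norm_eq algebra_simps)
qed

lemma cell_in_BV_cube: "N > 0 \<Longrightarrow> k \<in> grid N \<Longrightarrow> indicator (cell N k) \<in> BV_cube"
  using cell_subset_cube[of N k]
  by (intro BV_cubeI[OF integrable_cell is_distr_gradient_cell] AE_I2) (auto simp: indicator_def)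

lemma zero_BV: "(\<lambda>x::real^'n::finite. 0) \<in> BV_cube" "BV_norm (\<lambda>x::real^'n. 0) = 0"
proof -
  show z: "(\<lambda>x::real^'n. 0) \<in> BV_cube"
    using step_in_BV_cube[of 1 "\<lambda>_::'n \<Rightarrow> nat. 0"] by (simp add: step_def[abs_def])
  show "BV_norm (\<lambda>x::real^'n. 0) = 0"
    using BV_cube_scale(2)[OF z, of 0] BV_norm_nonneg[of "\<lambda>x::real^'n. 0"] by simp
qed

section \<open>The discrete Sobolev inequality\<close>

text \<open>Hoelder's inequality for \<open>d\<close> functions with all exponents equal to \<open>d\<close>. After normalising the sums to \<open>1\<close> it is the
  inequality between arithmetic and geometric mean, summed up.\<close>

lemma sum_prod_root_le:
  fixes a :: "'b \<Rightarrow> nat \<Rightarrow> real"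
  assumes J: "finite J" "card J = d" "d > 0" and nn: "\<And>j t. j \<in> J \<Longrightarrow> 0 \<le> a j t"
  shows "(\<Sum>t<N. \<Prod>j\<in>J. root d (a j t)) \<le> (\<Prod>j\<in>J. root d (\<Sum>t<N. a j t))"
proof (cases "\<exists>j\<in>J. (\<Sum>t<N. a j t) = 0")
  case True
  then obtain j where j: "j \<in> J" "(\<Sum>t<N. a j t) = 0" by blast
  then have "a j t = 0" if "t < N" for t
    using sum_nonneg_eq_0_iff[of "{..<N}" "a j"] nn that by auto
  then have "(\<Prod>j\<in>J. root d (a j t)) = 0" if "t < N" for t
    using j J that by (auto intro!: prod_zero bexI[of _ j])
  then have "(\<Sum>t<N. \<Prod>j\<in>J. root d (a j t)) = 0" by simp
  then show ?thesis using nn by (auto intro!: prod_nonneg real_root_ge_zero sum_nonneg)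
next
  case False
  define A where "A j = (\<Sum>t<N. a j t)" for j
  have A: "A j > 0" if "j \<in> J" for j
    using False that nn[OF that] sum_nonneg[of "{..<N}" "a j"] by (force simp: A_def)
  have P: "(\<Prod>j\<in>J. root d (A j)) > 0" using A J by (intro prod_pos) auto
  have term_le: "(\<Prod>j\<in>J. root d (a j t)) / (\<Prod>j\<in>J. root d (A j)) \<le> (\<Sum>j\<in>J. (a j t / A j) / d)" for t
  proof -
    have nn': "0 \<le> a j t / A j" if "j \<in> J" for j using nn[OF that] A[OF that] by simp
    have "(\<Prod>j\<in>J. root d (a j t)) / (\<Prod>j\<in>J. root d (A j)) = (\<Prod>j\<in>J. root d (a j t / A j))"
      by (simp add: prod_dividef real_root_divide)
    also have "\<dots> = (\<Prod>j\<in>J. (a j t / A j) powr (1 / d))"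
      using nn' J by (intro prod.cong refl root_powr_inverse) auto
    also have "\<dots> = (\<Prod>j\<in>J. a j t / A j) powr (1 / d)"
      by (rule prod_powr_distrib[symmetric])
    also have "\<dots> \<le> (\<Sum>j\<in>J. (a j t / A j) / d)"
      using arith_geom_mean[of J "\<lambda>j. a j t / A j"] nn' J by (auto simp: card_gt_0_iff)
    finally show ?thesis .
  qed
  have "(\<Sum>t<N. \<Prod>j\<in>J. root d (a j t)) / (\<Prod>j\<in>J. root d (A j)) = (\<Sum>t<N. (\<Prod>j\<in>J. root d (a j t)) / (\<Prod>j\<in>J. root d (A j)))"
    by (rule sum_divide_distrib)
  also have "\<dots> \<le> (\<Sum>t<N. \<Sum>j\<in>J. (a j t / A j) / d)" by (intro sum_mono term_le)
  also have "\<dots> = (\<Sum>j\<in>J. \<Sum>t<N. (a j t / A j) / d)" by (rule sum.swap)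
  also have "\<dots> = (\<Sum>j\<in>J. 1 / d)"
    using A by (intro sum.cong refl) (force simp: sum_divide_distrib[symmetric] A_def[symmetric])
  also have "\<dots> = 1" using J by simp
  finally show ?thesis using P by (simp add: A_def divide_le_eq)
qed

text \<open>Summation over the coordinates in \<open>S\<close>, while the others are kept as in \<open>y\<close>.\<close>

definition box_sum :: "nat \<Rightarrow> 'n set \<Rightarrow> (('n \<Rightarrow> nat) \<Rightarrow> real) \<Rightarrow> ('n \<Rightarrow> nat) \<Rightarrow> real" where
  "box_sum N S \<phi> y = (\<Sum>k\<in>(PiE UNIV (\<lambda>i. if i \<in> S then {..<N} else {y i})). \<phi> k)"

lemma box_sum_dom: "k \<in> (PiE UNIV (\<lambda>i. if i \<in> S then {..<N} else {y i})) \<longleftrightarrow> (\<forall>i. if i \<in> S then k i < N else k i = y i)"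
  by (auto simp: PiE_def extensional_def Pi_def split: if_splits)

lemma box_sum_empty: "box_sum N {} \<phi> y = \<phi> y"
proof -
  have "(PiE UNIV (\<lambda>i. if i \<in> {} then {..<N} else {y i})) = {y}"
    by (auto simp: PiE_def extensional_def Pi_def)
  then show ?thesis by (simp add: box_sum_def)
qed

lemma box_sum_insert:
  fixes S :: "'n::finite set"
  assumes "i \<notin> S"
  shows "box_sum N (insert i S) \<phi> y = (\<Sum>t<N. box_sum N S \<phi> (y(i := t)))"
proof -
  let ?B = "\<lambda>S y. PiE (UNIV :: 'n set) (\<lambda>i. if i \<in> S then {..<N} else {y i})"
  have fin: "finite (?B S y)" for S y by (intro finite_PiE) auto
  have "(\<Sum>t<N. box_sum N S \<phi> (y(i := t))) = (\<Sum>(t, k)\<in>(SIGMA t:{..<N}. ?B S (y(i := t))). \<phi> k)"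
    unfolding box_sum_def using fin by (intro sum.Sigma) auto
  also have "\<dots> = box_sum N (insert i S) \<phi> y"
    unfolding box_sum_def
    by (rule sum.reindex_bij_witness[where j="\<lambda>(t, k). k" and i="\<lambda>k. (k i, k)"])
       (use assms in \<open>auto simp: box_sum_dom split: if_splits\<close>)
  finally show ?thesis ..
qed

lemma box_sum_indep:
  assumes "i \<notin> S" "\<And>k t. \<phi> (k(i := t)) = \<phi> k"
  shows "box_sum N S \<phi> (y(i := t)) = box_sum N S \<phi> y"
  unfolding box_sum_def
  by (rule sum.reindex_bij_witness[where j="\<lambda>k. k(i := y i)" and i="\<lambda>k. k(i := t)"])
     (use assms in \<open>auto simp: box_sum_dom fun_upd_idem_iff split: if_splits\<close>)

lemma box_sum_nonneg: "(\<And>k. 0 \<le> \<phi> k) \<Longrightarrow> 0 \<le> box_sum N S \<phi> y"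
  unfolding box_sum_def by (intro sum_nonneg)

text \<open>The factor with index \<open>Some i\<close> does not depend on the coordinate \<open>i\<close> and so is not summed over it; the factor with
  index \<open>None\<close> depends on all coordinates.\<close>

fun drop_coord :: "'n option \<Rightarrow> 'n set \<Rightarrow> 'n set" where
  "drop_coord None S = S"
| "drop_coord (Some i) S = S - {i}"

text \<open>The inequality of Loomis and Whitney with an additional function \<open>\<Phi> None\<close>. The coordinates are summed up one at a time.
  When it is the turn of \<open>i\<close>, exactly one of the \<open>d + 1\<close> factors is constant in that coordinate, and Hoelder's
  inequality applies to the remaining \<open>d\<close>.\<close>

lemma box_sum_prod_root_le:
  fixes \<Phi> :: "'n::finite option \<Rightarrow> ('n \<Rightarrow> nat) \<Rightarrow> real"
  assumes nn: "\<And>p k. 0 \<le> \<Phi> p k" and ind: "\<And>i k t. \<Phi> (Some i) (k(i := t)) = \<Phi> (Some i) k"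
  shows "box_sum N S (\<lambda>k. \<Prod>p\<in>UNIV. root CARD('n) (\<Phi> p k)) y \<le> (\<Prod>p\<in>UNIV. root CARD('n) (box_sum N (drop_coord p S) (\<Phi> p) y))"
proof (induction S arbitrary: y rule: finite_induct[OF finite])
  case 1
  have "drop_coord p {} = {}" for p :: "'n option" by (cases p) auto
  then show ?case by (simp add: box_sum_empty)
next
  case (2 i S)
  let ?r = "root CARD('n)"
  let ?J = "UNIV - {Some i}"
  have dcard: "card (UNIV - {Some i}) = CARD('n)"
    by (simp add: card_Diff_singleton card_UNIV_option)
  have dl: "drop_coord p (insert i S) = insert i (drop_coord p S)" "i \<notin> drop_coord p S" if "p \<noteq> Some i" for p
    using that 2(2) by (cases p; auto)+
  have dl': "drop_coord (Some i) (insert i S) = S" "drop_coord (Some i) S = S" using 2(2) by auto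
  have "box_sum N (insert i S) (\<lambda>k. \<Prod>p\<in>UNIV. ?r (\<Phi> p k)) y = (\<Sum>t<N. box_sum N S (\<lambda>k. \<Prod>p\<in>UNIV. ?r (\<Phi> p k)) (y(i := t)))"
    by (rule box_sum_insert[OF 2(2)])
  also have "\<dots> \<le> (\<Sum>t<N. \<Prod>p\<in>UNIV. ?r (box_sum N (drop_coord p S) (\<Phi> p) (y(i := t))))"
    by (intro sum_mono 2(3))
  also have "\<dots> = (\<Sum>t<N. ?r (box_sum N S (\<Phi> (Some i)) y) * (\<Prod>p\<in>?J. ?r (box_sum N (drop_coord p S) (\<Phi> p) (y(i := t)))))"
    using 2(2) ind by (intro sum.cong refl, subst prod.remove[of _ "Some i"]) (auto simp: dl' box_sum_indep)
  also have "\<dots> = ?r (box_sum N S (\<Phi> (Some i)) y) * (\<Sum>t<N. \<Prod>p\<in>?J. ?r (box_sum N (drop_coord p S) (\<Phi> p) (y(i := t))))"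
    by (simp add: sum_distrib_left)
  also have "\<dots> \<le> ?r (box_sum N S (\<Phi> (Some i)) y) * (\<Prod>p\<in>?J. ?r (\<Sum>t<N. box_sum N (drop_coord p S) (\<Phi> p) (y(i := t))))"
    using nn dcard by (intro mult_left_mono sum_prod_root_le) (auto intro!: box_sum_nonneg)
  also have "\<dots> = ?r (box_sum N S (\<Phi> (Some i)) y) * (\<Prod>p\<in>?J. ?r (box_sum N (drop_coord p (insert i S)) (\<Phi> p) y))"
    by (intro arg_cong2[where f="(*)"] refl prod.cong) (auto simp: dl box_sum_insert)
  also have "\<dots> = (\<Prod>p\<in>UNIV. ?r (box_sum N (drop_coord p (insert i S)) (\<Phi> p) y))"
    by (subst (2) prod.remove[of _ "Some i"]) (auto simp: dl' simp del: drop_coord.simps)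
  finally show ?case .
qed

text \<open>Each of the \<open>d\<close> factors \<open>root d \<bar>c k\<bar>\<close> of \<open>\<bar>c k\<bar>\<close> is bounded by the sum of the jumps along the line through \<open>k\<close> in one
  of the \<open>d\<close> directions, and this sum does not depend on the coordinate in that direction.\<close>

lemma discrete_sobolev:
  fixes c f :: "('n::finite \<Rightarrow> nat) \<Rightarrow> real"
  assumes N: "N > 0" and z: "\<And>i k. k i = N \<Longrightarrow> c k = 0"
  shows "(\<Sum>k\<in>grid N. \<bar>f k\<bar> * \<bar>c k\<bar>) \<le>
    root CARD('n) (\<Sum>k\<in>grid N. \<bar>f k\<bar> ^ CARD('n)) * (\<Prod>i\<in>UNIV. root CARD('n) (\<Sum>k\<in>grid N. \<bar>jump i c k\<bar>))"
proof -
  let ?r = "root CARD('n)"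
  define g where "g i k = (\<Sum>s<N. \<bar>jump i c (k(i := s))\<bar>)" for i k
  define \<Phi> where "\<Phi> p k = (case p of None \<Rightarrow> \<bar>f k\<bar> ^ CARD('n) | Some i \<Rightarrow> g i k)" for p k
  have popt: "(\<Prod>p\<in>UNIV. h p) = h None * (\<Prod>i\<in>(UNIV::'n set). h (Some i))" for h :: "'n option \<Rightarrow> real"
    unfolding UNIV_option_conv by (subst prod.insert) (auto simp: prod.reindex)
  have gr: "box_sum N UNIV \<phi> y = (\<Sum>k\<in>grid N. \<phi> k)" for \<phi> :: "('n \<Rightarrow> nat) \<Rightarrow> real" and y
    by (simp add: box_sum_def grid_PiE)
  have gi: "box_sum N (UNIV - {i}) (g i) (\<lambda>_. 0) = (\<Sum>k\<in>grid N. \<bar>jump i c k\<bar>)" for i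
  proof -
    have "box_sum N (UNIV - {i}) (g i) (\<lambda>_. 0) = (\<Sum>k\<in>{k\<in>grid N. k i = 0}. g i k)"
    proof -
      have "k \<in> PiE UNIV (\<lambda>j. if j \<in> UNIV - {i} then {..<N} else {0::nat}) \<longleftrightarrow> k \<in> {k\<in>grid N. k i = 0}" for k :: "'n \<Rightarrow> nat"
      proof -
        have "(\<forall>j. if j \<in> UNIV - {i} then k j < N else k j = 0) \<longleftrightarrow> (\<forall>j. j \<noteq> i \<longrightarrow> k j < N) \<and> k i = 0" by auto
        also have "\<dots> \<longleftrightarrow> (\<forall>j. k j < N) \<and> k i = 0"
        proof -
          have "k j < N" if "\<forall>j. j \<noteq> i \<longrightarrow> k j < N" "k i = 0" for j
            using that N by (cases "j = i") auto
          then show ?thesis by blast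
        qed
        finally show ?thesis unfolding box_sum_dom grid_def mem_Collect_eq .
      qed
      then have E: "PiE UNIV (\<lambda>j. if j \<in> UNIV - {i} then {..<N} else {0::nat}) = {k\<in>grid N. k i = 0}" by blast
      show ?thesis unfolding box_sum_def E ..
    qed
    also have "\<dots> = (\<Sum>k\<in>grid N. \<bar>jump i c k\<bar>)" unfolding g_def by (rule grid_lines[OF N])
    finally show ?thesis .
  qed
  have g0: "0 \<le> g i k" for i k by (simp add: g_def sum_nonneg)
  have pt: "\<bar>f k\<bar> * \<bar>c k\<bar> \<le> (\<Prod>p\<in>UNIV. ?r (\<Phi> p k))" if k: "k \<in> grid N" for k
  proof -
    have "\<bar>c k\<bar> = (?r \<bar>c k\<bar>) ^ CARD('n)" by simp
    also have "\<dots> = (\<Prod>i\<in>(UNIV::'n set). ?r \<bar>c k\<bar>)" by simp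
    also have "\<dots> \<le> (\<Prod>i\<in>UNIV. ?r (g i k))"
      using abs_le_line_jumps[OF k z] by (intro prod_mono) (auto simp: g_def)
    finally have "\<bar>c k\<bar> \<le> (\<Prod>i\<in>UNIV. ?r (g i k))" .
    then show ?thesis
      by (simp add: popt \<Phi>_def real_root_power_cancel mult_left_mono)
  qed
  have "(\<Sum>k\<in>grid N. \<bar>f k\<bar> * \<bar>c k\<bar>) \<le> (\<Sum>k\<in>grid N. \<Prod>p\<in>UNIV. ?r (\<Phi> p k))"
    by (intro sum_mono pt)
  also have "\<dots> = box_sum N UNIV (\<lambda>k. \<Prod>p\<in>UNIV. ?r (\<Phi> p k)) (\<lambda>_. 0)" by (simp only: gr)
  also have "\<dots> \<le> (\<Prod>p\<in>UNIV. ?r (box_sum N (drop_coord p UNIV) (\<Phi> p) (\<lambda>_. 0)))"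
    by (rule box_sum_prod_root_le) (auto simp: \<Phi>_def g_def split: option.split intro!: sum_nonneg)
  also have "\<dots> = ?r (\<Sum>k\<in>grid N. \<bar>f k\<bar> ^ CARD('n)) * (\<Prod>i\<in>UNIV. ?r (\<Sum>k\<in>grid N. \<bar>jump i c k\<bar>))"
    by (simp add: popt \<Phi>_def[abs_def] gr gi)
  finally show ?thesis .
qed

section \<open>The Sobolev inequality\<close>

text \<open>The cubes are closed, so a step function has the expected values only off their faces, where exactly one summand
  remains.\<close>

lemma AE_cell:
  assumes N: "N > 0"
  shows "AE x in lborel. x \<in> unit_cube \<longrightarrow> (\<exists>k\<in>grid N. x \<in> cell N k \<and> (\<forall>c. step N c x = c k))"
proof -
  have "AE x in lborel. \<forall>k\<in>grid N. indicator (cell N k) x = (indicator (box (\<chi> i. real (k i) / real N) (\<chi> i. (real (k i) + 1) / real N)) x :: real)"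
    by (subst AE_finite_all) (auto intro: AE_cell_box)
  then show ?thesis
  proof (rule AE_mp, intro AE_I2 impI)
    fix x :: "real^'a"
    assume bx: "\<forall>k\<in>grid N. indicator (cell N k) x = (indicator (box (\<chi> i. real (k i) / real N) (\<chi> i. (real (k i) + 1) / real N)) x :: real)"
      and x: "x \<in> unit_cube"
    have x01: "0 \<le> x $ i" "x $ i \<le> 1" for i using x by (auto simp: mem_box_cart)
    \<comment> \<open>the upper boundary of the unit cube belongs to the last cubes\<close>
    define k where "k i = (if x $ i = 1 then N - 1 else nat \<lfloor>real N * x $ i\<rfloor>)" for i
    have kN: "k i < N" and kx: "real (k i) \<le> real N * x $ i" "real N * x $ i \<le> real (k i) + 1" for i
    proof -
      have "nat \<lfloor>real N * x $ i\<rfloor> < N" if "x $ i \<noteq> 1"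
      proof -
        have "x $ i < 1" using x01(2)[of i] that by linarith
        then have "real N * x $ i < real N" using N by simp
        then show ?thesis using x01[of i] by (simp add: nat_less_iff floor_less_iff)
      qed
      then show "k i < N" using N by (auto simp: k_def)
      show "real (k i) \<le> real N * x $ i" "real N * x $ i \<le> real (k i) + 1"
        using x01[of i] N by (auto simp: k_def of_nat_diff of_nat_nat intro: less_imp_le)
    qed
    have kg: "k \<in> grid N" using kN by (simp add: grid_def)
    have xk: "x \<in> cell N k" using kx N by (auto simp: cell_def mem_box_cart field_simps)
    have inner: "real (k' i) / real N < x $ i" "x $ i < (real (k' i) + 1) / real N" if "k' \<in> grid N" "x \<in> cell N k'" for k' i
    proof -
      have "x \<in> box (\<chi> i. real (k' i) / real N) (\<chi> i. (real (k' i) + 1) / real N)"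
        using bx[rule_format, OF that(1)] that(2) by (simp add: indicator_def split: if_splits)
      then show "real (k' i) / real N < x $ i" "x $ i < (real (k' i) + 1) / real N"
        by (simp_all add: mem_box_cart)
    qed
    have un: "k' = k" if "k' \<in> grid N" "x \<in> cell N k'" for k'
    proof (rule ext)
      fix i
      have "real (k' i) / real N < (real (k i) + 1) / real N" "real (k i) / real N < (real (k' i) + 1) / real N"
        using inner[OF that, of i] inner[OF kg xk, of i] by linarith+
      then have "real (k' i) < real (k i) + 1" "real (k i) < real (k' i) + 1"
        using N by (auto simp: divide_less_cancel)
      then show "k' i = k i" by linarith
    qed
    have "step N c x = c k" for c
    proof -
      have "step N c x = (\<Sum>k'\<in>grid N. if k' = k then c k else 0)"
        unfolding step_def
      proof (rule sum.cong[OF refl])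
        fix k' :: "'a \<Rightarrow> nat" assume k': "k' \<in> grid N"
        show "c k' * indicator (cell N k') x = (if k' = k then c k else 0)"
        proof (cases "k' = k")
          case True
          then show ?thesis using xk by simp
        next
          case False
          then have "x \<notin> cell N k'" using un[OF k'] by blast
          with False show ?thesis by simp
        qed
      qed
      also have "\<dots> = c k" using kg by simp
      finally show ?thesis .
    qed
    with kg xk show "\<exists>k\<in>grid N. x \<in> cell N k \<and> (\<forall>c. step N c x = c k)" by blast
  qed
qed

lemma step_measurable [measurable]: "step N c \<in> borel_measurable borel"
  using borel_measurable_integrable[OF integrable_step[of N c]] by simp

lemma step_outside: "N > 0 \<Longrightarrow> x \<notin> unit_cube \<Longrightarrow> step N c x = 0"
  unfolding step_def using cell_subset_cube[of N] by (intro sum.neutral) (auto simp: indicator_def)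

lemma integral_step: "N > 0 \<Longrightarrow> (\<integral>x. step N c x \<partial>lborel) = (1 / real N) ^ CARD('n) * (\<Sum>k\<in>grid N. c (k :: 'n::finite \<Rightarrow> nat))"
  unfolding step_def
  by (subst Bochner_Integration.integral_sum) (auto simp: integrable_cell measure_cell sum_distrib_right mult.commute intro!: integrable_mult_right)

lemma integral_step_times:
  assumes "integrable lborel u"
  shows "(\<integral>x. step N c x * u x \<partial>lborel) = (\<Sum>k\<in>grid N. c k * cell_int N u k)"
proof -
  have i: "integrable lborel (\<lambda>x. c k * (u x * indicator (cell N k) x))" for k
    using integrable_real_mult_indicator[OF _ assms, of "cell N k"] by (simp add: cell_def)
  have "(\<integral>x. step N c x * u x \<partial>lborel) = (\<integral>x. (\<Sum>k\<in>grid N. c k * (u x * indicator (cell N k) x)) \<partial>lborel)"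
    unfolding step_def sum_distrib_right by (simp only: mult_ac)
  also have "\<dots> = (\<Sum>k\<in>grid N. c k * cell_int N u k)"
    using i by (subst Bochner_Integration.integral_sum) (auto simp: cell_int_def)
  finally show ?thesis .
qed

definition Ld_norm :: "(real^'n::finite \<Rightarrow> real) \<Rightarrow> real" where
  "Ld_norm F = root CARD('n) (\<integral>x. \<bar>F x\<bar> ^ CARD('n) \<partial>lborel)"

text \<open>The discrete inequality for the integrals over the cubes. The factor \<open>1/N\<close> that comes with the bound on the jumps
  turns the sum of the \<open>\<bar>c k\<bar>\<^sup>d\<close> into an integral.\<close>

lemma sobolev_step:
  fixes u :: "real^'n::finite \<Rightarrow> real"
  assumes u: "u \<in> BV_cube" and N: "N > 0"
  shows "\<bar>\<integral>x. step N c x * u x \<partial>lborel\<bar> \<le> Ld_norm (step N c) * var u"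
proof -
  let ?r = "root CARD('n)" and ?v = "cell_int N u"
  have z: "?v k = 0" if "k i = N" for i k
    by (rule cell_int_outside[OF u N, where k=k and i=i]) (simp add: that)
  have V: "0 \<le> var u / real N" using var_nonneg[of u] by simp
  have "\<bar>\<integral>x. step N c x * u x \<partial>lborel\<bar> \<le> (\<Sum>k\<in>grid N. \<bar>c k\<bar> * \<bar>?v k\<bar>)"
    unfolding integral_step_times[OF BV_cube_integrable[OF u]]
    by (rule order_trans[OF sum_abs]) (simp add: abs_mult)
  also have "\<dots> \<le> ?r (\<Sum>k\<in>grid N. \<bar>c k\<bar> ^ CARD('n)) * (\<Prod>i\<in>UNIV. ?r (\<Sum>k\<in>grid N. \<bar>jump i ?v k\<bar>))"
    by (rule discrete_sobolev[OF N z])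
  also have "\<dots> \<le> ?r (\<Sum>k\<in>grid N. \<bar>c k\<bar> ^ CARD('n)) * (\<Prod>i\<in>(UNIV::'n set). ?r (var u / real N))"
    using sum_jumps_le_var[OF u N] by (intro mult_left_mono prod_mono) (auto intro!: sum_nonneg)
  also have "\<dots> = ?r (\<Sum>k\<in>grid N. \<bar>c k\<bar> ^ CARD('n)) * (1 / real N) * var u"
    using V by simp
  also have "?r (\<Sum>k\<in>grid N. \<bar>c k\<bar> ^ CARD('n)) * (1 / real N) = ?r ((1 / real N) ^ CARD('n) * (\<Sum>k\<in>grid N. \<bar>c k\<bar> ^ CARD('n)))"
    by (simp add: real_root_mult real_root_power_cancel del: power_one_over)
  also have "(1 / real N) ^ CARD('n) * (\<Sum>k\<in>grid N. \<bar>c k\<bar> ^ CARD('n)) = (\<integral>x. \<bar>step N c x\<bar> ^ CARD('n) \<partial>lborel)"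
  proof -
    have "(\<integral>x. \<bar>step N c x\<bar> ^ CARD('n) \<partial>lborel) = (\<integral>x. step N (\<lambda>k. \<bar>c k\<bar> ^ CARD('n)) x \<partial>lborel)"
    proof (rule integral_cong_AE)
      show "AE x in lborel. \<bar>step N c x\<bar> ^ CARD('n) = step N (\<lambda>k. \<bar>c k\<bar> ^ CARD('n)) x"
        using AE_cell[OF N]
      proof eventually_elim
        case (elim x)
        then show ?case by (cases "x \<in> unit_cube") (auto simp: step_outside[OF N])
      qed
    qed measurable
    then show ?thesis by (simp add: integral_step[OF N])
  qed
  finally show ?thesis by (simp add: Ld_norm_def)
qed

lemma step_approx_continuous:
  fixes G :: "real^'n::finite \<Rightarrow> real"
  assumes G: "continuous_on UNIV G" "\<And>x. \<bar>G x\<bar> \<le> b" and e: "e > 0"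
  obtains n c where "AE x in lborel. x \<in> unit_cube \<longrightarrow> \<bar>step (2 ^ n) c x - G x\<bar> \<le> e" "\<And>k. \<bar>c k\<bar> \<le> b"
proof -
  have "uniformly_continuous_on unit_cube G"
    by (intro compact_uniformly_continuous continuous_on_subset[OF G(1)]) (rule subset_UNIV, rule compact_cbox)
  then obtain \<delta> where \<delta>: "\<delta> > 0" "\<And>x y. x \<in> unit_cube \<Longrightarrow> y \<in> unit_cube \<Longrightarrow> dist y x < \<delta> \<Longrightarrow> dist (G y) (G x) < e"
    using e unfolding uniformly_continuous_on_def by metis
  obtain n where n: "real CARD('n) / \<delta> < 2 ^ n"
    using real_arch_pow[of 2 "real CARD('n) / \<delta>"] by auto
  define N where "N = (2::nat) ^ n"
  have N: "N > 0" "real CARD('n) / real N < \<delta>" using n \<delta>(1) by (auto simp: N_def field_simps)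
  define p :: "('n \<Rightarrow> nat) \<Rightarrow> real^'n" where "p k = (\<chi> i. real (k i) / real N)" for k
  define c where "c k = G (p k)" for k
  show ?thesis
  proof
    show "\<bar>c k\<bar> \<le> b" for k using G(2) by (simp add: c_def)
    show "AE x in lborel. x \<in> unit_cube \<longrightarrow> \<bar>step (2 ^ n) c x - G x\<bar> \<le> e"
      using AE_cell[OF N(1)]
    proof eventually_elim
      case (elim x)
      show ?case
      proof
        assume x: "x \<in> unit_cube"
        with elim obtain k where k: "k \<in> grid N" "x \<in> cell N k" "step N c x = c k" by blast
        have "p k \<in> cell N k" by (auto simp: p_def cell_def mem_box_cart divide_right_mono)
        then have pk: "p k \<in> unit_cube" using cell_subset_cube[OF N(1) k(1)] by blast
        have "dist (p k) x \<le> (\<Sum>i\<in>UNIV. \<bar>(p k - x) $ i\<bar>)" unfolding dist_norm by (rule norm_le_l1_cart)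
        also have "\<dots> \<le> (\<Sum>i\<in>(UNIV::'n set). 1 / real N)"
        proof (rule sum_mono)
          fix i
          have "real (k i) / real N \<le> x $ i" "x $ i \<le> (real (k i) + 1) / real N" using k(2) by (auto simp: cell_def mem_box_cart)
          then show "\<bar>(p k - x) $ i\<bar> \<le> 1 / real N" by (simp add: p_def add_divide_distrib)
        qed
        also have "\<dots> < \<delta>" using N(2) by simp
        finally have "dist (G (p k)) (G x) < e" using \<delta>(2)[OF x pk] by blast
        then show "\<bar>step (2 ^ n) c x - G x\<bar> \<le> e" using k(3) by (simp add: c_def dist_real_def N_def)
      qed
    qed
  qed
qed

text \<open>Measurable functions are limits almost everywhere of continuous ones, which can be truncated, and these are approximated
  uniformly on the cube by dyadic step functions.\<close>

lemma step_approx_bounded: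
  fixes g :: "real^'n::finite \<Rightarrow> real"
  assumes g: "g \<in> borel_measurable borel" "\<And>x. \<bar>g x\<bar> \<le> b" "\<And>x. x \<notin> unit_cube \<Longrightarrow> g x = 0"
  obtains n c where "AE x in lborel. (\<lambda>j. step (2 ^ n j) (c j) x) \<longlonglongrightarrow> g x" "\<And>j k. \<bar>c j k\<bar> \<le> b"
proof -
  have b0: "0 \<le> b" using g(2)[of 0] by linarith
  have "g \<in> borel_measurable lebesgue" using g(1) by (simp add: measurable_completion)
  then have "g measurable_on UNIV" by (rule lebesgue_measurable_imp_measurable_on) simp
  then obtain Z G where Z: "negligible Z" and G: "\<And>j. continuous_on UNIV (G j)" "\<And>x. x \<notin> Z \<Longrightarrow> (\<lambda>j. G j x) \<longlonglongrightarrow> g x"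
    unfolding measurable_on_def by auto
  define H where "H j x = max (- b) (min b (G j x))" for j :: nat and x
  have H: "continuous_on UNIV (H j)" "\<bar>H j x\<bar> \<le> b" for j x
    using b0 unfolding H_def by (auto intro!: continuous_intros G(1))
  have Hg: "(\<lambda>j. H j x) \<longlonglongrightarrow> g x" if "x \<notin> Z" for x
  proof -
    have "(\<lambda>j. H j x) \<longlonglongrightarrow> max (- b) (min b (g x))"
      unfolding H_def by (intro tendsto_intros G(2) that)
    then show ?thesis using g(2)[of x] by (simp add: abs_le_iff max_def min_def split: if_splits)
  qed
  have ex: "\<exists>p. (AE x in lborel. x \<in> unit_cube \<longrightarrow> \<bar>step (2 ^ fst p) (snd p) x - H j x\<bar> \<le> inverse (real (Suc j))) \<and> (\<forall>k. \<bar>snd p k\<bar> \<le> b)" for j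
  proof -
    obtain n c where "AE x in lborel. x \<in> unit_cube \<longrightarrow> \<bar>step (2 ^ n) c x - H j x\<bar> \<le> inverse (real (Suc j))" "\<And>k. \<bar>c k\<bar> \<le> b"
      using step_approx_continuous[OF H, of "inverse (real (Suc j))" j] by auto
    then show ?thesis by (intro exI[of _ "(n, c)"]) simp
  qed
  have "\<exists>p. \<forall>j. (AE x in lborel. x \<in> unit_cube \<longrightarrow> \<bar>step (2 ^ fst (p j)) (snd (p j)) x - H j x\<bar> \<le> inverse (real (Suc j))) \<and> (\<forall>k. \<bar>snd (p j) k\<bar> \<le> b)"
    by (intro choice allI ex)
  then obtain p where p: "\<forall>j. (AE x in lborel. x \<in> unit_cube \<longrightarrow> \<bar>step (2 ^ fst (p j)) (snd (p j)) x - H j x\<bar> \<le> inverse (real (Suc j))) \<and> (\<forall>k. \<bar>snd (p j) k\<bar> \<le> b)"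
    by blast
  define n where "n j = fst (p j)" for j
  define c where "c j = snd (p j)" for j
  have nc: "\<And>j. AE x in lborel. x \<in> unit_cube \<longrightarrow> \<bar>step (2 ^ n j) (c j) x - H j x\<bar> \<le> inverse (real (Suc j))"
    "\<And>j k. \<bar>c j k\<bar> \<le> b" using p unfolding n_def c_def by blast+
  have "AE x in lborel. \<forall>j. x \<in> unit_cube \<longrightarrow> \<bar>step (2 ^ n j) (c j) x - H j x\<bar> \<le> inverse (real (Suc j))"
    unfolding AE_all_countable using nc(1) by blast
  moreover have "AE x in lborel. x \<notin> Z"
  proof -
    have "Z \<in> null_sets lebesgue" using Z by (simp add: negligible_iff_null_sets)
    then obtain Z' where "Z \<subseteq> Z'" "Z' \<in> null_sets lborel" unfolding null_sets_completion_iff2 by auto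
    then show ?thesis by (intro AE_I'[of Z']) auto
  qed
  ultimately have "AE x in lborel. (\<lambda>j. step (2 ^ n j) (c j) x) \<longlonglongrightarrow> g x"
  proof eventually_elim
    case (elim x)
    show ?case
    proof (cases "x \<in> unit_cube")
      case True
      have "(\<lambda>j. step (2 ^ n j) (c j) x - H j x) \<longlonglongrightarrow> 0"
        using elim(1) True by (intro Lim_null_comparison[OF _ LIMSEQ_inverse_real_of_nat]) auto
      from tendsto_add[OF this Hg[OF elim(2)]] show ?thesis by simp
    next
      case False
      then show ?thesis using g(3) by (simp add: step_outside)
    qed
  qed
  then show ?thesis using nc(2) by (rule that)
qed

lemma step_bound:
  assumes N: "N > 0" and "\<And>k. \<bar>c k\<bar> \<le> b"
  shows "AE x in lborel. \<bar>step N c x\<bar> \<le> b * indicator unit_cube x"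
  using AE_cell[OF N]
proof eventually_elim
  case (elim x)
  then show ?case using assms(2) by (cases "x \<in> unit_cube") (auto simp: step_outside[OF N])
qed

lemma integrable_cube: "integrable lborel (\<lambda>x. b * indicator unit_cube (x::real^'n::finite) :: real)"
  by (intro integrable_mult_right integrable_real_indicator) (simp_all add: emeasure_lborel_cbox_finite[unfolded infinity_ennreal_def])

lemma sobolev_bounded:
  fixes g u :: "real^'n::finite \<Rightarrow> real"
  assumes g: "g \<in> borel_measurable borel" "\<And>x. \<bar>g x\<bar> \<le> b" "\<And>x. x \<notin> unit_cube \<Longrightarrow> g x = 0" and u: "u \<in> BV_cube"
  shows "\<bar>\<integral>x. g x * u x \<partial>lborel\<bar> \<le> Ld_norm g * var u"
proof -
  note um = borel_measurable_integrable[OF BV_cube_integrable[OF u]]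
  obtain n c where nc: "AE x in lborel. (\<lambda>j. step (2 ^ n j) (c j) x) \<longlonglongrightarrow> g x" "\<And>j k. \<bar>c j k\<bar> \<le> b"
    using step_approx_bounded[OF g] by blast
  have bd: "AE x in lborel. \<bar>step (2 ^ n j) (c j) x\<bar> \<le> b * indicator unit_cube x" for j
    by (rule step_bound) (use nc(2) in auto)
  have b0: "0 \<le> b" using g(2)[of 0] by linarith
  have lim1: "(\<lambda>j. \<integral>x. step (2 ^ n j) (c j) x * u x \<partial>lborel) \<longlonglongrightarrow> (\<integral>x. g x * u x \<partial>lborel)"
  proof (rule integral_dominated_convergence[where w="\<lambda>x. b * \<bar>u x\<bar>"])
    show "AE x in lborel. norm (step (2 ^ n j) (c j) x * u x) \<le> b * \<bar>u x\<bar>" for j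
      using bd[of j]
    proof eventually_elim
      case (elim x)
      then have "\<bar>step (2 ^ n j) (c j) x\<bar> \<le> b" using b0 by (cases "x \<in> unit_cube") auto
      then show ?case by (simp add: abs_mult mult_right_mono)
    qed
    show "AE x in lborel. (\<lambda>j. step (2 ^ n j) (c j) x * u x) \<longlonglongrightarrow> g x * u x"
      using nc(1) by eventually_elim (intro tendsto_intros)
  qed (use um g(1) BV_cube_integrable[OF u] step_measurable in auto)
  have lim2: "(\<lambda>j. \<integral>x. \<bar>step (2 ^ n j) (c j) x\<bar> ^ CARD('n) \<partial>lborel) \<longlonglongrightarrow> (\<integral>x. \<bar>g x\<bar> ^ CARD('n) \<partial>lborel)"
  proof (rule integral_dominated_convergence[where w="\<lambda>x. b ^ CARD('n) * indicator unit_cube x"])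
    show "AE x in lborel. norm (\<bar>step (2 ^ n j) (c j) x\<bar> ^ CARD('n)) \<le> b ^ CARD('n) * indicator unit_cube x" for j
      using bd[of j]
    proof eventually_elim
      case (elim x)
      then have "\<bar>step (2 ^ n j) (c j) x\<bar> ^ CARD('n) \<le> (b * indicator unit_cube x) ^ CARD('n)"
        by (intro power_mono) auto
      then show ?case by (cases "x \<in> unit_cube") (auto simp: zero_power)
    qed
    show "AE x in lborel. (\<lambda>j. \<bar>step (2 ^ n j) (c j) x\<bar> ^ CARD('n)) \<longlonglongrightarrow> \<bar>g x\<bar> ^ CARD('n)"
      using nc(1) by eventually_elim (intro tendsto_intros)
  qed (use g(1) step_measurable integrable_cube in auto)
  show ?thesis
  proof (rule LIMSEQ_le)
    show "(\<lambda>j. \<bar>\<integral>x. step (2 ^ n j) (c j) x * u x \<partial>lborel\<bar>) \<longlonglongrightarrow> \<bar>\<integral>x. g x * u x \<partial>lborel\<bar>"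
      by (intro tendsto_intros lim1)
    show "(\<lambda>j. Ld_norm (step (2 ^ n j) (c j)) * var u) \<longlonglongrightarrow> Ld_norm g * var u"
      unfolding Ld_norm_def by (intro tendsto_intros lim2)
    show "\<exists>N. \<forall>j\<ge>N. \<bar>\<integral>x. step (2 ^ n j) (c j) x * u x \<partial>lborel\<bar> \<le> Ld_norm (step (2 ^ n j) (c j)) * var u"
      using sobolev_step[OF u] by auto
  qed
qed

lemma Ld_norm_mono:
  fixes F G :: "real^'n::finite \<Rightarrow> real"
  assumes "G \<in> borel_measurable borel" "integrable lborel (\<lambda>x. \<bar>F x\<bar> ^ CARD('n))" "\<And>x. \<bar>G x\<bar> \<le> \<bar>F x\<bar>"
  shows "Ld_norm G \<le> Ld_norm F"
proof -
  have "integrable lborel (\<lambda>x. \<bar>G x\<bar> ^ CARD('n))"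
    using assms by (intro Bochner_Integration.integrable_bound[OF assms(2)]) (auto intro!: power_mono)
  then show ?thesis unfolding Ld_norm_def using assms
    by (intro real_root_le_mono integral_mono power_mono) auto
qed

lemma Ld_norm_nonneg: "0 \<le> Ld_norm F"
  unfolding Ld_norm_def by (intro real_root_ge_zero integral_nonneg_AE) auto

text \<open>For unbounded \<open>F\<close> the integrability of \<open>F u\<close> is part of the claim. It comes from the bounded case applied
  to truncations of \<open>\<bar>F\<bar> sgn u\<close>, for which the integrand is nonnegative, and Fatou's lemma.\<close>

lemma sobolev:
  fixes F u :: "real^'n::finite \<Rightarrow> real"
  assumes F: "F \<in> borel_measurable borel" "integrable lborel (\<lambda>x. \<bar>F x\<bar> ^ CARD('n))" "\<And>x. x \<notin> unit_cube \<Longrightarrow> F x = 0"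
    and u: "u \<in> BV_cube"
  shows "integrable lborel (\<lambda>x. F x * u x)" "\<bar>\<integral>x. F x * u x \<partial>lborel\<bar> \<le> Ld_norm F * var u"
proof -
  note um = borel_measurable_integrable[OF BV_cube_integrable[OF u], simplified]
  define g where "g m x = (if \<bar>F x\<bar> \<le> real m then \<bar>F x\<bar> * sgn (u x) else 0)" for m x
  have gm: "g m \<in> borel_measurable borel" for m unfolding g_def using F(1) um by measurable
  have gF: "\<bar>g m x\<bar> \<le> \<bar>F x\<bar>" "\<bar>g m x\<bar> \<le> real m" for m x
    by (auto simp: g_def abs_mult abs_sgn_eq)
  have gux: "g m x * u x = (if \<bar>F x\<bar> \<le> real m then \<bar>F x * u x\<bar> else 0)" for m x
    by (simp add: g_def abs_mult abs_sgn[of "u x"] mult_ac)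
  then have gu: "0 \<le> g m x * u x" for m x by simp
  have igu: "integrable lborel (\<lambda>x. g m x * u x)" for m
    using integrable_times_bounded[OF BV_cube_integrable[OF u] gm gF(2)] by (simp add: mult.commute)
  have le: "(\<integral>\<^sup>+x. ennreal (g m x * u x) \<partial>lborel) \<le> ennreal (Ld_norm F * var u)" for m
  proof -
    have "g m x = 0" if "x \<notin> unit_cube" for x using F(3)[OF that] by (simp add: g_def)
    from sobolev_bounded[OF gm gF(2) this u]
    have "(\<integral>x. g m x * u x \<partial>lborel) \<le> Ld_norm (g m) * var u" by linarith
    also have "\<dots> \<le> Ld_norm F * var u"
      by (intro mult_right_mono Ld_norm_mono gm F(2) gF(1) var_nonneg)
    finally show ?thesis by (simp add: nn_integral_eq_integral[OF igu] gu ennreal_leI)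
  qed
  have lim: "(\<lambda>m. ennreal (g m x * u x)) \<longlonglongrightarrow> ennreal \<bar>F x * u x\<bar>" for x
  proof (rule tendsto_eventually)
    obtain m0 :: nat where "\<bar>F x\<bar> \<le> real m0" using real_arch_simple by blast
    then show "\<forall>\<^sub>F m in sequentially. ennreal (g m x * u x) = ennreal \<bar>F x * u x\<bar>"
      by (intro eventually_sequentiallyI[of m0]) (auto simp: gux)
  qed
  have nn: "(\<integral>\<^sup>+x. ennreal \<bar>F x * u x\<bar> \<partial>lborel) \<le> ennreal (Ld_norm F * var u)"
  proof -
    have "(\<integral>\<^sup>+x. ennreal \<bar>F x * u x\<bar> \<partial>lborel) = (\<integral>\<^sup>+x. liminf (\<lambda>m. ennreal (g m x * u x)) \<partial>lborel)"
      using lim_imp_Liminf[OF _ lim] by simp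
    also have "\<dots> \<le> liminf (\<lambda>m. \<integral>\<^sup>+x. ennreal (g m x * u x) \<partial>lborel)"
      using gm um by (intro nn_integral_liminf) auto
    also have "\<dots> \<le> liminf (\<lambda>m. ennreal (Ld_norm F * var u))"
      using le by (intro Liminf_mono) auto
    finally show ?thesis by (simp add: Liminf_const)
  qed
  show int: "integrable lborel (\<lambda>x. F x * u x)"
    using nn F(1) um by (intro integrableI_bounded) (auto simp: less_top[symmetric] top_unique intro: le_less_trans)
  have "\<bar>\<integral>x. F x * u x \<partial>lborel\<bar> \<le> (\<integral>x. \<bar>F x * u x\<bar> \<partial>lborel)" using integral_abs_bound .
  also have "\<dots> \<le> Ld_norm F * var u"
  proof -
    have "ennreal (\<integral>x. \<bar>F x * u x\<bar> \<partial>lborel) \<le> ennreal (Ld_norm F * var u)"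
      using nn int by (simp add: nn_integral_eq_integral)
    then show ?thesis using mult_nonneg_nonneg[OF Ld_norm_nonneg[of F] var_nonneg[of u]] by (simp add: ennreal_le_iff)
  qed
  finally show "\<bar>\<integral>x. F x * u x \<partial>lborel\<bar> \<le> Ld_norm F * var u" .
qed

section \<open>The sign matrices\<close>

lemma haar_matrix_sym: "haar_matrix m r l = haar_matrix m l r"
  by (induction m arbitrary: r l) (auto simp: mult.commute)

lemma abs_haar_matrix: "\<bar>haar_matrix m r l\<bar> = 1"
  by (induction m arbitrary: r l) (auto simp: abs_mult)

lemma haar_matrix_0: "haar_matrix m 0 l = 1"
  by (induction m arbitrary: l) auto

text \<open>The second half of the columns repeats the first half up to the signs of the block recursion, so the sum doubles
  or cancels.\<close>

lemma haar_matrix_orthogonal: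
  assumes "r < 2 ^ m" "s < 2 ^ m"
  shows "(\<Sum>l<2 ^ m. haar_matrix m r l * haar_matrix m s l) = (if r = s then 2 ^ m else 0)"
  using assms
proof (induction m arbitrary: r s)
  case (Suc m)
  let ?A = "haar_matrix m" and ?e = "\<lambda>r. if (2::nat) ^ m \<le> r then - 1 else (1::real)"
  have split: "(\<Sum>l<2 ^ Suc m. f l) = (\<Sum>l<2 ^ m. f l) + (\<Sum>l<2 ^ m. f (2 ^ m + l))" for f :: "nat \<Rightarrow> real"
  proof -
    have "(\<Sum>l<2 ^ Suc m. f l) = (\<Sum>l\<in>{0..<2 ^ m + 2 ^ m}. f l)" by (simp add: lessThan_atLeast0 mult_2)
    also have "\<dots> = (\<Sum>l\<in>{0..<2 ^ m}. f l) + (\<Sum>l\<in>{2 ^ m..<2 ^ m + 2 ^ m}. f l)"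
      by (rule sum.atLeastLessThan_concat[symmetric]) auto
    also have "(\<Sum>l\<in>{2 ^ m..<2 ^ m + 2 ^ m}. f l) = (\<Sum>l\<in>{0..<2 ^ m}. f (l + 2 ^ m))"
      using sum.shift_bounds_nat_ivl[of f 0 "2 ^ m" "2 ^ m"] by simp
    finally show ?thesis by (simp add: lessThan_atLeast0 add.commute)
  qed
  have lt: "r mod 2 ^ m < 2 ^ m" "s mod 2 ^ m < 2 ^ m" by auto
  have "(\<Sum>l<2 ^ Suc m. haar_matrix (Suc m) r l * haar_matrix (Suc m) s l) =
    (\<Sum>l<2 ^ m. ?A (r mod 2 ^ m) l * ?A (s mod 2 ^ m) l) + (\<Sum>l<2 ^ m. (?e r * ?e s) * (?A (r mod 2 ^ m) l * ?A (s mod 2 ^ m) l))"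
    unfolding split by (intro arg_cong2[where f="(+)"] sum.cong refl) auto
  also have "\<dots> = (1 + ?e r * ?e s) * (if r mod 2 ^ m = s mod 2 ^ m then 2 ^ m else 0)"
    unfolding sum_distrib_left[symmetric] Suc.IH[OF lt] by (simp add: algebra_simps)
  also have "\<dots> = (if r = s then 2 ^ Suc m else 0)"
  proof -
    have dm: "r = 2 ^ m * (r div 2 ^ m) + r mod 2 ^ m" "s = 2 ^ m * (s div 2 ^ m) + s mod 2 ^ m" by simp_all
    have d2: "r div 2 ^ m = (if 2 ^ m \<le> r then 1 else 0)" "s div 2 ^ m = (if 2 ^ m \<le> s then 1 else 0)"
      using Suc.prems by (auto intro!: div_nat_eqI)
    show ?thesis
    proof (cases "r = s")
      case False
      then have "r mod 2 ^ m \<noteq> s mod 2 ^ m \<or> (2 ^ m \<le> r) \<noteq> (2 ^ m \<le> s)"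
        using dm d2 by metis
      then show ?thesis using False by auto
    qed auto
  qed
  finally show ?case .
qed simp

lemma haar_matrix_row_sum: "0 < r \<Longrightarrow> r < 2 ^ m \<Longrightarrow> (\<Sum>l<2 ^ m. haar_matrix m r l) = 0"
  using haar_matrix_orthogonal[of r m 0] by (simp add: haar_matrix_0)

lemma haar_matrix_orthogonal_columns:
  assumes "l < 2 ^ m" "l' < 2 ^ m"
  shows "(\<Sum>r<2 ^ m. haar_matrix m r l * haar_matrix m r l') = (if l = l' then 2 ^ m else 0)"
  using haar_matrix_orthogonal[OF assms] by (simp add: haar_matrix_sym)

section \<open>The lexicographic enumeration\<close>

context
  fixes d D :: nat
  \<comment> \<open>\<open>D = 2\<^sup>d - 1\<close> is the number of Haar functions of one cube\<close>
  assumes D: "2 ^ d = Suc D" and D0: "D > 0" and d: "d > 0"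
begin

lemma next_index_r: "i < D \<Longrightarrow> (next_index d ^^ i) (n, k, Suc 0) = (n, k, Suc i)"
  by (induction i) (auto simp: D)

lemma next_index_block:
  "(next_index d ^^ D) (n, k, Suc 0) = (if k < 2 ^ (n * d) - Suc 0 then (n, Suc k, Suc 0) else (Suc n, 0, Suc 0))"
proof -
  obtain E where E: "D = Suc E" using D0 by (cases D) auto
  have "(next_index d ^^ Suc E) (n, k, Suc 0) = next_index d (n, k, Suc E)"
    using next_index_r[of E n k] E by simp
  then show ?thesis by (simp add: D E)
qed

lemma next_index_k: "k < 2 ^ (n * d) \<Longrightarrow> (next_index d ^^ (k * D)) (n, 0, Suc 0) = (n, k, Suc 0)"
proof (induction k)
  case (Suc k)
  then have "(next_index d ^^ (k * D)) (n, 0, Suc 0) = (n, k, Suc 0)" by simp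
  then have "(next_index d ^^ (Suc k * D)) (n, 0, Suc 0) = (next_index d ^^ D) (n, k, Suc 0)"
    by (simp only: mult_Suc funpow_add o_apply)
  then show ?case using Suc.prems by (simp only: next_index_block) auto
qed simp

text \<open>The functions before level \<open>n\<close> number \<open>2\<^sup>n\<^sup>d\<close>, including the constant one, and level \<open>n\<close> has \<open>2\<^sup>n\<^sup>d D\<close>.\<close>

lemma level_step: "2 ^ (n * d) + 2 ^ (n * d) * D = (2::nat) ^ (Suc n * d)"
  by (simp add: power_add D algebra_simps)

lemma next_index_n: "(next_index d ^^ (2 ^ (n * d) - Suc 0)) (0, 0, Suc 0) = (n, 0, Suc 0)"
proof (induction n)
  case (Suc n)
  obtain k where k: "(2::nat) ^ (n * d) = Suc k" by (cases "(2::nat) ^ (n * d)") auto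
  have e: "2 ^ (Suc n * d) - Suc 0 = D + (k * D + k)"
    unfolding level_step[of n, symmetric] k by simp
  have IH: "(next_index d ^^ k) (0, 0, Suc 0) = (n, 0, Suc 0)" using Suc.IH by (simp add: k)
  have kk: "(next_index d ^^ (k * D)) (n, 0, Suc 0) = (n, k, Suc 0)" using k by (intro next_index_k) simp
  show ?case unfolding e funpow_add o_apply IH kk next_index_block by (simp add: k)
qed simp

lemma next_index_funpow:
  assumes "k < 2 ^ (n * d)" "r < D"
  shows "(next_index d ^^ (r + (k * D + (2 ^ (n * d) - Suc 0)))) (0, 0, Suc 0) = (n, k, Suc r)"
  by (simp only: funpow_add o_apply next_index_n next_index_k[OF assms(1)] next_index_r[OF assms(2)])

text \<open>The level of \<open>j\<close> is found from the powers of \<open>2\<^sup>d\<close> that enclose it; the rest is division by \<open>D\<close>.\<close>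

lemma index_decode:
  fixes j :: nat
  assumes "j > 0"
  obtains n k r where "k < 2 ^ (n * d)" "r < D" "j = 2 ^ (n * d) + k * D + r"
proof -
  have "j < 2 ^ j" by (rule less_exp)
  also have "(2::nat) ^ j \<le> 2 ^ (j * d)" using d by (intro power_increasing) auto
  finally have ex: "j < 2 ^ (j * d)" .
  define m where "m = (LEAST m. j < 2 ^ (m * d))"
  have m: "j < 2 ^ (m * d)" unfolding m_def using ex by (rule LeastI)
  have "m \<noteq> 0"
  proof
    assume "m = 0"
    with m assms show False by simp
  qed
  then obtain n where n: "m = Suc n" by (cases m) auto
  have jn: "2 ^ (n * d) \<le> j"
    using not_less_Least[of n "\<lambda>m. j < 2 ^ (m * d)"] n by (simp add: m_def[symmetric])
  define i where "i = j - 2 ^ (n * d)"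
  have "i < 2 ^ (n * d) * D"
    using m jn unfolding n level_step[symmetric] i_def by linarith
  then have "i div D < 2 ^ (n * d)" by (rule less_mult_imp_div_less)
  moreover have "i mod D < D" using D0 by simp
  moreover have "j = 2 ^ (n * d) + i div D * D + i mod D"
    using jn by (simp add: i_def)
  ultimately show ?thesis by (rule that)
qed

end

lemma haar_seq_eq:
  fixes K :: "nat \<Rightarrow> nat \<Rightarrow> (real^'n::finite) set"
  assumes "2 ^ CARD('n) = Suc D" "k < 2 ^ (n * CARD('n))" "r < D"
  shows "haar_seq K (2 ^ (n * CARD('n)) + k * D + r) = haar K (n, k, Suc r)"
proof -
  obtain P where P: "(2::nat) ^ (n * CARD('n)) = Suc P" by (cases "(2::nat) ^ (n * CARD('n))") auto
  have "(next_index CARD('n) ^^ (r + (k * D + P))) (0, 0, Suc 0) = (n, k, Suc r)"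
    using next_index_funpow[OF assms(1) _ zero_less_card_finite assms(2,3)] assms(3) by (simp add: P)
  moreover have i: "2 ^ (n * CARD('n)) + k * D + r = Suc (r + (k * D + P))" by (simp add: P)
  ultimately show ?thesis unfolding i by (simp only: haar_seq.simps One_nat_def)
qed

lemma sum_blocks: "(\<Sum>j<m * b. f j) = (\<Sum>k<m. \<Sum>i<b. f (k * b + i))" for f :: "nat \<Rightarrow> 'a::comm_monoid_add"
proof -
  have "(\<Sum>j<m * b. f j) = (\<Sum>k<m. sum f {k * b..<k * b + b})" by (rule sum.nat_group[symmetric])
  also have "\<dots> = (\<Sum>k<m. \<Sum>i<b. f (k * b + i))"
  proof (rule sum.cong[OF refl])
    fix k show "sum f {k * b..<k * b + b} = (\<Sum>i<b. f (k * b + i))"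
      using sum.shift_bounds_nat_ivl[of f 0 "k * b" b] by (simp add: lessThan_atLeast0 add.commute)
  qed
  finally show ?thesis .
qed

section \<open>Overlaps of dyadic cubes\<close>

lemma cell_bounds: "x \<in> cell N k \<longleftrightarrow> (\<forall>i. real (k i) / real N \<le> x $ i \<and> x $ i \<le> (real (k i) + 1) / real N)"
  by (auto simp: cell_def mem_box_cart)

lemma cell_subset_coarse:
  assumes N: "N > 0" and R: "R > 0" and p: "\<And>i. p i div R = q i"
  shows "cell (N * R) p \<subseteq> cell N q"
proof
  fix x assume x: "x \<in> cell (N * R) p"
  show "x \<in> cell N q"
    unfolding cell_bounds
  proof
    fix i
    have "R * q i \<le> p i" "p i + 1 \<le> R * (q i + 1)"
      using p[of i] R mult_div_mod_eq[of R "p i"] mod_less_divisor[OF R, of "p i"] by (auto simp: algebra_simps)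
    then have "real (R * q i) \<le> real (p i)" "real (p i + 1) \<le> real (R * (q i + 1))"
      by (simp_all only: of_nat_le_iff)
    then have "real R * real (q i) \<le> real (p i)" "real (p i) + 1 \<le> real R * (real (q i) + 1)"
      by (simp_all add: algebra_simps)
    then have "real R * real (q i) / real (N * R) \<le> real (p i) / real (N * R)"
      "(real (p i) + 1) / real (N * R) \<le> real R * (real (q i) + 1) / real (N * R)"
      by (intro divide_right_mono; simp)+
    moreover have "real R * real (q i) / real (N * R) = real (q i) / real N" "real R * (real (q i) + 1) / real (N * R) = (real (q i) + 1) / real N"
      using R by simp_all
    ultimately have "real (q i) / real N \<le> real (p i) / real (N * R)" "(real (p i) + 1) / real (N * R) \<le> (real (q i) + 1) / real N"
      by (simp_all only:)
    then show "real (q i) / real N \<le> x $ i \<and> x $ i \<le> (real (q i) + 1) / real N"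
      using x[unfolded cell_bounds, rule_format, of i] by linarith
  qed
qed

text \<open>Dyadic cubes are nested or almost disjoint. In terms of the indices, nesting is integer division.\<close>

lemma cell_int_cell:
  fixes p q :: "'n::finite \<Rightarrow> nat"
  assumes N: "N > 0" and R: "R > 0"
  shows "cell_int (N * R) (indicator (cell N q)) p = (if \<forall>i. p i div R = q i then (1 / real (N * R)) ^ CARD('n) else 0)"
proof (cases "\<forall>i. p i div R = q i")
  case True
  then have sub: "cell (N * R) p \<subseteq> cell N q" using N R by (intro cell_subset_coarse) auto
  have "cell_int (N * R) (indicator (cell N q)) p = (\<integral>x. indicator (cell (N * R) p) x \<partial>lborel)"
    unfolding cell_int_def using sub by (intro Bochner_Integration.integral_cong) (auto simp: indicator_def)
  also have "\<dots> = (1 / real (N * R)) ^ CARD('n)" using measure_cell[of "N * R" p] N R by simp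
  finally show ?thesis using True by simp
next
  case False
  then obtain i where i: "p i div R \<noteq> q i" by blast
  have "AE x in lborel. indicator (cell N q) x * indicator (cell (N * R) p) x = (0::real)"
    using AE_cell_box[of N q] AE_cell_box[of "N * R" p]
  proof eventually_elim
    case (elim x)
    show ?case
    proof (rule ccontr)
      assume "\<not> ?thesis"
      then have "x \<in> box (\<chi> i. real (q i) / real N) (\<chi> i. (real (q i) + 1) / real N)"
        "x \<in> box (\<chi> i. real (p i) / real (N * R)) (\<chi> i. (real (p i) + 1) / real (N * R))"
        using elim by (auto simp: indicator_def split: if_splits)
      then have "real (q i) / real N < x $ i" "x $ i < (real (q i) + 1) / real N"
        "real (p i) / real (N * R) < x $ i" "x $ i < (real (p i) + 1) / real (N * R)"
        by (simp_all add: mem_box_cart)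
      then have "real (q i) / real N < (real (p i) + 1) / real (N * R)" "real (p i) / real (N * R) < (real (q i) + 1) / real N"
        by linarith+
      then have "real (q i) * real R < real (p i) + 1" "real (p i) < (real (q i) + 1) * real R"
        using N R by (auto simp: field_simps)
      then have "real (q i * R) < real (p i + 1)" "real (p i) < real ((q i + 1) * R)"
        by (simp_all add: algebra_simps)
      then have "q i * R < p i + 1" "p i < (q i + 1) * R" unfolding of_nat_less_iff .
      then have "p i div R = q i" by (intro div_nat_eqI) (auto simp: mult.commute)
      with i show False by blast
    qed
  qed
  then have "cell_int (N * R) (indicator (cell N q)) p = 0"
    unfolding cell_int_def by (rule integral_eq_zero_AE)
  then show ?thesis by (simp only: False if_False)
qed

lemma cell_inj: "N > 0 \<Longrightarrow> cell N p = cell N q \<Longrightarrow> p = q"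
proof (rule ext)
  fix i assume N: "N > 0" and e: "cell N p = cell N q"
  have "(\<chi> i. real (p i) / real N) \<in> cell N p" "(\<chi> i. real (q i) / real N) \<in> cell N q"
    by (auto simp: cell_bounds divide_right_mono)
  then have "(\<chi> i. real (p i) / real N) \<in> cell N q" "(\<chi> i. real (q i) / real N) \<in> cell N p" by (simp_all add: e)
  then have "real (q i) / real N \<le> real (p i) / real N" "real (p i) / real N \<le> real (q i) / real N"
    unfolding cell_bounds by (auto dest: spec[of _ i])
  then show "p i = q i" using N by (simp add: divide_le_cancel)
qed

lemma cell_subset_half:
  assumes N: "N > 0" and sub: "cell (N * 2) p \<subseteq> cell N q"
  shows "p i div 2 = q i"
proof -
  have "(\<chi> i. real (p i) / real (N * 2)) \<in> cell (N * 2) p" "(\<chi> i. (real (p i) + 1) / real (N * 2)) \<in> cell (N * 2) p"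
    by (auto simp: cell_bounds divide_right_mono)
  then have "(\<chi> i. real (p i) / real (N * 2)) \<in> cell N q" "(\<chi> i. (real (p i) + 1) / real (N * 2)) \<in> cell N q" using sub by auto
  then have "real (q i) / real N \<le> real (p i) / real (N * 2)" "(real (p i) + 1) / real (N * 2) \<le> (real (q i) + 1) / real N"
    unfolding cell_bounds by (auto dest: spec[of _ i])
  then have "2 * real (q i) \<le> real (p i)" "real (p i) + 1 \<le> 2 * (real (q i) + 1)" 
  proof -
    assume a: "real (q i) / real N \<le> real (p i) / real (N * 2)" and b: "(real (p i) + 1) / real (N * 2) \<le> (real (q i) + 1) / real N"
    have e: "x / real N = (2 * x) / real (N * 2)" for x by simp
    show "2 * real (q i) \<le> real (p i)" "real (p i) + 1 \<le> 2 * (real (q i) + 1)"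
      using a b N unfolding e[of "real (q i)"] e[of "real (q i) + 1"] divide_le_cancel by simp_all
  qed
  then have "real (2 * q i) \<le> real (p i)" "real (p i) \<le> real (2 * q i + 1)" by simp_all
  then have "2 * q i \<le> p i" "p i \<le> 2 * q i + 1" by (simp_all only: of_nat_le_iff)
  then show ?thesis by linarith
qed

section \<open>Oscillation inside a cube\<close>

text \<open>From \<open>q\<close> to \<open>p\<close> one can walk inside the block of the \<open>2\<^sup>d\<close> subcubes of the cube \<open>z\<close>, changing one coordinate at a time;
  each step is at most one jump.\<close>

lemma abs_diff_le_jumps:
  fixes p q z :: "'n::finite \<Rightarrow> nat"
  assumes p: "\<And>i. p i div 2 = z i" and q: "\<And>i. q i div 2 = z i"
  shows "\<bar>c p - c q\<bar> \<le> (\<Sum>i\<in>UNIV. \<Sum>k\<in>{k. \<forall>i. k i div 2 = z i}. \<bar>jump i c k\<bar>)"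
proof -
  let ?B = "{k. \<forall>i. k i div 2 = z i}"
  have "?B \<subseteq> PiE UNIV (\<lambda>i. {.. 2 * z i + 1})"
  proof
    fix k assume "k \<in> ?B"
    then have "z i = k i div 2" for i by simp
    then have "k i \<le> 2 * z i + 1" for i by simp
    then show "k \<in> PiE UNIV (\<lambda>i. {.. 2 * z i + 1})" by (simp add: PiE_def extensional_def)
  qed
  then have fin: "finite ?B" by (rule finite_subset) (intro finite_PiE, auto)
  \<comment> \<open>\<open>S\<close> is the set of coordinates that are already changed\<close>
  have "\<bar>c (override_on q p S) - c q\<bar> \<le> (\<Sum>i\<in>S. \<Sum>k\<in>?B. \<bar>jump i c k\<bar>)" for S
  proof (induction S rule: finite_induct[OF finite])
    case 1
    then show ?case by simp
  next
    case (2 i S)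
    define w where "w = override_on q p S"
    have wi: "w i = q i" using 2(2) by (simp add: w_def)
    have wB: "w \<in> ?B" "w(i := p i) \<in> ?B" using p q by (auto simp: w_def override_on_def)
    have wi': "override_on q p (insert i S) = w(i := p i)" by (auto simp: w_def override_on_def)
    have one: "\<bar>jump i c k\<bar> \<le> (\<Sum>k\<in>?B. \<bar>jump i c k\<bar>)" if "k \<in> ?B" for k
      by (rule member_le_sum[OF that]) (auto simp: fin)
    have "p i div 2 = q i div 2" using p q by simp
    then consider "p i = q i" | "p i = q i + 1" | "q i = p i + 1" by linarith
    then have "\<bar>c (w(i := p i)) - c w\<bar> \<le> (\<Sum>k\<in>?B. \<bar>jump i c k\<bar>)"
    proof cases
      case 1
      then have "w(i := p i) = w" using wi by (simp add: fun_upd_idem)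
      then show ?thesis by (simp add: sum_nonneg)
    next
      case 2
      then show ?thesis using one[OF wB(1)] wi by (simp add: jump_def)
    next
      case 3
      then have "(w(i := p i))(i := p i + 1) = w" using wi by (auto simp: fun_eq_iff)
      then show ?thesis using one[OF wB(2)] by (simp add: jump_def abs_minus_commute)
    qed
    moreover have "\<bar>c w - c q\<bar> \<le> (\<Sum>i\<in>S. \<Sum>k\<in>?B. \<bar>jump i c k\<bar>)" unfolding w_def by (rule 2(3))
    ultimately show ?case unfolding wi' sum.insert[OF 2(1,2)] by linarith
  qed
  from this[of UNIV] show ?thesis by (simp add: override_on_def)
qed

section \<open>Inner products and averages\<close>

definition inner_prod :: "(real^'n::finite \<Rightarrow> real) \<Rightarrow> (real^'n \<Rightarrow> real) \<Rightarrow> real" where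
  "inner_prod u h = (\<integral>x. h x * u x \<partial>lborel)"

lemma cell_int_cong_AE: "(AE x in lborel. u x = v x) \<Longrightarrow> u \<in> borel_measurable borel \<Longrightarrow> v \<in> borel_measurable borel \<Longrightarrow> cell_int N u k = cell_int N v k"
  unfolding cell_int_def by (intro integral_cong_AE) (auto simp: cell_def)

lemma cell_int_sum:
  assumes "\<And>a. a \<in> A \<Longrightarrow> integrable lborel (f a)"
  shows "cell_int N (\<lambda>x. \<Sum>a\<in>A. c a * f a x) k = (\<Sum>a\<in>A. c a * cell_int N (f a) k)"
proof -
  have i: "integrable lborel (\<lambda>x. c a * (f a x * indicator (cell N k) x))" if "a \<in> A" for a
    using integrable_real_mult_indicator[OF _ assms[OF that], of "cell N k"] by (simp add: cell_def)
  have "cell_int N (\<lambda>x. \<Sum>a\<in>A. c a * f a x) k = (\<integral>x. (\<Sum>a\<in>A. c a * (f a x * indicator (cell N k) x)) \<partial>lborel)"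
    unfolding cell_int_def by (simp only: sum_distrib_right mult.assoc)
  also have "\<dots> = (\<Sum>a\<in>A. c a * cell_int N (f a) k)"
    using i by (subst Bochner_Integration.integral_sum) (auto simp: cell_int_def)
  finally show ?thesis .
qed

lemma cell_int_average:
  fixes u :: "real^'n::finite \<Rightarrow> real"
  assumes N: "N > 0" and k: "k \<in> grid N"
  shows "cell_int N (average N u) k = cell_int N u k"
proof -
  have cc: "cell_int N (indicator (cell N q)) k = (if k = q then (1 / real N) ^ CARD('n) else 0)" for q
    using cell_int_cell[of N 1 q k] N by (simp add: fun_eq_iff)
  have "cell_int N (average N u) k = (\<Sum>q\<in>grid N. (real N ^ CARD('n) * cell_int N u q) * cell_int N (indicator (cell N q)) k)"
    unfolding average_def step_def[abs_def] by (rule cell_int_sum) (rule integrable_cell)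
  also have "\<dots> = (\<Sum>q\<in>grid N. if k = q then (real N ^ CARD('n) * cell_int N u q) * (1 / real N) ^ CARD('n) else 0)"
    by (intro sum.cong refl) (simp add: cc)
  also have "\<dots> = cell_int N u k"
    using k N by (simp add: power_one_over)
  finally show ?thesis .
qed

text \<open>The normalising factor of the Haar functions of level \<open>n\<close> in dimension \<open>d\<close>.\<close>

definition hscale :: "nat \<Rightarrow> nat \<Rightarrow> real" where "hscale d n = 2 powr (real (n * d) / 2)"

lemma hscale_square: "hscale d n * hscale d n = 2 ^ (n * d)"
  by (simp add: hscale_def powr_add[symmetric] powr_realpow[symmetric] mult.commute)

lemma hscale_pos: "hscale d n > 0" by (simp add: hscale_def)

text \<open>The Haar functions of level \<open>n\<close> are step functions on this grid.\<close>

definition finer :: "nat \<Rightarrow> nat" where "finer n = 2 ^ Suc n"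

lemma finer_pos [simp]: "finer n > 0" by (simp add: finer_def)

lemma hscale_finer: "hscale d n * hscale d n * 2 ^ d = real (finer n) ^ d"
proof -
  have "real (finer n) ^ d = 2 ^ d * (2 ^ n) ^ d" by (simp add: finer_def power_mult_distrib)
  then show ?thesis by (simp add: hscale_square power_mult)
qed

section \<open>The Haar system of an enumeration\<close>

context
  fixes K :: "nat \<Rightarrow> nat \<Rightarrow> (real^'n::finite) set"
  assumes enum: "dyadic_enumeration K"
begin

text \<open>The grid index of the \<open>k\<close>-th cube of level \<open>n\<close>. From here on the enumeration enters only through the fact that
  \<open>pos n\<close> is a bijection onto the grid that respects subdivision (\<open>pos_child\<close>).\<close>

definition pos :: "nat \<Rightarrow> nat \<Rightarrow> 'n \<Rightarrow> nat" where
  "pos n = inv_into (grid (2 ^ n)) (cell (2 ^ n)) \<circ> K n"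

lemma dyadic_cubes_eq: "dyadic_cubes n = cell (2 ^ n) ` (grid (2 ^ n) :: ('n \<Rightarrow> nat) set)"
proof -
  have "(\<forall>i. k i \<le> 2 ^ n - 1) \<longleftrightarrow> k \<in> grid (2 ^ n)" for k :: "'n \<Rightarrow> nat"
  proof -
    have "k i \<le> 2 ^ n - 1 \<longleftrightarrow> k i < 2 ^ n" for i
      by (metis Suc_pred' less_Suc_eq_le zero_less_numeral zero_less_power)
    then show ?thesis by (simp add: grid_def)
  qed
  then show ?thesis unfolding dyadic_cubes_def by (auto simp: cell_def)
qed

lemma bij_cell: "bij_betw (cell (2 ^ n)) (grid (2 ^ n) :: ('n \<Rightarrow> nat) set) (dyadic_cubes n)"
  unfolding dyadic_cubes_eq by (intro inj_on_imp_bij_betw inj_onI) (rule cell_inj[of "2 ^ n"], simp_all)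

lemma bij_K: "bij_betw (K n) {..<2 ^ (n * CARD('n))} (dyadic_cubes n)"
  using enum by (simp add: dyadic_enumeration_def)

lemma bij_pos: "bij_betw (pos n) {..<2 ^ (n * CARD('n))} (grid (2 ^ n))"
  unfolding pos_def by (rule bij_betw_trans[OF bij_K bij_betw_inv_into[OF bij_cell]])

lemma pos_grid: "k < 2 ^ (n * CARD('n)) \<Longrightarrow> pos n k \<in> grid (2 ^ n)"
  using bij_pos[of n] by (auto simp: bij_betw_def)

lemma K_eq: "k < 2 ^ (n * CARD('n)) \<Longrightarrow> K n k = cell (2 ^ n) (pos n k)"
proof -
  assume "k < 2 ^ (n * CARD('n))"
  then have "K n k \<in> cell (2 ^ n) ` grid (2 ^ n)"
    using bij_K[of n] unfolding dyadic_cubes_eq by (auto simp: bij_betw_def)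
  then show ?thesis unfolding pos_def o_apply by (rule f_inv_into_f[symmetric])
qed

lemma child_lt:
  fixes k l :: nat
  assumes "k < 2 ^ (n * CARD('n))" "l < 2 ^ CARD('n)"
  shows "2 ^ CARD('n) * k + l < 2 ^ (Suc n * CARD('n))"
proof -
  have "2 ^ CARD('n) * k + l < 2 ^ CARD('n) * (k + 1)" using assms(2) by simp
  also have "\<dots> \<le> 2 ^ CARD('n) * 2 ^ (n * CARD('n))" using assms(1) by (intro mult_left_mono) auto
  finally show ?thesis by (simp add: power_add)
qed

lemma pos_child:
  assumes k: "k < 2 ^ (n * CARD('n))" and l: "l < 2 ^ CARD('n)"
  shows "pos (Suc n) (2 ^ CARD('n) * k + l) i div 2 = pos n k i"
proof -
  have "K (Suc n) (2 ^ CARD('n) * k + l) \<in> (\<lambda>l. K (Suc n) (2 ^ CARD('n) * k + l)) ` {..<2 ^ CARD('n)}" using l by blast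
  also have "\<dots> = {Q \<in> dyadic_cubes (Suc n). Q \<subseteq> K n k}"
    using enum k by (simp add: dyadic_enumeration_def)
  finally have "K (Suc n) (2 ^ CARD('n) * k + l) \<subseteq> K n k" by blast
  then have "cell (2 ^ n * 2) (pos (Suc n) (2 ^ CARD('n) * k + l)) \<subseteq> cell (2 ^ n) (pos n k)"
    using K_eq[OF k] K_eq[OF child_lt[OF k l]] by (simp add: mult.commute)
  then show ?thesis by (intro cell_subset_half) auto
qed

definition child :: "nat \<Rightarrow> nat \<Rightarrow> nat \<Rightarrow> 'n \<Rightarrow> nat" where
  "child n k l = pos (Suc n) (2 ^ CARD('n) * k + l)"

lemma child_grid: "k < 2 ^ (n * CARD('n)) \<Longrightarrow> l < 2 ^ CARD('n) \<Longrightarrow> child n k l \<in> grid (finer n)"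
  unfolding child_def finer_def by (intro pos_grid child_lt)

lemma child_inj:
  assumes "k < 2 ^ (n * CARD('n))" "l < 2 ^ CARD('n)" "k' < 2 ^ (n * CARD('n))" "l' < 2 ^ CARD('n)" "child n k l = child n k' l'"
  shows "k = k' \<and> l = l'"
proof -
  have "2 ^ CARD('n) * k + l = 2 ^ CARD('n) * k' + l'"
    by (rule inj_onD[OF bij_betw_imp_inj_on[OF bij_pos[of "Suc n"]] assms(5)[unfolded child_def]])
      (simp_all only: lessThan_iff child_lt[OF assms(1,2)] child_lt[OF assms(3,4)])
  then have "(2 ^ CARD('n) * k + l) div 2 ^ CARD('n) = (2 ^ CARD('n) * k' + l') div 2 ^ CARD('n)" "(2 ^ CARD('n) * k + l) mod 2 ^ CARD('n) = (2 ^ CARD('n) * k' + l') mod 2 ^ CARD('n)"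
    by simp_all
  then show ?thesis using assms(2,4) by simp
qed

lemma haar_eq:
  assumes "k < 2 ^ (n * CARD('n))"
  shows "haar K (n, k, r) x = (\<Sum>l<2 ^ CARD('n). (hscale CARD('n) n * haar_matrix CARD('n) r l) * indicator (cell (finer n) (child n k l)) x)"
proof -
  have "haar K (n, k, r) x = hscale CARD('n) n * (\<Sum>l<2 ^ CARD('n). haar_matrix CARD('n) r l * indicator (K (Suc n) (2 ^ CARD('n) * k + l)) x)"
    by (simp add: haar_def hscale_def)
  also have "\<dots> = (\<Sum>l<2 ^ CARD('n). (hscale CARD('n) n * haar_matrix CARD('n) r l) * indicator (cell (finer n) (child n k l)) x)"
    unfolding sum_distrib_left child_def finer_def
    by (intro sum.cong refl) (simp only: lessThan_iff K_eq[OF child_lt[OF assms]] mult.assoc)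
  finally show ?thesis .
qed

lemma haar_fun_eq:
  assumes "k < 2 ^ (n * CARD('n))"
  shows "haar K (n, k, r) = (\<lambda>x. \<Sum>l<2 ^ CARD('n). (hscale CARD('n) n * haar_matrix CARD('n) r l) * indicator (cell (finer n) (child n k l)) x)"
  by (rule ext) (rule haar_eq[OF assms])

lemma BV_sum_cells:
  fixes q :: "'b \<Rightarrow> 'n \<Rightarrow> nat"
  assumes "finite A" "N > 0" "\<And>a. a \<in> A \<Longrightarrow> q a \<in> grid N"
  shows "(\<lambda>x. \<Sum>a\<in>A. c a * indicator (cell N (q a)) x) \<in> BV_cube \<and>
    BV_norm (\<lambda>x. \<Sum>a\<in>A. c a * indicator (cell N (q a)) x) \<le> (\<Sum>a\<in>A. \<bar>c a\<bar>) * ((1 + 2 * CARD('n)) * (1 / real N) ^ (CARD('n) - 1))"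
  using assms(1,3)
proof (induction A)
  case empty
  show ?case by (simp add: zero_BV)
next
  case (insert a A)
  have IH: "(\<lambda>x. \<Sum>a\<in>A. c a * indicator (cell N (q a)) x) \<in> BV_cube"
    "BV_norm (\<lambda>x. \<Sum>a\<in>A. c a * indicator (cell N (q a)) x) \<le> (\<Sum>a\<in>A. \<bar>c a\<bar>) * ((1 + 2 * CARD('n)) * (1 / real N) ^ (CARD('n) - 1))"
    using insert by auto
  have qa: "indicator (cell N (q a)) \<in> BV_cube" by (intro cell_in_BV_cube assms(2) insert.prems) simp
  note sc = BV_cube_scale[OF qa, of "c a"]
  have "BV_norm (\<lambda>x. c a * indicator (cell N (q a)) x) \<le> \<bar>c a\<bar> * ((1 + 2 * CARD('n)) * (1 / real N) ^ (CARD('n) - 1))"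
    using BV_norm_cell[OF assms(2), of "q a"] by (intro order_trans[OF sc(2)] mult_left_mono) auto
  then show ?case
    unfolding sum.insert[OF insert.hyps] using BV_cube_add[OF sc(1) IH(1)] IH(2) by (auto simp: distrib_right)
qed

lemma haar_BV:
  assumes "k < 2 ^ (n * CARD('n))"
  shows "haar K (n, k, r) \<in> BV_cube"
    and "BV_norm (haar K (n, k, r)) \<le> hscale CARD('n) n * 2 ^ CARD('n) * ((1 + 2 * CARD('n)) * (1 / real (finer n)) ^ (CARD('n) - 1))"
proof -
  have "haar K (n, k, r) \<in> BV_cube \<and> BV_norm (haar K (n, k, r)) \<le> (\<Sum>l<2 ^ CARD('n). \<bar>hscale CARD('n) n * haar_matrix CARD('n) r l\<bar>) * ((1 + 2 * CARD('n)) * (1 / real (finer n)) ^ (CARD('n) - 1))"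
    unfolding haar_fun_eq[OF assms] using assms by (intro BV_sum_cells) (auto intro: child_grid)
  moreover have "(\<Sum>l<2 ^ CARD('n). \<bar>hscale CARD('n) n * haar_matrix CARD('n) r l\<bar>) = hscale CARD('n) n * 2 ^ CARD('n)"
    using hscale_pos[of "CARD('n)" n] by (simp add: abs_mult abs_haar_matrix)
  ultimately show "haar K (n, k, r) \<in> BV_cube"
    "BV_norm (haar K (n, k, r)) \<le> hscale CARD('n) n * 2 ^ CARD('n) * ((1 + 2 * CARD('n)) * (1 / real (finer n)) ^ (CARD('n) - 1))"
    by simp_all
qed

lemma ip_haar:
  assumes k: "k < 2 ^ (n * CARD('n))" and u: "integrable lborel u"
  shows "inner_prod u (haar K (n, k, r)) = hscale CARD('n) n * (\<Sum>l<2 ^ CARD('n). haar_matrix CARD('n) r l * cell_int (finer n) u (child n k l))"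
proof -
  have i: "integrable lborel (\<lambda>x. a * (u x * indicator (cell N q) x))" for a N q
    using integrable_real_mult_indicator[OF _ u, of "cell N q"] by (simp add: cell_def)
  have "inner_prod u (haar K (n, k, r)) = (\<integral>x. (\<Sum>l<2 ^ CARD('n). (hscale CARD('n) n * haar_matrix CARD('n) r l) * (u x * indicator (cell (finer n) (child n k l)) x)) \<partial>lborel)"
    unfolding inner_prod_def haar_fun_eq[OF k] sum_distrib_right by (simp only: mult_ac)
  also have "\<dots> = (\<Sum>l<2 ^ CARD('n). (hscale CARD('n) n * haar_matrix CARD('n) r l) * cell_int (finer n) u (child n k l))"
    by (subst Bochner_Integration.integral_sum[OF i]) (simp add: cell_int_def)
  finally show ?thesis by (simp add: sum_distrib_left mult.assoc)
qed

text \<open>The rows of the sign matrix, \<open>r = 0\<close> included, form an orthogonal basis of the functions on the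
  subcubes of a cube, so they reproduce the averages over these subcubes.\<close>

lemma sum_over_r:
  assumes k: "k < 2 ^ (n * CARD('n))" and u: "integrable lborel u"
  shows "(\<Sum>r<2 ^ CARD('n). inner_prod u (haar K (n, k, r)) * haar K (n, k, r) x) =
    (\<Sum>l<2 ^ CARD('n). (real (finer n) ^ CARD('n) * cell_int (finer n) u (child n k l)) * indicator (cell (finer n) (child n k l)) x)"
proof -
  let ?A = "haar_matrix CARD('n)" and ?v = "\<lambda>l. cell_int (finer n) u (child n k l)" and ?I = "\<lambda>l. indicator (cell (finer n) (child n k l)) x :: real"
  have "(\<Sum>r<2 ^ CARD('n). inner_prod u (haar K (n, k, r)) * haar K (n, k, r) x) =
    (\<Sum>r<2 ^ CARD('n). \<Sum>l<2 ^ CARD('n). \<Sum>l'<2 ^ CARD('n). (hscale CARD('n) n * hscale CARD('n) n) * ((?A r l * ?A r l') * (?v l * ?I l')))"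
  proof (rule sum.cong[OF refl])
    fix r
    have "inner_prod u (haar K (n, k, r)) * haar K (n, k, r) x =
      (\<Sum>l<2 ^ CARD('n). hscale CARD('n) n * (?A r l * ?v l)) * (\<Sum>l'<2 ^ CARD('n). (hscale CARD('n) n * ?A r l') * ?I l')"
      unfolding ip_haar[OF k u] haar_eq[OF k] by (simp only: sum_distrib_left)
    also have "\<dots> = (\<Sum>l<2 ^ CARD('n). \<Sum>l'<2 ^ CARD('n). (hscale CARD('n) n * hscale CARD('n) n) * ((?A r l * ?A r l') * (?v l * ?I l')))"
      unfolding sum_product by (intro sum.cong refl) (simp only: mult_ac)
    finally show "inner_prod u (haar K (n, k, r)) * haar K (n, k, r) x =
      (\<Sum>l<2 ^ CARD('n). \<Sum>l'<2 ^ CARD('n). (hscale CARD('n) n * hscale CARD('n) n) * ((?A r l * ?A r l') * (?v l * ?I l')))" .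
  qed
  also have "\<dots> = (\<Sum>l<2 ^ CARD('n). \<Sum>l'<2 ^ CARD('n). \<Sum>r<2 ^ CARD('n). (hscale CARD('n) n * hscale CARD('n) n) * ((?A r l * ?A r l') * (?v l * ?I l')))"
  proof -
    have "(\<Sum>r<2 ^ CARD('n). \<Sum>l<2 ^ CARD('n). \<Sum>l'<2 ^ CARD('n). (hscale CARD('n) n * hscale CARD('n) n) * ((?A r l * ?A r l') * (?v l * ?I l')))
      = (\<Sum>l<2 ^ CARD('n). \<Sum>r<2 ^ CARD('n). \<Sum>l'<2 ^ CARD('n). (hscale CARD('n) n * hscale CARD('n) n) * ((?A r l * ?A r l') * (?v l * ?I l')))"
      by (rule sum.swap)
    also have "\<dots> = (\<Sum>l<2 ^ CARD('n). \<Sum>l'<2 ^ CARD('n). \<Sum>r<2 ^ CARD('n). (hscale CARD('n) n * hscale CARD('n) n) * ((?A r l * ?A r l') * (?v l * ?I l')))"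
      by (rule sum.cong[OF refl], rule sum.swap)
    finally show ?thesis .
  qed
  also have "\<dots> = (\<Sum>l<2 ^ CARD('n). \<Sum>l'<2 ^ CARD('n). if l' = l then (real (finer n) ^ CARD('n) * ?v l) * ?I l else 0)"
  proof (intro sum.cong refl)
    fix l l' assume l: "l \<in> {..<(2::nat) ^ CARD('n)}" "l' \<in> {..<(2::nat) ^ CARD('n)}"
    have "(\<Sum>r<2 ^ CARD('n). (hscale CARD('n) n * hscale CARD('n) n) * ((?A r l * ?A r l') * (?v l * ?I l'))) =
      (hscale CARD('n) n * hscale CARD('n) n) * ((\<Sum>r<2 ^ CARD('n). ?A r l * ?A r l') * (?v l * ?I l'))"
      by (simp only: sum_distrib_left sum_distrib_right)
    also have "\<dots> = (if l' = l then (real (finer n) ^ CARD('n) * ?v l) * ?I l else 0)"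
      using l by (cases "l' = l") (simp_all add: haar_matrix_orthogonal_columns hscale_finer[symmetric])
    finally show "(\<Sum>r<2 ^ CARD('n). (hscale CARD('n) n * hscale CARD('n) n) * ((?A r l * ?A r l') * (?v l * ?I l'))) = (if l' = l then (real (finer n) ^ CARD('n) * ?v l) * ?I l else 0)" .
  qed
  also have "\<dots> = (\<Sum>l<2 ^ CARD('n). (real (finer n) ^ CARD('n) * ?v l) * ?I l)"
    by (intro sum.cong refl) (simp add: sum.delta)
  finally show ?thesis .
qed

lemma average_level:
  "average (2 ^ n) u x = (\<Sum>k<2 ^ (n * CARD('n)). (real (2 ^ n) ^ CARD('n) * cell_int (2 ^ n) u (pos n k)) * indicator (cell (2 ^ n) (pos n k)) x)"
  unfolding average_def step_def by (rule sum.reindex_bij_betw[OF bij_pos, symmetric])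

lemma average_finer:
  assumes u: "integrable lborel u"
  shows "average (2 ^ Suc n) u x = (\<Sum>k<2 ^ (n * CARD('n)). \<Sum>r<2 ^ CARD('n). inner_prod u (haar K (n, k, r)) * haar K (n, k, r) x)"
proof -
  have e: "(2::nat) ^ (Suc n * CARD('n)) = 2 ^ (n * CARD('n)) * 2 ^ CARD('n)" by (simp add: power_add)
  have "average (2 ^ Suc n) u x = (\<Sum>k<2 ^ (n * CARD('n)). \<Sum>l<2 ^ CARD('n). (real (finer n) ^ CARD('n) * cell_int (finer n) u (child n k l)) * indicator (cell (finer n) (child n k l)) x)"
    unfolding average_level e sum_blocks finer_def child_def by (simp only: mult.commute[of _ "2 ^ CARD('n)"])
  also have "\<dots> = (\<Sum>k<2 ^ (n * CARD('n)). \<Sum>r<2 ^ CARD('n). inner_prod u (haar K (n, k, r)) * haar K (n, k, r) x)"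
    by (intro sum.cong refl sum_over_r[symmetric] u) simp
  finally show ?thesis .
qed

lemma AE_cell_indicator:
  assumes N: "N > 0"
  shows "AE x in lborel. x \<in> unit_cube \<longrightarrow> (\<exists>p\<in>grid N. x \<in> cell N p \<and> (\<forall>a\<in>grid N. indicator (cell N a) x = (if a = p then 1 else 0 :: real)))"
  using AE_cell[OF N]
proof eventually_elim
  case (elim x)
  show ?case
  proof
    assume "x \<in> unit_cube"
    with elim obtain p where p: "p \<in> grid N" "x \<in> cell N p" "\<And>c. step N c x = c p" by blast
    have "indicator (cell N a) x = (if a = p then 1 else 0 :: real)" if a: "a \<in> grid N" for a
    proof -
      have "(if a = p then 1 else 0 :: real) = step N (\<lambda>k. if a = k then 1 else 0) x" by (simp only: p(3))
      also have "\<dots> = (\<Sum>k\<in>grid N. if a = k then indicator (cell N k) x else 0)"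
        unfolding step_def by (intro sum.cong refl) auto
      also have "\<dots> = indicator (cell N a) x" using a by (simp only: sum.delta'[OF finite_grid] if_True)
      finally show ?thesis by (rule sym)
    qed
    with p show "\<exists>p\<in>grid N. x \<in> cell N p \<and> (\<forall>a\<in>grid N. indicator (cell N a) x = (if a = p then 1 else 0 :: real))" by blast
  qed
qed

lemma child_cell_subset:
  assumes "k < 2 ^ (n * CARD('n))" "l < 2 ^ CARD('n)"
  shows "cell (finer n) (child n k l) \<subseteq> cell (2 ^ n) (pos n k)"
proof -
  have "cell (2 ^ n * 2) (child n k l) \<subseteq> cell (2 ^ n) (pos n k)"
    by (rule cell_subset_coarse) (use pos_child[OF assms] in \<open>auto simp: child_def\<close>)
  then show ?thesis by (simp add: finer_def mult.commute)
qed

lemma child_surj: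
  assumes "p \<in> grid (finer n)"
  obtains k l where "k < 2 ^ (n * CARD('n))" "l < 2 ^ CARD('n)" "p = child n k l"
proof -
  have "p \<in> pos (Suc n) ` {..<2 ^ (Suc n * CARD('n))}"
    using assms bij_pos[of "Suc n"] by (simp add: finer_def bij_betw_def)
  then obtain t where t: "t < 2 ^ (Suc n * CARD('n))" "p = pos (Suc n) t" by blast
  show ?thesis
  proof
    show "t div 2 ^ CARD('n) < 2 ^ (n * CARD('n))" using t(1) by (intro less_mult_imp_div_less) (simp add: power_add mult.commute)
    show "t mod 2 ^ CARD('n) < 2 ^ CARD('n)" by simp
    show "p = child n (t div 2 ^ CARD('n)) (t mod 2 ^ CARD('n))" by (simp only: child_def t(2) mult_div_mod_eq)
  qed
qed

text \<open>Almost every point of the unit cube lies in exactly one cube of each of the two grids, and these two are nested.\<close>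

lemma children_fill:
  "AE x in lborel. \<forall>k<2 ^ (n * CARD('n)). (\<Sum>l<2 ^ CARD('n). indicator (cell (finer n) (child n k l)) x) = (indicator (cell (2 ^ n) (pos n k)) x :: real)"
  using AE_cell_indicator[OF finer_pos[of n]] AE_cell_indicator[of "2 ^ n", simplified]
proof eventually_elim
  case (elim x)
  show ?case
  proof (intro allI impI)
    fix k :: nat assume k: "k < 2 ^ (n * CARD('n))"
    show "(\<Sum>l<2 ^ CARD('n). indicator (cell (finer n) (child n k l)) x) = (indicator (cell (2 ^ n) (pos n k)) x :: real)"
    proof (cases "x \<in> unit_cube")
      case False
      have "x \<notin> cell (2 ^ n) (pos n k)" using cell_subset_cube[OF _ pos_grid[OF k]] False by auto
      moreover from this have "x \<notin> cell (finer n) (child n k l)" if "l < 2 ^ CARD('n)" for l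
        using child_cell_subset[OF k that] by blast
      ultimately show ?thesis by simp
    next
      case True
      obtain p where p: "p \<in> grid (finer n)" "x \<in> cell (finer n) p"
        "\<And>a. a \<in> grid (finer n) \<Longrightarrow> indicator (cell (finer n) a) x = (if a = p then 1 else 0 :: real)"
        using elim(1) True by blast
      obtain q where q: "q \<in> grid (2 ^ n)" "\<And>a. a \<in> grid (2 ^ n) \<Longrightarrow> indicator (cell (2 ^ n) a) x = (if a = q then 1 else 0 :: real)"
        using elim(2) True by blast
      obtain k' l' where kl: "k' < 2 ^ (n * CARD('n))" "l' < 2 ^ CARD('n)" "p = child n k' l'" using child_surj[OF p(1)] .
      have "x \<in> cell (2 ^ n) (pos n k')" using child_cell_subset[OF kl(1,2)] p(2) kl(3) by blast
      then have qk: "q = pos n k'" using q(2)[OF pos_grid[OF kl(1)]] by (simp split: if_splits)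
      have "(\<Sum>l<2 ^ CARD('n). indicator (cell (finer n) (child n k l)) x) = (\<Sum>l<2 ^ CARD('n). if l = l' then (if k = k' then 1 else 0) else (0::real))"
      proof (intro sum.cong refl)
        fix l assume "l \<in> {..<(2::nat) ^ CARD('n)}"
        then have l: "l < 2 ^ CARD('n)" by simp
        have "child n k l = child n k' l' \<longleftrightarrow> k = k' \<and> l = l'" using child_inj[OF k l kl(1,2)] by blast
        then show "indicator (cell (finer n) (child n k l)) x = (if l = l' then (if k = k' then 1 else 0) else (0::real))"
          using p(3)[OF child_grid[OF k l]] kl(3) by auto
      qed
      also have "\<dots> = (if k = k' then 1 else 0)" using kl(2) by (simp add: sum.delta)
      also have "\<dots> = indicator (cell (2 ^ n) (pos n k)) x"
      proof -
        have "pos n k = pos n k' \<longleftrightarrow> k = k'"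
          using bij_betw_imp_inj_on[OF bij_pos[of n]] k kl(1) unfolding inj_on_def by auto
        then show ?thesis using q(2)[OF pos_grid[OF k]] qk by simp
      qed
      finally show ?thesis .
    qed
  qed
qed

text \<open>Row \<open>0\<close> of the sign matrix is constant. It completes the Haar functions of a cube to an orthogonal basis, by a
  multiple of the indicator of the whole cube.\<close>

lemma haar_0_AE: "AE x in lborel. \<forall>k<2 ^ (n * CARD('n)). haar K (n, k, 0) x = hscale CARD('n) n * indicator (cell (2 ^ n) (pos n k)) x"
  using children_fill[of n]
proof eventually_elim
  case (elim x)
  show ?case
  proof (intro allI impI)
    fix k :: nat assume k: "k < 2 ^ (n * CARD('n))"
    have "haar K (n, k, 0) x = hscale CARD('n) n * (\<Sum>l<2 ^ CARD('n). indicator (cell (finer n) (child n k l)) x)"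
      unfolding haar_eq[OF k] by (simp only: haar_matrix_0 sum_distrib_left mult_1_right)
    then show "haar K (n, k, 0) x = hscale CARD('n) n * indicator (cell (2 ^ n) (pos n k)) x" using elim k by simp
  qed
qed

lemma haar_measurable: "k < 2 ^ (n * CARD('n)) \<Longrightarrow> haar K (n, k, r) \<in> borel_measurable borel"
  using borel_measurable_integrable[OF BV_cube_integrable[OF haar_BV(1)]] by simp

lemma ip_haar_0:
  assumes k: "k < 2 ^ (n * CARD('n))" and u: "integrable lborel u"
  shows "inner_prod u (haar K (n, k, 0)) = hscale CARD('n) n * cell_int (2 ^ n) u (pos n k)"
proof -
  have "inner_prod u (haar K (n, k, 0)) = (\<integral>x. hscale CARD('n) n * (u x * indicator (cell (2 ^ n) (pos n k)) x) \<partial>lborel)"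
    unfolding inner_prod_def
  proof (rule integral_cong_AE)
    show "AE x in lborel. haar K (n, k, 0) x * u x = hscale CARD('n) n * (u x * indicator (cell (2 ^ n) (pos n k)) x)"
      using haar_0_AE[of n] by eventually_elim (use k in simp)
  qed (use u haar_measurable[OF k] in \<open>auto simp: cell_def\<close>)
  then show ?thesis by (simp add: cell_int_def)
qed

text \<open>In \<open>average_finer\<close> the terms with \<open>r = 0\<close> give the average over the coarser cubes, and the other ones are the
  Haar functions of level \<open>n\<close>.\<close>

lemma average_refine:
  assumes u: "integrable lborel u" and D: "2 ^ CARD('n) = Suc D"
  shows "AE x in lborel. average (2 ^ Suc n) u x = average (2 ^ n) u x +
    (\<Sum>k<2 ^ (n * CARD('n)). \<Sum>r<D. inner_prod u (haar K (n, k, Suc r)) * haar K (n, k, Suc r) x)"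
  using haar_0_AE[of n]
proof eventually_elim
  case (elim x)
  have "inner_prod u (haar K (n, k, 0)) * haar K (n, k, 0) x = (real (2 ^ n) ^ CARD('n) * cell_int (2 ^ n) u (pos n k)) * indicator (cell (2 ^ n) (pos n k)) x"
    if k: "k < 2 ^ (n * CARD('n))" for k
  proof -
    have "inner_prod u (haar K (n, k, 0)) * haar K (n, k, 0) x = (hscale CARD('n) n * hscale CARD('n) n) * (cell_int (2 ^ n) u (pos n k) * indicator (cell (2 ^ n) (pos n k)) x)"
      using elim k by (simp only: ip_haar_0[OF k u] mult_ac)
    then show ?thesis by (simp add: hscale_square power_mult mult.assoc)
  qed
  then have eq: "(\<Sum>k<2 ^ (n * CARD('n)). inner_prod u (haar K (n, k, 0)) * haar K (n, k, 0) x) = average (2 ^ n) u x"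
    unfolding average_level by (intro sum.cong refl) (simp only: lessThan_iff)
  show ?case
    unfolding average_finer[OF u] D sum.lessThan_Suc_shift sum.distrib eq ..
qed

end

section \<open>Partial sums of the Haar expansion\<close>

lemma sum_lessThan_add: "(\<Sum>j<a + b. f j) = (\<Sum>j<a. f j) + (\<Sum>i<b. f (a + i))" for f :: "nat \<Rightarrow> 'a::comm_monoid_add"
  by (induction b) (auto simp: add.assoc)

lemma BV_norm_cong_AE:
  assumes u: "u \<in> BV_cube" and eq: "AE x in lborel. u x = v x" and v: "v \<in> borel_measurable borel"
  shows "BV_norm v = BV_norm u"
proof -
  obtain D where D: "integrable lborel u" "is_distr_gradient u D" using BV_cubeE[OF u] .
  have um: "u \<in> borel_measurable borel" using borel_measurable_integrable[OF D(1)] by simp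
  have "is_distr_gradient v D" by (rule is_distr_gradient_cong_AE[OF D(2) eq um v])
  then have "var v = var u" using D(2) by (simp add: var_eq)
  moreover have "(\<integral>x. \<bar>v x\<bar> \<partial>lborel) = (\<integral>x. \<bar>u x\<bar> \<partial>lborel)"
    using eq um v by (intro integral_cong_AE) auto
  ultimately show ?thesis by (simp add: BV_norm_eq)
qed

lemma BV_sum:
  assumes "finite A" "\<And>a. a \<in> A \<Longrightarrow> f a \<in> BV_cube"
  shows "(\<lambda>x. \<Sum>a\<in>A. c a * f a x) \<in> BV_cube \<and> BV_norm (\<lambda>x. \<Sum>a\<in>A. c a * f a x) \<le> (\<Sum>a\<in>A. \<bar>c a\<bar> * BV_norm (f a))"
  using assms
proof (induction A)
  case empty
  show ?case by (simp add: zero_BV)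
next
  case (insert a A)
  then have IH: "(\<lambda>x. \<Sum>a\<in>A. c a * f a x) \<in> BV_cube" "BV_norm (\<lambda>x. \<Sum>a\<in>A. c a * f a x) \<le> (\<Sum>a\<in>A. \<bar>c a\<bar> * BV_norm (f a))" by auto
  have fa: "f a \<in> BV_cube" using insert.prems by simp
  note sc = BV_cube_scale[OF fa, of "c a"]
  show ?case unfolding sum.insert[OF insert.hyps]
    using BV_cube_add[OF sc(1) IH(1)] sc(2) IH(2) by auto
qed

context
  fixes K :: "nat \<Rightarrow> nat \<Rightarrow> (real^'n::finite) set" and D :: nat
  assumes enum: "dyadic_enumeration K" and D: "2 ^ CARD('n) = Suc D"
begin

lemma D_pos: "D > 0"
proof -
  have "(2::nat) ^ 1 \<le> 2 ^ CARD('n)" by (intro power_increasing) (auto simp: Suc_le_eq)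
  then show ?thesis using D by simp
qed

lemmas decode = index_decode[OF D D_pos zero_less_card_finite]
lemmas level = level_step[OF D D_pos zero_less_card_finite]
lemmas seq_eq = haar_seq_eq[OF D, of _ _ _ K]

lemma unit_cube_cell: "unit_cube = cell (2 ^ 0) (\<lambda>_::'n. 0)"
  by (simp add: cell_def zero_vec_def one_vec_def)

lemma zero_grid: "(\<lambda>_::'n. 0) \<in> grid (2 ^ 0)" by (simp add: grid_def)

lemma haar_seq_BV: "haar_seq K j \<in> BV_cube"
proof (cases "j = 0")
  case True
  then show ?thesis using cell_in_BV_cube[OF _ zero_grid] by (simp add: unit_cube_cell)
next
  case False
  then obtain n k r where "k < 2 ^ (n * CARD('n))" "r < D" "j = 2 ^ (n * CARD('n)) + k * D + r" using decode by blast
  then show ?thesis using seq_eq haar_BV(1)[OF enum] by simp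
qed

lemma haar_seq_integrable: "integrable lborel (haar_seq K j)"
  by (rule BV_cube_integrable[OF haar_seq_BV])

definition partial :: "nat \<Rightarrow> (real^'n \<Rightarrow> real) \<Rightarrow> real^'n \<Rightarrow> real" where
  "partial m u x = (\<Sum>j<m. inner_prod u (haar_seq K j) * haar_seq K j x)"

lemma partial_BV: "partial m u \<in> BV_cube"
  using BV_sum[of "{..<m}" "haar_seq K" "\<lambda>j. inner_prod u (haar_seq K j)"] haar_seq_BV by (simp add: partial_def[abs_def])

lemma partial_measurable: "partial m u \<in> borel_measurable borel"
  using borel_measurable_integrable[OF BV_cube_integrable[OF partial_BV]] by simp

lemma level_sum:
  "(\<Sum>i<2 ^ (n * CARD('n)) * D. f (haar_seq K (2 ^ (n * CARD('n)) + i))) = (\<Sum>k<2 ^ (n * CARD('n)). \<Sum>r<D. f (haar K (n, k, Suc r)))"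
  for f :: "(real^'n \<Rightarrow> real) \<Rightarrow> real"
  unfolding sum_blocks by (intro sum.cong refl) (simp add: seq_eq add.assoc[symmetric])

lemma average_measurable: "average N u \<in> borel_measurable borel"
  unfolding average_def by (rule step_measurable)

text \<open>After \<open>2\<^sup>n\<^sup>d\<close> terms all levels below \<open>n\<close> are complete, and the expansion is the average over the cubes of level \<open>n\<close>.\<close>

lemma partial_level:
  assumes u: "integrable lborel u"
  shows "AE x in lborel. partial (2 ^ (n * CARD('n))) u x = average (2 ^ n) u x"
proof (induction n)
  case 0
  have g0: "grid (2 ^ 0) = {\<lambda>_::'n. 0}" by (auto simp: grid_def)
  have "average (2 ^ 0) u x = cell_int (2 ^ 0) u (\<lambda>_. 0) * indicator unit_cube x" for x
    unfolding average_def step_def unit_cube_cell g0 by (subst sum.insert) simp_all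
  moreover have "partial 1 u x = inner_prod u (indicator unit_cube) * indicator unit_cube x" for x
    by (simp add: partial_def)
  moreover have "inner_prod u (indicator unit_cube) = cell_int (2 ^ 0) u (\<lambda>_. 0)"
    unfolding inner_prod_def cell_int_def unit_cube_cell by (simp only: mult.commute)
  ultimately show ?case by simp
next
  case (Suc n)
  show ?case
    using Suc.IH average_refine[OF enum u D, of n]
  proof eventually_elim
    case (elim x)
    have "partial (2 ^ (Suc n * CARD('n))) u x = partial (2 ^ (n * CARD('n))) u x +
      (\<Sum>i<2 ^ (n * CARD('n)) * D. inner_prod u (haar_seq K (2 ^ (n * CARD('n)) + i)) * haar_seq K (2 ^ (n * CARD('n)) + i) x)"
      unfolding level[of n, symmetric] partial_def sum_lessThan_add ..
    also have "(\<Sum>i<2 ^ (n * CARD('n)) * D. inner_prod u (haar_seq K (2 ^ (n * CARD('n)) + i)) * haar_seq K (2 ^ (n * CARD('n)) + i) x) =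
      (\<Sum>k<2 ^ (n * CARD('n)). \<Sum>r<D. inner_prod u (haar K (n, k, Suc r)) * haar K (n, k, Suc r) x)"
      by (rule level_sum[of "\<lambda>h. inner_prod u h * h x" n])
    finally show ?case using elim by simp
  qed
qed

section \<open>Uniform boundedness of the partial sums\<close>

text \<open>A row of the matrix other than the first adds up to \<open>0\<close>, so a Haar function only sees the differences between the
  integrals over the subcubes.\<close>

lemma abs_ip_haar_le:
  assumes u: "integrable lborel u" and k: "k < 2 ^ (n * CARD('n))" and r: "r < D"
  shows "\<bar>inner_prod u (haar K (n, k, Suc r))\<bar> \<le> hscale CARD('n) n * (2 ^ CARD('n) *
    (\<Sum>i\<in>UNIV. \<Sum>p\<in>{p. \<forall>i. p i div 2 = pos K n k i}. \<bar>jump i (cell_int (finer n) u) p\<bar>))"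
proof -
  let ?A = "haar_matrix CARD('n) (Suc r)" and ?v = "\<lambda>l. cell_int (finer n) u (child K n k l)"
  let ?W = "\<Sum>i\<in>UNIV. \<Sum>p\<in>{p. \<forall>i. p i div 2 = pos K n k i}. \<bar>jump i (cell_int (finer n) u) p\<bar>"
  have "(\<Sum>l<2 ^ CARD('n). ?A l) = 0" using r D by (intro haar_matrix_row_sum) auto
  then have "(\<Sum>l<2 ^ CARD('n). ?A l * ?v l) = (\<Sum>l<2 ^ CARD('n). ?A l * (?v l - ?v 0))"
    by (simp only: right_diff_distrib sum_subtractf sum_distrib_right[symmetric] mult_zero_left diff_zero)
  then have "inner_prod u (haar K (n, k, Suc r)) = hscale CARD('n) n * (\<Sum>l<2 ^ CARD('n). ?A l * (?v l - ?v 0))"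
    by (simp only: ip_haar[OF enum k u])
  moreover have "\<bar>\<Sum>l<2 ^ CARD('n). ?A l * (?v l - ?v 0)\<bar> \<le> (\<Sum>l<(2::nat) ^ CARD('n). ?W)"
  proof (rule order_trans[OF sum_abs], rule sum_mono)
    fix l assume "l \<in> {..<(2::nat) ^ CARD('n)}"
    then have l: "l < 2 ^ CARD('n)" by simp
    have "\<bar>?v l - ?v 0\<bar> \<le> ?W"
      unfolding child_def[OF enum] by (rule abs_diff_le_jumps) (simp_all only: pos_child[OF enum k l] pos_child[OF enum k zero_less_power[OF zero_less_numeral]])
    then show "\<bar>?A l * (?v l - ?v 0)\<bar> \<le> ?W" by (simp add: abs_mult abs_haar_matrix)
  qed
  ultimately show ?thesis using hscale_pos[of "CARD('n)" n] by (simp add: abs_mult)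
qed

text \<open>Every index of the finer grid lies in the block of one cube of level \<open>n\<close>, found by halving it.\<close>

lemma sum_parents:
  fixes g :: "('n \<Rightarrow> nat) \<Rightarrow> real"
  shows "(\<Sum>k<2 ^ (n * CARD('n)). \<Sum>p\<in>{p. \<forall>i. p i div 2 = pos K n k i}. g p) = (\<Sum>p\<in>grid (finer n). g p)"
proof -
  have "(\<Sum>k<2 ^ (n * CARD('n)). \<Sum>p\<in>{p. \<forall>i. p i div 2 = pos K n k i}. g p) = (\<Sum>z\<in>grid (2 ^ n). \<Sum>p\<in>{p. \<forall>i. p i div 2 = z i}. g p)"
    by (rule sum.reindex_bij_betw[OF bij_pos[OF enum]])
  also have "\<dots> = (\<Sum>z\<in>grid (2 ^ n). \<Sum>p\<in>{p \<in> grid (finer n). (\<lambda>i. p i div 2) = z}. g p)"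
  proof (intro sum.cong refl)
    fix z :: "'n \<Rightarrow> nat" assume "z \<in> grid (2 ^ n)"
    then have "p i < 2 ^ Suc n" if "p i div 2 = z i" for p i
      using that by (auto simp: grid_def dest!: spec[of _ i])
    then show "{p. \<forall>i. p i div 2 = z i} = {p \<in> grid (finer n). (\<lambda>i. p i div 2) = z}"
      by (auto simp: grid_def finer_def fun_eq_iff)
  qed
  also have "\<dots> = (\<Sum>p\<in>grid (finer n). g p)"
  proof (rule sum.group)
    show "(\<lambda>p i. p i div 2) ` grid (finer n) \<subseteq> grid (2 ^ n)"
      by (auto simp: grid_def finer_def intro!: less_mult_imp_div_less)
        (metis mult.commute)
  qed (rule finite_grid)+
  finally show ?thesis .
qed

text \<open>The coefficients of a level add up to the jumps of the finer grid, hence to the variation of \<open>u\<close> times the side of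
  the cubes. The normalising factor, which enters once with the coefficient and once with the norm, and the norm of the
  indicator of a cube contribute exactly the power of the side that makes the bound independent of \<open>n\<close>.\<close>

lemma level_bound:
  assumes u: "u \<in> BV_cube"
  shows "(\<Sum>k<2 ^ (n * CARD('n)). \<Sum>r<D. \<bar>inner_prod u (haar K (n, k, Suc r))\<bar> * BV_norm (haar K (n, k, Suc r)))
    \<le> (real D * 4 ^ CARD('n) * (1 + 2 * CARD('n)) * CARD('n)) * var u"
proof -
  let ?d = "CARD('n)" and ?s = "hscale CARD('n) n"
  let ?J = "\<lambda>i p. \<bar>jump i (cell_int (finer n) u) p\<bar>"
  define W where "W k = (\<Sum>i\<in>UNIV. \<Sum>p\<in>{p. \<forall>i. p i div 2 = pos K n k i}. ?J i p)" for k
  define \<beta> where "\<beta> = (1 + 2 * real ?d) * (1 / real (finer n)) ^ (?d - 1)"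
  have b0: "0 \<le> \<beta>" by (simp add: \<beta>_def)
  have W0: "0 \<le> W k" for k by (simp add: W_def sum_nonneg)
  have ui: "integrable lborel u" by (rule BV_cube_integrable[OF u])
  have s0: "?s > 0" by (rule hscale_pos)
  have "(\<Sum>k<2 ^ (n * ?d). \<Sum>r<D. \<bar>inner_prod u (haar K (n, k, Suc r))\<bar> * BV_norm (haar K (n, k, Suc r)))
    \<le> (\<Sum>k<2 ^ (n * ?d). \<Sum>r<D. (?s * (2 ^ ?d * W k)) * (?s * 2 ^ ?d * \<beta>))"
  proof (intro sum_mono mult_mono)
    fix k r assume "k \<in> {..<(2::nat) ^ (n * ?d)}" "r \<in> {..<D}"
    then have k: "k < 2 ^ (n * ?d)" and r: "r < D" by simp_all
    show "\<bar>inner_prod u (haar K (n, k, Suc r))\<bar> \<le> ?s * (2 ^ ?d * W k)" unfolding W_def by (rule abs_ip_haar_le[OF ui k r])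
    show "BV_norm (haar K (n, k, Suc r)) \<le> ?s * 2 ^ ?d * \<beta>" unfolding \<beta>_def using haar_BV(2)[OF enum k] by simp
    show "0 \<le> ?s * (2 ^ ?d * W k)" using s0 W0[of k] by simp
  qed (rule BV_norm_nonneg)
  also have "\<dots> = real D * (2 ^ ?d * 2 ^ ?d) * (?s * ?s) * \<beta> * (\<Sum>k<2 ^ (n * ?d). W k)"
    by (simp add: sum_distrib_left mult_ac)
  also have "\<dots> \<le> real D * (2 ^ ?d * 2 ^ ?d) * (?s * ?s) * \<beta> * (real ?d * (var u / real (finer n)))"
  proof (rule mult_left_mono)
    have "(\<Sum>k<2 ^ (n * ?d). W k) = (\<Sum>i\<in>UNIV. \<Sum>p\<in>grid (finer n). ?J i p)"
      unfolding W_def sum_parents[symmetric] by (rule sum.swap)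
    also have "\<dots> \<le> (\<Sum>i\<in>(UNIV::'n set). var u / real (finer n))"
      by (intro sum_mono sum_jumps_le_var[OF u finer_pos])
    finally show "(\<Sum>k<2 ^ (n * ?d). W k) \<le> real ?d * (var u / real (finer n))" by simp
    show "0 \<le> real D * (2 ^ ?d * 2 ^ ?d) * (?s * ?s) * \<beta>" using b0 s0 by simp
  qed
  also have "\<dots> = (real D * (2 ^ ?d * 2 ^ ?d) * (1 + 2 * real ?d) * real ?d * var u) * ((?s * ?s) * ((1 / real (finer n)) ^ (?d - 1) * (1 / real (finer n))))"
    by (simp add: \<beta>_def mult_ac)
  also have "(1 / real (finer n)) ^ (?d - 1) * (1 / real (finer n)) = (1 / real (finer n)) ^ ?d"
    by (rule power_minus_mult) simp
  also have "(?s * ?s) * (1 / real (finer n)) ^ ?d = (1 / 2) ^ ?d"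
  proof -
    have "(?s * ?s) * (1 / real (finer n)) ^ ?d * 2 ^ ?d = (?s * ?s * 2 ^ ?d) * (1 / real (finer n)) ^ ?d" by simp
    also have "\<dots> = 1" unfolding hscale_finer power_one_over by simp
    finally show ?thesis by (simp add: power_one_over divide_simps)
  qed
  also have "(real D * (2 ^ ?d * 2 ^ ?d) * (1 + 2 * real ?d) * real ?d * var u) * (1 / 2) ^ ?d
    \<le> (real D * (2 ^ ?d * 2 ^ ?d) * (1 + 2 * real ?d) * real ?d * var u) * 1"
    using var_nonneg[of u] by (intro mult_left_mono power_le_one) auto
  also have "\<dots> = (real D * 4 ^ ?d * (1 + 2 * ?d) * ?d) * var u"
    by (simp add: power_mult_distrib[symmetric])
  finally show ?thesis .
qed

text \<open>The partial sum up to the last complete level is an average; the remaining terms are some of those in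
  \<open>level_bound\<close>.\<close>

lemma partial_bounded:
  assumes u: "u \<in> BV_cube"
  shows "BV_norm (partial m u) \<le> ((1 + 2 * CARD('n)) + real D * 4 ^ CARD('n) * (1 + 2 * CARD('n)) * CARD('n)) * BV_norm u"
proof -
  let ?C1 = "1 + 2 * real CARD('n)" and ?C2 = "real D * 4 ^ CARD('n) * (1 + 2 * CARD('n)) * CARD('n)"
  have ui: "integrable lborel u" by (rule BV_cube_integrable[OF u])
  have vle: "var u \<le> BV_norm u" by (simp add: BV_norm_eq)
  have "BV_norm (partial m u) \<le> (?C1 + ?C2) * var u"
  proof (cases "m = 0")
    case True
    then have "BV_norm (partial m u) = 0" by (simp add: partial_def[abs_def] zero_BV)
    then show ?thesis using var_nonneg[of u] by simp
  next
    case False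
    then obtain n k r where nkr: "k < 2 ^ (n * CARD('n))" "r < D" "m = 2 ^ (n * CARD('n)) + k * D + r" using decode by blast
    let ?P = "(2::nat) ^ (n * CARD('n))"
    define b where "b = k * D + r"
    have "b < Suc k * D" using nkr(2) by (simp add: b_def)
    also have "\<dots> \<le> ?P * D" using nkr(1) by (intro mult_right_mono) auto
    finally have b: "b < ?P * D" .
    have m: "m = ?P + b" by (simp add: nkr(3) b_def)
    define R where "R x = (\<Sum>i<b. inner_prod u (haar_seq K (?P + i)) * haar_seq K (?P + i) x)" for x
    have pm: "partial m u = (\<lambda>x. partial ?P u x + R x)" by (simp add: partial_def[abs_def] m sum_lessThan_add R_def)
    have R: "R \<in> BV_cube" "BV_norm R \<le> (\<Sum>i<b. \<bar>inner_prod u (haar_seq K (?P + i))\<bar> * BV_norm (haar_seq K (?P + i)))"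
      using BV_sum[of "{..<b}" "\<lambda>i. haar_seq K (?P + i)" "\<lambda>i. inner_prod u (haar_seq K (?P + i))"] haar_seq_BV by (simp_all add: R_def[abs_def])
    have "BV_norm (partial m u) \<le> BV_norm (partial ?P u) + BV_norm R"
      unfolding pm by (rule BV_cube_add(2)[OF partial_BV R(1)])
    also have "BV_norm (partial ?P u) = BV_norm (average (2 ^ n) u)"
      by (rule BV_norm_cong_AE[OF partial_BV partial_level[OF ui] average_measurable, symmetric])
    also have "\<dots> \<le> ?C1 * var u" using BV_norm_average[OF u, of "2 ^ n"] by simp
    also note R(2)
    also have "(\<Sum>i<b. \<bar>inner_prod u (haar_seq K (?P + i))\<bar> * BV_norm (haar_seq K (?P + i))) \<le>
      (\<Sum>i<?P * D. \<bar>inner_prod u (haar_seq K (?P + i))\<bar> * BV_norm (haar_seq K (?P + i)))"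
      using b by (intro sum_mono2) (auto intro!: mult_nonneg_nonneg BV_norm_nonneg)
    also have "\<dots> = (\<Sum>k<?P. \<Sum>r<D. \<bar>inner_prod u (haar K (n, k, Suc r))\<bar> * BV_norm (haar K (n, k, Suc r)))"
      by (rule level_sum[of "\<lambda>h. \<bar>inner_prod u h\<bar> * BV_norm h" n])
    also have "\<dots> \<le> ?C2 * var u" by (rule level_bound[OF u])
    finally show ?thesis by (simp add: distrib_right)
  qed
  also have "\<dots> \<le> (?C1 + ?C2) * BV_norm u" using vle by (intro mult_left_mono) auto
  finally show ?thesis by simp
qed

section \<open>Orthonormality\<close>

text \<open>A cube of level \<open>m \<le> n\<close> contains all subcubes of the support of the Haar function or, up to null sets, none of them.\<close>

lemma cell_int_haar_0:
  assumes mn: "m \<le> n" and k: "k < 2 ^ (n * CARD('n))" and r: "r < D"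
  shows "cell_int (2 ^ m) (haar K (n, k, Suc r)) q = 0"
proof -
  let ?w = "indicator (cell (2 ^ m) q) :: real^'n \<Rightarrow> real"
  obtain e where e: "n = m + e" using mn le_Suc_ex by blast
  have fe: "finer n = 2 ^ m * (2 * 2 ^ e)" by (simp add: finer_def e power_add)
  have same: "cell_int (finer n) ?w (child K n k l) = cell_int (finer n) ?w (child K n k 0)" if l: "l < 2 ^ CARD('n)" for l
  proof -
    have "child K n k l i div (2 * 2 ^ e) = pos K n k i div 2 ^ e" if "l < 2 ^ CARD('n)" for l i
      using pos_child[OF enum k that] by (simp add: div_mult2_eq child_def[OF enum])
    then have "(\<forall>i. child K n k l i div (2 * 2 ^ e) = q i) \<longleftrightarrow> (\<forall>i. child K n k 0 i div (2 * 2 ^ e) = q i)"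
      using l by simp
    then show ?thesis unfolding fe by (subst (1 2) cell_int_cell) simp_all
  qed
  have "(\<Sum>l<2 ^ CARD('n). haar_matrix CARD('n) (Suc r) l * cell_int (finer n) ?w (child K n k l)) =
    (\<Sum>l<2 ^ CARD('n). haar_matrix CARD('n) (Suc r) l * cell_int (finer n) ?w (child K n k 0))"
    by (intro sum.cong refl arg_cong2[where f="(*)"] same) (simp only: lessThan_iff)
  also have "\<dots> = 0" unfolding sum_distrib_right[symmetric] using r D by (subst haar_matrix_row_sum) auto
  finally have "inner_prod ?w (haar K (n, k, Suc r)) = 0" by (subst ip_haar[OF enum k integrable_cell]) simp
  then show ?thesis by (simp add: inner_prod_def cell_int_def)
qed

lemma cell_int_seq_0:
  assumes "2 ^ (m * CARD('n)) \<le> j"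
  shows "cell_int (2 ^ m) (haar_seq K j) q = 0"
proof -
  have "j > 0" using assms by (metis gr_zeroI le_zero_eq power_not_zero zero_neq_numeral)
  then obtain n k r where nkr: "k < 2 ^ (n * CARD('n))" "r < D" "j = 2 ^ (n * CARD('n)) + k * D + r" using decode by blast
  have "j < 2 ^ (Suc n * CARD('n))"
  proof -
    have "k * D + r < Suc k * D" using nkr(2) by simp
    also have "\<dots> \<le> 2 ^ (n * CARD('n)) * D" using nkr(1) by (intro mult_right_mono) auto
    finally show ?thesis unfolding level[of n, symmetric] nkr(3) by simp
  qed
  then have "(2::nat) ^ (m * CARD('n)) < 2 ^ (Suc n * CARD('n))" using assms by linarith
  then have "m * CARD('n) < Suc n * CARD('n)" by (simp only: power_strict_increasing_iff one_less_numeral_iff semiring_norm)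
  then have "m < Suc n" by (simp only: mult_less_cancel2)
  then have "m \<le> n" by simp
  then show ?thesis using nkr by (simp add: seq_eq cell_int_haar_0)
qed

lemma ip_sym: "inner_prod u v = inner_prod v u" by (simp add: inner_prod_def mult.commute)

lemma ip_same_level:
  assumes k: "k < 2 ^ (n * CARD('n))" "k' < 2 ^ (n * CARD('n))" and r: "r < D" "r' < D"
  shows "inner_prod (haar K (n, k, Suc r)) (haar K (n, k', Suc r')) = (if k = k' \<and> r = r' then 1 else 0)"
proof -
  let ?A = "haar_matrix CARD('n)" and ?s = "hscale CARD('n) n" and ?h = "(1 / real (finer n)) ^ CARD('n)"
  have ci: "cell_int (finer n) (haar K (n, k, Suc r)) (child K n k' l) = (if k = k' then (?s * ?A (Suc r) l) * ?h else 0)" if l: "l < 2 ^ CARD('n)" for l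
  proof -
    have "cell_int (finer n) (haar K (n, k, Suc r)) (child K n k' l) =
      (\<Sum>l'<2 ^ CARD('n). (?s * ?A (Suc r) l') * cell_int (finer n) (indicator (cell (finer n) (child K n k l'))) (child K n k' l))"
      unfolding haar_fun_eq[OF enum k(1)] by (rule cell_int_sum) (rule integrable_cell)
    also have "\<dots> = (\<Sum>l'<2 ^ CARD('n). if l = l' then (if k = k' then (?s * ?A (Suc r) l) * ?h else 0) else 0)"
    proof (intro sum.cong refl)
      fix l' assume "l' \<in> {..<(2::nat) ^ CARD('n)}"
      then have l': "l' < 2 ^ CARD('n)" by simp
      have "(\<forall>i. child K n k' l i = child K n k l' i) \<longleftrightarrow> k = k' \<and> l = l'"
        using child_inj[OF enum k(2) l k(1) l'] by (auto simp: fun_eq_iff)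
      then show "(?s * ?A (Suc r) l') * cell_int (finer n) (indicator (cell (finer n) (child K n k l'))) (child K n k' l) =
        (if l = l' then (if k = k' then (?s * ?A (Suc r) l) * ?h else 0) else 0)"
        using cell_int_cell[OF finer_pos[of n] zero_less_one, of "child K n k l'" "child K n k' l"] by simp
    qed
    also have "\<dots> = (if k = k' then (?s * ?A (Suc r) l) * ?h else 0)" using l by (simp add: sum.delta)
    finally show ?thesis .
  qed
  have "inner_prod (haar K (n, k, Suc r)) (haar K (n, k', Suc r')) = ?s * (\<Sum>l<2 ^ CARD('n). ?A (Suc r') l * (if k = k' then (?s * ?A (Suc r) l) * ?h else 0))"
    unfolding ip_haar[OF enum k(2) BV_cube_integrable[OF haar_BV(1)[OF enum k(1)]]]
    by (intro arg_cong2[where f="(*)"] sum.cong refl) (simp only: lessThan_iff ci)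
  also have "\<dots> = (if k = k' then (?s * ?s) * ?h * (\<Sum>l<2 ^ CARD('n). ?A (Suc r') l * ?A (Suc r) l) else 0)"
    by (simp add: sum_distrib_left mult_ac)
  also have "\<dots> = (if k = k' \<and> r = r' then (?s * ?s) * ?h * 2 ^ CARD('n) else 0)"
    using r D by (subst haar_matrix_orthogonal) auto
  also have "(?s * ?s) * ?h * 2 ^ CARD('n) = 1"
  proof -
    have "(?s * ?s) * ?h * 2 ^ CARD('n) = (?s * ?s * 2 ^ CARD('n)) * ?h" by simp
    also have "\<dots> = 1" unfolding hscale_finer power_one_over by simp
    finally show ?thesis .
  qed
  finally show ?thesis .
qed

text \<open>The coarser function is a combination of indicators of cubes over which the finer one has integral \<open>0\<close>.\<close>

lemma ip_finer_0:
  assumes "n < n'" and k: "k < 2 ^ (n * CARD('n))" "k' < 2 ^ (n' * CARD('n))" and r': "r' < D"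
  shows "inner_prod (haar K (n', k', Suc r')) (haar K (n, k, r)) = 0"
proof -
  have "cell_int (finer n) (haar K (n', k', Suc r')) p = 0" for p
    unfolding finer_def by (rule cell_int_haar_0[OF _ k(2) r']) (use assms(1) in simp)
  then show ?thesis by (simp add: ip_haar[OF enum k(1) BV_cube_integrable[OF haar_BV(1)[OF enum k(2)]]])
qed

lemma ip_cube: "inner_prod u (indicator unit_cube) = cell_int (2 ^ 0) u (\<lambda>_::'n. 0)"
  unfolding inner_prod_def cell_int_def unit_cube_cell by (simp only: mult.commute)

lemma haar_orthonormal_le:
  assumes le: "i \<le> j"
  shows "inner_prod (haar_seq K i) (haar_seq K j) = (if i = j then 1 else 0)"
proof (cases "i = 0")
    case True
    have "inner_prod (haar_seq K i) (haar_seq K j) = cell_int (2 ^ 0) (haar_seq K j) (\<lambda>_. 0)"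
      unfolding True haar_seq.simps(1) by (subst ip_sym) (rule ip_cube)
    also have "\<dots> = (if i = j then 1 else 0)"
    proof (cases "j = 0")
      case True
      have "cell_int (2 ^ 0) (indicator (cell (2 ^ 0) (\<lambda>_::'n. 0))) (\<lambda>_. 0) = 1"
        using cell_int_cell[of "2 ^ 0" 1 "\<lambda>_::'n. 0" "\<lambda>_. 0"] by simp
      then show ?thesis using True \<open>i = 0\<close> by (simp add: unit_cube_cell)
    next
      case False
      then have "2 ^ (0 * CARD('n)) \<le> j" by simp
      from cell_int_seq_0[OF this, of "\<lambda>_. 0"] show ?thesis using False \<open>i = 0\<close> by simp
    qed
    finally show ?thesis .
  next
    case False
    obtain n k r where i: "k < 2 ^ (n * CARD('n))" "r < D" "i = 2 ^ (n * CARD('n)) + k * D + r" using False decode by blast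
    have j0: "j > 0" using False le by simp
    obtain n' k' r' where j: "k' < 2 ^ (n' * CARD('n))" "r' < D" "j = 2 ^ (n' * CARD('n)) + k' * D + r'" using j0 decode by blast
    have si: "haar_seq K i = haar K (n, k, Suc r)" unfolding i(3) by (rule seq_eq[OF i(1,2)])
    have sj: "haar_seq K j = haar K (n', k', Suc r')" unfolding j(3) by (rule seq_eq[OF j(1,2)])
    consider "n = n'" | "n < n'" | "n' < n" by linarith
    then show ?thesis
    proof cases
      case 1
      have "i = j \<longleftrightarrow> k = k' \<and> r = r'"
      proof
        assume "i = j"
        then have "k * D + r = k' * D + r'" using i(3) j(3) 1 by simp
        then have "(k * D + r) div D = (k' * D + r') div D" "(k * D + r) mod D = (k' * D + r') mod D" by simp_all
        then show "k = k' \<and> r = r'" using i(2) j(2) by simp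
      qed (use 1 i(3) j(3) in simp)
      then show ?thesis unfolding si sj 1 using ip_same_level[OF i(1)[unfolded 1] j(1) i(2) j(2)] by simp
    next
      case 2
      have "inner_prod (haar_seq K i) (haar_seq K j) = 0"
        unfolding si sj by (subst ip_sym) (rule ip_finer_0[OF 2 i(1) j(1,2)])
      moreover have "inner_prod (haar_seq K j) (haar_seq K j) = 1"
        unfolding sj using ip_same_level[OF j(1) j(1) j(2) j(2)] by simp
      ultimately show ?thesis by auto
    next
      case 3
      have "inner_prod (haar_seq K i) (haar_seq K j) = 0"
        unfolding si sj by (rule ip_finer_0[OF 3 j(1) i(1,2)])
      moreover have "inner_prod (haar_seq K j) (haar_seq K j) = 1"
        unfolding sj using ip_same_level[OF j(1) j(1) j(2) j(2)] by simp
      ultimately show ?thesis by auto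
    qed
qed

lemma haar_orthonormal: "inner_prod (haar_seq K i) (haar_seq K j) = (if i = j then 1 else 0)"
proof (cases "i \<le> j")
  case False
  then have "inner_prod (haar_seq K j) (haar_seq K i) = (if j = i then 1 else 0)" by (intro haar_orthonormal_le) simp
  then show ?thesis using False by (subst ip_sym) simp
qed (rule haar_orthonormal_le)

text \<open>The average over the cubes preserves their integrals, and later Haar functions have integral \<open>0\<close> over them.\<close>

lemma cell_int_partial:
  assumes u: "u \<in> BV_cube" and m: "2 ^ (n * CARD('n)) \<le> m" and k: "k \<in> grid (2 ^ n)"
  shows "cell_int (2 ^ n) (partial m u) k = cell_int (2 ^ n) u k"
proof -
  let ?P = "(2::nat) ^ (n * CARD('n))"
  obtain b where b: "m = ?P + b" using m le_Suc_ex by blast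
  have ci: "cell_int (2 ^ n) (partial m u) k = (\<Sum>j<m. inner_prod u (haar_seq K j) * cell_int (2 ^ n) (haar_seq K j) k)" for m
    unfolding partial_def[abs_def] by (rule cell_int_sum) (rule haar_seq_integrable)
  have "cell_int (2 ^ n) (partial m u) k = cell_int (2 ^ n) (partial ?P u) k"
    unfolding ci b sum_lessThan_add by (simp add: cell_int_seq_0)
  also have "\<dots> = cell_int (2 ^ n) (average (2 ^ n) u) k"
    by (rule cell_int_cong_AE[OF partial_level[OF BV_cube_integrable[OF u]] partial_measurable average_measurable])
  also have "\<dots> = cell_int (2 ^ n) u k" using k by (intro cell_int_average) auto
  finally show ?thesis .
qed

end

section \<open>The dual norm\<close>

lemma BV_dual_add: "\<alpha> \<in> BV_dual \<Longrightarrow> u \<in> BV_cube \<Longrightarrow> v \<in> BV_cube \<Longrightarrow> \<alpha> (\<lambda>x. u x + v x) = \<alpha> u + \<alpha> v"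
  by (simp add: BV_dual_def)

lemma BV_dual_scale: "\<alpha> \<in> BV_dual \<Longrightarrow> u \<in> BV_cube \<Longrightarrow> \<alpha> (\<lambda>x. c * u x) = c * \<alpha> u"
  by (simp add: BV_dual_def)

lemma BV_dual_outside: "\<alpha> \<in> BV_dual \<Longrightarrow> u \<notin> BV_cube \<Longrightarrow> \<alpha> u = 0"
  by (simp add: BV_dual_def)

lemma BV_dual_bound: "\<alpha> \<in> BV_dual \<Longrightarrow> \<exists>C. \<forall>u\<in>BV_cube. \<bar>\<alpha> u\<bar> \<le> C * BV_norm u"
  by (simp add: BV_dual_def)

lemma BV_dualI:
  assumes "\<And>u. u \<notin> BV_cube \<Longrightarrow> \<alpha> u = 0"
    "\<And>u v. u \<in> BV_cube \<Longrightarrow> v \<in> BV_cube \<Longrightarrow> \<alpha> (\<lambda>x. u x + v x) = \<alpha> u + \<alpha> v"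
    "\<And>c u. u \<in> BV_cube \<Longrightarrow> \<alpha> (\<lambda>x. c * u x) = c * \<alpha> u"
    "\<And>u. u \<in> BV_cube \<Longrightarrow> \<bar>\<alpha> u\<bar> \<le> C * BV_norm u"
  shows "\<alpha> \<in> BV_dual"
  unfolding BV_dual_def using assms by blast

lemma BV_dual_combine:
  fixes \<alpha> \<beta> :: "(real^'n::finite \<Rightarrow> real) \<Rightarrow> real"
  assumes a: "\<alpha> \<in> BV_dual" and b: "\<beta> \<in> BV_dual"
  shows "(\<lambda>u. \<alpha> u + c * \<beta> u) \<in> BV_dual"
proof -
  obtain A where A: "\<And>u. u \<in> BV_cube \<Longrightarrow> \<bar>\<alpha> u\<bar> \<le> A * BV_norm u" using BV_dual_bound[OF a] by blast
  obtain B where B: "\<And>u. u \<in> BV_cube \<Longrightarrow> \<bar>\<beta> u\<bar> \<le> B * BV_norm u" using BV_dual_bound[OF b] by blast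
  show ?thesis
  proof (rule BV_dualI[where C="A + \<bar>c\<bar> * B"])
    fix u :: "real^'n \<Rightarrow> real" assume u: "u \<in> BV_cube"
    have "\<bar>\<alpha> u + c * \<beta> u\<bar> \<le> \<bar>\<alpha> u\<bar> + \<bar>c\<bar> * \<bar>\<beta> u\<bar>" using abs_triangle_ineq[of "\<alpha> u" "c * \<beta> u"] by (simp add: abs_mult)
    also have "\<dots> \<le> A * BV_norm u + \<bar>c\<bar> * (B * BV_norm u)" using A[OF u] B[OF u] by (intro add_mono mult_left_mono) auto
    finally show "\<bar>\<alpha> u + c * \<beta> u\<bar> \<le> (A + \<bar>c\<bar> * B) * BV_norm u" by (simp add: algebra_simps)
  qed (simp_all add: BV_dual_add[OF a] BV_dual_add[OF b] BV_dual_scale[OF a] BV_dual_scale[OF b] BV_dual_outside[OF a] BV_dual_outside[OF b] algebra_simps)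
qed

lemma BV_dual_diff: "\<alpha> \<in> BV_dual \<Longrightarrow> \<beta> \<in> BV_dual \<Longrightarrow> (\<lambda>u. \<alpha> u - \<beta> u) \<in> BV_dual"
  using BV_dual_combine[of \<alpha> \<beta> "-1"] by simp

lemma BV_dual_zero: "(\<lambda>u. 0) \<in> BV_dual"
  by (rule BV_dualI[where C=0]) auto

lemma BV_dual_sum:
  assumes "\<And>j. e j \<in> BV_dual"
  shows "(\<lambda>u. \<Sum>j<(m::nat). a j * e j u) \<in> BV_dual"
proof (induction m)
  case 0
  then show ?case using BV_dual_zero by simp
next
  case (Suc m)
  then show ?case using BV_dual_combine[OF Suc assms[of m], of "a m"] by simp
qed

lemma dual_norm_le:
  fixes \<alpha> :: "(real^'n::finite \<Rightarrow> real) \<Rightarrow> real"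
  assumes "\<And>u. u \<in> BV_cube \<Longrightarrow> \<bar>\<alpha> u\<bar> \<le> C * BV_norm u" "0 \<le> C"
  shows "dual_norm \<alpha> \<le> C"
  unfolding dual_norm_def
proof (rule cSUP_least)
  have "(\<lambda>x::real^'n. 0) \<in> {u \<in> BV_cube. BV_norm u \<le> 1}" using zero_BV[where 'n='n] by simp
  then show "{u :: real^'n \<Rightarrow> real. u \<in> BV_cube \<and> BV_norm u \<le> 1} \<noteq> {}" by blast
  fix u :: "real^'n \<Rightarrow> real" assume "u \<in> {u \<in> BV_cube. BV_norm u \<le> 1}"
  then have u: "u \<in> BV_cube" "BV_norm u \<le> 1" by auto
  have "\<bar>\<alpha> u\<bar> \<le> C * BV_norm u" by (rule assms(1)[OF u(1)])
  also have "\<dots> \<le> C * 1" using u(2) assms(2) by (rule mult_left_mono)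
  finally show "\<bar>\<alpha> u\<bar> \<le> C" by simp
qed

lemma abs_le_dual_norm:
  fixes \<alpha> :: "(real^'n::finite \<Rightarrow> real) \<Rightarrow> real"
  assumes a: "\<alpha> \<in> BV_dual" and u: "u \<in> BV_cube"
  shows "\<bar>\<alpha> u\<bar> \<le> dual_norm \<alpha> * BV_norm u"
proof -
  obtain C where C: "\<And>u. u \<in> BV_cube \<Longrightarrow> \<bar>\<alpha> u\<bar> \<le> C * BV_norm u" using BV_dual_bound[OF a] by blast
  show ?thesis
  proof (cases "BV_norm u = 0")
    case True
    then show ?thesis using C[OF u] by simp
  next
    case False
    then have pos: "BV_norm u > 0" using BV_norm_nonneg[of u] by simp
    define v where "v x = inverse (BV_norm u) * u x" for x
    have v: "v \<in> BV_cube" "BV_norm v \<le> 1"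
      using BV_cube_scale[OF u, of "inverse (BV_norm u)"] pos by (simp_all add: v_def[abs_def])
    have "\<bar>\<alpha> v\<bar> \<le> dual_norm \<alpha>"
      unfolding dual_norm_def
    proof (rule cSUP_upper)
      show "v \<in> {u \<in> BV_cube. BV_norm u \<le> 1}" using v by simp
      show "bdd_above ((\<lambda>u. \<bar>\<alpha> u\<bar>) ` {u \<in> BV_cube. BV_norm u \<le> 1})"
      proof (rule bdd_aboveI2[where M="\<bar>C\<bar>"])
        fix w :: "real^'n \<Rightarrow> real" assume "w \<in> {u \<in> BV_cube. BV_norm u \<le> 1}"
        then have w: "w \<in> BV_cube" "BV_norm w \<le> 1" by auto
        have "\<bar>\<alpha> w\<bar> \<le> C * BV_norm w" by (rule C[OF w(1)])
        also have "\<dots> \<le> \<bar>C\<bar> * 1" using w(2) BV_norm_nonneg[of w] by (intro mult_mono) auto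
        finally show "\<bar>\<alpha> w\<bar> \<le> \<bar>C\<bar>" by simp
      qed
    qed
    moreover have "\<alpha> v = inverse (BV_norm u) * \<alpha> u" unfolding v_def[abs_def] by (rule BV_dual_scale[OF a u])
    ultimately show ?thesis using pos by (simp add: abs_mult field_simps)
  qed
qed

text \<open>The bound \<open>abs_le_dual_norm\<close> at a function of positive norm, here the indicator of the unit cube.\<close>

lemma dual_norm_nonneg:
  fixes \<alpha> :: "(real^'n::finite \<Rightarrow> real) \<Rightarrow> real"
  assumes a: "\<alpha> \<in> BV_dual"
  shows "0 \<le> dual_norm \<alpha>"
proof -
  let ?w = "indicator (cell 1 (\<lambda>_::'n. 0)) :: real^'n \<Rightarrow> real"
  have w: "?w \<in> BV_cube" by (rule cell_in_BV_cube) (auto simp: grid_def)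
  have "(\<integral>x. \<bar>?w x\<bar> \<partial>lborel) = 1" using measure_cell[of 1 "\<lambda>_::'n. 0"] by simp
  then have "0 < BV_norm ?w" using var_nonneg[of ?w] by (simp add: BV_norm_eq)
  then show ?thesis using abs_le_dual_norm[OF a w] by (metis abs_ge_zero order_trans zero_le_mult_iff not_le)
qed

section \<open>The functionals of functions in the Lebesgue space\<close>

text \<open>Elements of \<open>Ld_cube\<close> are constrained only inside the cube; cutting them off makes them Borel functions on the whole
  space.\<close>

definition cut :: "(real^'n::finite \<Rightarrow> real) \<Rightarrow> real^'n \<Rightarrow> real" where
  "cut f x = indicator unit_cube x * f x"

lemma T_eq: "u \<in> BV_cube \<Longrightarrow> T f u = (\<integral>x. cut f x * u x \<partial>lborel)"
  by (simp add: T_def set_lebesgue_integral_def cut_def mult.assoc)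

lemma cut_outside: "x \<notin> unit_cube \<Longrightarrow> cut f x = 0"
  by (simp add: cut_def)

lemma cut_Ld:
  fixes f :: "real^'n::finite \<Rightarrow> real"
  assumes "f \<in> Ld_cube"
  shows "cut f \<in> borel_measurable borel" "integrable lborel (\<lambda>x. \<bar>cut f x\<bar> ^ CARD('n))"
proof -
  show "cut f \<in> borel_measurable borel"
    using assms by (simp add: Ld_cube_def set_borel_measurable_def cut_def[abs_def])
  have "(\<lambda>x. \<bar>cut f x\<bar> ^ CARD('n)) = (\<lambda>x. indicator unit_cube x *\<^sub>R \<bar>f x\<bar> ^ CARD('n))"
    by (rule ext) (auto simp: cut_def indicator_def zero_power)
  then show "integrable lborel (\<lambda>x. \<bar>cut f x\<bar> ^ CARD('n))"
    using assms by (simp add: Ld_cube_def set_integrable_def)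
qed

lemma T_BV_dual:
  fixes f :: "real^'n::finite \<Rightarrow> real"
  assumes f: "f \<in> Ld_cube"
  shows "T f \<in> BV_dual"
proof (rule BV_dualI[where C="Ld_norm (cut f)"])
  have sob: "integrable lborel (\<lambda>x. cut f x * u x)" "\<bar>\<integral>x. cut f x * u x \<partial>lborel\<bar> \<le> Ld_norm (cut f) * var u"
    if "u \<in> BV_cube" for u
    using that by (auto intro!: sobolev cut_Ld[OF f] cut_outside)
  show "u \<notin> BV_cube \<Longrightarrow> T f u = 0" for u by (simp add: T_def)
  show "T f (\<lambda>x. u x + v x) = T f u + T f v" if "u \<in> BV_cube" "v \<in> BV_cube" for u v
    using sob(1)[OF that(1)] sob(1)[OF that(2)] by (simp add: T_eq that BV_cube_add distrib_left)
  show "T f (\<lambda>x. c * u x) = c * T f u" if "u \<in> BV_cube" for c u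
  proof -
    have "(\<integral>x. cut f x * (c * u x) \<partial>lborel) = (\<integral>x. c * (cut f x * u x) \<partial>lborel)" by (simp only: mult.left_commute)
    then show ?thesis by (simp add: T_eq that BV_cube_scale)
  qed
  show "\<bar>T f u\<bar> \<le> Ld_norm (cut f) * BV_norm u" if u: "u \<in> BV_cube" for u
  proof -
    have "\<bar>T f u\<bar> \<le> Ld_norm (cut f) * var u" using sob(2)[OF u] by (simp add: T_eq u)
    also have "\<dots> \<le> Ld_norm (cut f) * BV_norm u" by (intro mult_left_mono Ld_norm_nonneg) (simp add: BV_norm_eq)
    finally show ?thesis .
  qed
qed

lemma tendsto_root_0: "0 < d \<Longrightarrow> X \<longlonglongrightarrow> 0 \<Longrightarrow> (\<lambda>j. root d (X j)) \<longlonglongrightarrow> 0"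
  using tendsto_real_root[of X 0 sequentially d] by simp

text \<open>Dominated convergence in \<open>L\<^sup>d\<close>, transported to functionals by Sobolev's inequality for \<open>F - G j\<close>.\<close>

lemma approx_functional:
  fixes F :: "real^'n::finite \<Rightarrow> real"
  assumes F: "F \<in> borel_measurable borel" "integrable lborel (\<lambda>x. \<bar>F x\<bar> ^ CARD('n))" "\<And>x. x \<notin> unit_cube \<Longrightarrow> F x = 0"
    and G: "\<And>j. G j \<in> borel_measurable borel" "\<And>j x. x \<notin> unit_cube \<Longrightarrow> G j x = 0"
    and lim: "AE x in lborel. (\<lambda>j. G j x) \<longlonglongrightarrow> F x"
    and bd: "\<And>j. AE x in lborel. \<bar>F x - G j x\<bar> ^ CARD('n) \<le> w x" and w: "integrable lborel w" and e: "e > 0"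
  shows "\<exists>j. \<forall>u\<in>BV_cube. \<bar>(\<integral>x. F x * u x \<partial>lborel) - (\<integral>x. G j x * u x \<partial>lborel)\<bar> \<le> e * BV_norm u"
proof -
  have i: "integrable lborel (\<lambda>x. \<bar>F x - G j x\<bar> ^ CARD('n))" for j
    by (rule Bochner_Integration.integrable_bound[OF w]) (use F(1) G(1) bd[of j] in \<open>auto elim!: eventually_mono\<close>)
  have "(\<lambda>j. \<integral>x. \<bar>F x - G j x\<bar> ^ CARD('n) \<partial>lborel) \<longlonglongrightarrow> (\<integral>x. 0 \<partial>(lborel :: (real^'n) measure))"
  proof (rule integral_dominated_convergence[where w=w])
    show "AE x in lborel. (\<lambda>j. \<bar>F x - G j x\<bar> ^ CARD('n)) \<longlonglongrightarrow> 0"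
      using lim
    proof eventually_elim
      case (elim x)
      then have "(\<lambda>j. \<bar>F x - G j x\<bar> ^ CARD('n)) \<longlonglongrightarrow> \<bar>F x - F x\<bar> ^ CARD('n)" by (intro tendsto_intros)
      then show ?case by (simp add: zero_power)
    qed
  qed (use F(1) G(1) bd w in auto)
  then have "(\<lambda>j. Ld_norm (\<lambda>x. F x - G j x)) \<longlonglongrightarrow> 0"
    unfolding Ld_norm_def by (intro tendsto_root_0) auto
  then have "eventually (\<lambda>j. Ld_norm (\<lambda>x. F x - G j x) < e) sequentially" using e by (rule order_tendstoD(2))
  then obtain j where j: "Ld_norm (\<lambda>x. F x - G j x) < e" by (auto simp: eventually_sequentially)
  have "\<bar>(\<integral>x. F x * u x \<partial>lborel) - (\<integral>x. G j x * u x \<partial>lborel)\<bar> \<le> e * BV_norm u" if u: "u \<in> BV_cube" for u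
  proof -
    have d: "integrable lborel (\<lambda>x. (F x - G j x) * u x)" "\<bar>\<integral>x. (F x - G j x) * u x \<partial>lborel\<bar> \<le> Ld_norm (\<lambda>x. F x - G j x) * var u"
      using F(1,3) G i[of j] by (intro sobolev[OF _ i[of j] _ u]; auto)+
    have iF: "integrable lborel (\<lambda>x. F x * u x)" by (rule sobolev(1)[OF F(1,2) _ u]) (rule F(3))
    have "integrable lborel (\<lambda>x. F x * u x - (F x - G j x) * u x)" by (rule Bochner_Integration.integrable_diff[OF iF d(1)])
    then have iG: "integrable lborel (\<lambda>x. G j x * u x)" by (simp add: left_diff_distrib)
    have "(\<integral>x. F x * u x \<partial>lborel) - (\<integral>x. G j x * u x \<partial>lborel) = (\<integral>x. (F x - G j x) * u x \<partial>lborel)"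
      using iF iG by (simp add: left_diff_distrib)
    then have "\<bar>(\<integral>x. F x * u x \<partial>lborel) - (\<integral>x. G j x * u x \<partial>lborel)\<bar> \<le> Ld_norm (\<lambda>x. F x - G j x) * var u" using d(2) by simp
    also have "\<dots> \<le> e * BV_norm u"
      using j by (intro mult_mono) (use e in \<open>auto simp: BV_norm_eq var_nonneg Ld_norm_nonneg\<close>)
    finally show ?thesis .
  qed
  then show ?thesis by blast
qed

text \<open>The function is truncated first, as bounded functions are limits of uniformly bounded step functions.\<close>

lemma T_approx_step:
  fixes f :: "real^'n::finite \<Rightarrow> real"
  assumes f: "f \<in> Ld_cube" and e: "e > 0"
  obtains n c where "\<And>u. u \<in> BV_cube \<Longrightarrow> \<bar>T f u - (\<integral>x. step (2 ^ n) c x * u x \<partial>lborel)\<bar> \<le> e * BV_norm u"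
proof -
  note F = cut_Ld[OF f]
  define g where "g m x = (if \<bar>cut f x\<bar> \<le> real m then cut f x else 0)" for m :: nat and x
  have gm: "g m \<in> borel_measurable borel" for m unfolding g_def using F(1) by measurable
  have g0: "x \<notin> unit_cube \<Longrightarrow> g m x = 0" for m x by (simp add: g_def cut_outside)
  have "\<exists>m. \<forall>u\<in>BV_cube. \<bar>(\<integral>x. cut f x * u x \<partial>lborel) - (\<integral>x. g m x * u x \<partial>lborel)\<bar> \<le> e / 2 * BV_norm u"
  proof (rule approx_functional[OF F cut_outside gm g0 _ _ F(2)])
    show "AE x in lborel. (\<lambda>m. g m x) \<longlonglongrightarrow> cut f x"
    proof (rule AE_I2, rule tendsto_eventually)
      fix x
      obtain m0 :: nat where "\<bar>cut f x\<bar> \<le> real m0" using real_arch_simple by blast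
      then show "\<forall>\<^sub>F m in sequentially. g m x = cut f x"
        by (intro eventually_sequentiallyI[of m0]) (auto simp: g_def)
    qed
    show "AE x in lborel. \<bar>cut f x - g m x\<bar> ^ CARD('n) \<le> \<bar>cut f x\<bar> ^ CARD('n)" for m
      by (intro AE_I2 power_mono) (auto simp: g_def)
  qed (use e in auto)
  then obtain m where m: "\<And>u. u \<in> BV_cube \<Longrightarrow> \<bar>(\<integral>x. cut f x * u x \<partial>lborel) - (\<integral>x. g m x * u x \<partial>lborel)\<bar> \<le> e / 2 * BV_norm u" by blast
  have gb: "\<bar>g m x\<bar> \<le> real m" for x by (simp add: g_def)
  obtain n c where nc: "AE x in lborel. (\<lambda>j. step (2 ^ n j) (c j) x) \<longlonglongrightarrow> g m x" "\<And>j k. \<bar>c j k\<bar> \<le> real m"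
    using step_approx_bounded[OF gm gb g0] by blast
  have "\<exists>j. \<forall>u\<in>BV_cube. \<bar>(\<integral>x. g m x * u x \<partial>lborel) - (\<integral>x. step (2 ^ n j) (c j) x * u x \<partial>lborel)\<bar> \<le> e / 2 * BV_norm u"
  proof (rule approx_functional[OF gm _ g0 step_measurable _ nc(1) _ integrable_cube[of "(2 * real m) ^ CARD('n)"]])
    show "integrable lborel (\<lambda>x. \<bar>g m x\<bar> ^ CARD('n))"
    proof (rule Bochner_Integration.integrable_bound[OF F(2)])
      show "(\<lambda>x. \<bar>g m x\<bar> ^ CARD('n)) \<in> borel_measurable lborel" using gm[of m] by measurable
      have "\<bar>g m x\<bar> \<le> \<bar>cut f x\<bar>" for x by (simp add: g_def)
      then show "AE x in lborel. norm (\<bar>g m x\<bar> ^ CARD('n)) \<le> norm (\<bar>cut f x\<bar> ^ CARD('n))"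
        by (intro AE_I2) (simp add: power_mono)
    qed
    show "step (2 ^ n j) (c j) x = 0" if "x \<notin> unit_cube" for j x using that by (intro step_outside) auto
    show "AE x in lborel. \<bar>g m x - step (2 ^ n j) (c j) x\<bar> ^ CARD('n) \<le> (2 * real m) ^ CARD('n) * indicator unit_cube x" for j
    proof -
      have "AE x in lborel. \<bar>step (2 ^ n j) (c j) x\<bar> \<le> real m * indicator unit_cube x"
        by (rule step_bound) (use nc(2) in auto)
      then show ?thesis
      proof eventually_elim
        case (elim x)
        show ?case
        proof (cases "x \<in> unit_cube")
          case True
          have "\<bar>g m x - step (2 ^ n j) (c j) x\<bar> \<le> 2 * real m" using elim True gb[of x] by simp
          then have "\<bar>g m x - step (2 ^ n j) (c j) x\<bar> ^ CARD('n) \<le> (2 * real m) ^ CARD('n)" by (intro power_mono) auto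
          then show ?thesis using True by simp
        next
          case False
          then show ?thesis using g0[OF False] by (simp add: step_outside zero_power)
        qed
      qed
    qed
  qed (use e in auto)
  then obtain j where j: "\<And>u. u \<in> BV_cube \<Longrightarrow> \<bar>(\<integral>x. g m x * u x \<partial>lborel) - (\<integral>x. step (2 ^ n j) (c j) x * u x \<partial>lborel)\<bar> \<le> e / 2 * BV_norm u" by blast
  show ?thesis
  proof
    fix u :: "real^'n \<Rightarrow> real" assume u: "u \<in> BV_cube"
    have "e * BV_norm u = e / 2 * BV_norm u + e / 2 * BV_norm u" by simp
    then show "\<bar>T f u - (\<integral>x. step (2 ^ n j) (c j) x * u x \<partial>lborel)\<bar> \<le> e * BV_norm u"
      unfolding T_eq[OF u] using m[OF u] j[OF u] by linarith
  qed
qed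

section \<open>The basis\<close>

context
  fixes K :: "nat \<Rightarrow> nat \<Rightarrow> (real^'n::finite) set" and D :: nat
  assumes enum: "dyadic_enumeration K" and D: "2 ^ CARD('n) = Suc D"
begin

text \<open>The common form of the constant function and of the Haar functions from which boundedness and support are read off.\<close>

lemma haar_seq_step:
  obtains N :: nat and c :: "nat \<Rightarrow> real" and Q where "haar_seq K j = (\<lambda>x. \<Sum>a<N. c a * indicator (Q a) x)" "\<And>a. a < N \<Longrightarrow> Q a \<subseteq> unit_cube"
proof (cases "j = 0")
  case True
  have "haar_seq K j = (\<lambda>x. \<Sum>a<(1::nat). 1 * indicator unit_cube x)" by (simp add: True)
  then show ?thesis by (rule that) simp
next
  case False
  then obtain n k r where nkr: "k < 2 ^ (n * CARD('n))" "r < D" "j = 2 ^ (n * CARD('n)) + k * D + r" using decode[OF enum D] by blast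
  have h: "haar_seq K j = haar K (n, k, Suc r)" unfolding nkr(3) by (rule seq_eq[OF enum D nkr(1,2)])
  show ?thesis
  proof (rule that)
    show "haar_seq K j = (\<lambda>x. \<Sum>l<2 ^ CARD('n). (hscale CARD('n) n * haar_matrix CARD('n) (Suc r) l) * indicator (cell (finer n) (child K n k l)) x)"
      unfolding h by (rule haar_fun_eq[OF enum nkr(1)])
    show "cell (finer n) (child K n k l) \<subseteq> unit_cube" if "l < 2 ^ CARD('n)" for l
      using that by (intro cell_subset_cube[OF finer_pos child_grid[OF enum nkr(1)]])
  qed
qed

lemma haar_seq_props:
  shows "\<exists>b. \<forall>x. \<bar>haar_seq K j x\<bar> \<le> b" "haar_seq K j \<in> borel_measurable borel" "x \<notin> unit_cube \<Longrightarrow> haar_seq K j x = 0"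
proof -
  obtain N :: nat and c :: "nat \<Rightarrow> real" and Q
    where h: "haar_seq K j = (\<lambda>x. \<Sum>a<N. c a * indicator (Q a) x)" and c: "\<And>a. a < N \<Longrightarrow> Q a \<subseteq> unit_cube"
    by (rule haar_seq_step[of j]) blast
  have "\<bar>haar_seq K j x\<bar> \<le> (\<Sum>a<N. \<bar>c a\<bar>)" for x
    unfolding h by (rule order_trans[OF sum_abs], rule sum_mono) (auto simp: indicator_def)
  then show "\<exists>b. \<forall>x. \<bar>haar_seq K j x\<bar> \<le> b" by blast
  show "haar_seq K j \<in> borel_measurable borel"
    using borel_measurable_integrable[OF haar_seq_integrable[OF enum D]] by simp
  show "haar_seq K j x = 0" if "x \<notin> unit_cube"
    unfolding h using c that by (intro sum.neutral) (auto simp: indicator_def)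
qed

lemma cut_haar_seq: "cut (haar_seq K j) = haar_seq K j"
  by (rule ext) (auto simp: cut_def indicator_def haar_seq_props(3))

lemma haar_seq_Ld: "haar_seq K j \<in> Ld_cube"
proof -
  note m = haar_seq_props(2)[of j]
  obtain b where b: "\<And>x. \<bar>haar_seq K j x\<bar> \<le> b" using haar_seq_props(1)[of j] by blast
  have "integrable lborel (\<lambda>x. indicator unit_cube x *\<^sub>R \<bar>haar_seq K j x\<bar> ^ CARD('n))"
  proof (rule Bochner_Integration.integrable_bound[OF integrable_cube[of "b ^ CARD('n)"]])
    show "AE x in lborel. norm (indicator unit_cube x *\<^sub>R \<bar>haar_seq K j x\<bar> ^ CARD('n)) \<le> norm (b ^ CARD('n) * indicator unit_cube x)"
    proof (rule AE_I2)
      fix x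
      have "\<bar>haar_seq K j x\<bar> ^ CARD('n) \<le> b ^ CARD('n)" using b[of x] by (intro power_mono) auto
      then show "norm (indicator unit_cube x *\<^sub>R \<bar>haar_seq K j x\<bar> ^ CARD('n)) \<le> norm (b ^ CARD('n) * indicator unit_cube x)"
        by (auto simp: indicator_def)
    qed
  qed (use m in auto)
  then show ?thesis using m by (simp add: Ld_cube_def set_borel_measurable_def set_integrable_def)
qed

lemma T_haar_dual: "T (haar_seq K j) \<in> BV_dual"
  by (rule T_BV_dual[OF haar_seq_Ld])

lemma T_haar_SCH: "T (haar_seq K j) \<in> SCH"
proof -
  have "dual_norm (\<lambda>u::real^'n \<Rightarrow> real. 0) \<le> 0" by (rule dual_norm_le) auto
  then show ?thesis unfolding SCH_def using T_haar_dual haar_seq_Ld by (auto intro!: bexI[of _ "haar_seq K j"] intro: le_less_trans)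
qed

lemma T_haar_ip: "u \<in> BV_cube \<Longrightarrow> T (haar_seq K j) u = inner_prod u (haar_seq K j)"
  by (simp add: T_eq cut_haar_seq inner_prod_def)

lemma T_haar_haar: "T (haar_seq K j) (haar_seq K i) = (if i = j then 1 else 0)"
  using T_haar_ip[OF haar_seq_BV[OF enum D]] haar_orthonormal[OF enum D] by simp

text \<open>By linearity of \<open>\<alpha>\<close>, as \<open>T (haar_seq K j) u\<close> is the \<open>j\<close>-th Haar coefficient of \<open>u\<close>.\<close>

lemma dual_partial:
  assumes a: "\<alpha> \<in> BV_dual" and u: "u \<in> BV_cube"
  shows "\<alpha> (partial K m u) = (\<Sum>j<m. \<alpha> (haar_seq K j) * T (haar_seq K j) u)"
proof (induction m)
  case 0
  have "\<alpha> (\<lambda>x. 0 * 0) = 0 * \<alpha> (\<lambda>x. 0)" by (rule BV_dual_scale[OF a zero_BV(1)])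
  then show ?case by (simp add: partial_def[OF enum D, abs_def])
next
  case (Suc m)
  have "partial K (Suc m) u = (\<lambda>x. partial K m u x + inner_prod u (haar_seq K m) * haar_seq K m x)"
    by (simp add: partial_def[OF enum D, abs_def])
  then have "\<alpha> (partial K (Suc m) u) = \<alpha> (partial K m u) + inner_prod u (haar_seq K m) * \<alpha> (haar_seq K m)"
    using BV_dual_add[OF a partial_BV[OF enum D] BV_cube_scale(1)[OF haar_seq_BV[OF enum D]]] BV_dual_scale[OF a haar_seq_BV[OF enum D]] by simp
  then show ?case using Suc T_haar_ip[OF u] by (simp add: mult.commute)
qed

text \<open>A step functional of level \<open>n\<close> depends only on the integrals over cubes of that level.\<close>

lemma step_partial:
  assumes u: "u \<in> BV_cube" and m: "2 ^ (n * CARD('n)) \<le> m"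
  shows "(\<integral>x. step (2 ^ n) c x * partial K m u x \<partial>lborel) = (\<integral>x. step (2 ^ n) c x * u x \<partial>lborel)"
  unfolding integral_step_times[OF BV_cube_integrable[OF u]] integral_step_times[OF BV_cube_integrable[OF partial_BV[OF enum D]]]
  by (intro sum.cong refl) (simp add: cell_int_partial[OF enum D u m])

text \<open>The convergence on a dense set, where the sequence is eventually constant, extends by uniform boundedness.\<close>

lemma expansion_converges:
  assumes a: "\<alpha> \<in> SCH"
  shows "(\<lambda>m. dual_norm (\<lambda>u. \<alpha> u - (\<Sum>j<m. \<alpha> (haar_seq K j) * T (haar_seq K j) u))) \<longlonglongrightarrow> 0"
proof -
  have ad: "\<alpha> \<in> BV_dual" using a by (simp add: SCH_def)
  define C where "C = (1 + 2 * real CARD('n)) + real D * 4 ^ CARD('n) * (1 + 2 * CARD('n)) * CARD('n)"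
  have C0: "C \<ge> 0" by (simp add: C_def)
  define R where "R m u = \<alpha> u - (\<Sum>j<m. \<alpha> (haar_seq K j) * T (haar_seq K j) u)" for m u
  have Rd: "R m \<in> BV_dual" for m
    unfolding R_def by (intro BV_dual_diff ad BV_dual_sum T_haar_dual)
  have "\<exists>m0. \<forall>m\<ge>m0. norm (dual_norm (R m) - 0) < e" if e: "e > 0" for e
  proof -
    \<comment> \<open>\<open>\<alpha>\<close> is within \<open>2 \<epsilon>\<close> of a step functional, and the error is at most \<open>1 + C\<close> times that\<close>
    define \<epsilon> where "\<epsilon> = e / (4 * (1 + C))"
    have \<epsilon>: "\<epsilon> > 0" using e C0 by (simp add: \<epsilon>_def)
    obtain f where f: "f \<in> Ld_cube" "dual_norm (\<lambda>u. \<alpha> u - T f u) < \<epsilon>" using a \<epsilon> by (auto simp: SCH_def)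
    obtain n c where nc: "\<And>u. u \<in> BV_cube \<Longrightarrow> \<bar>T f u - (\<integral>x. step (2 ^ n) c x * u x \<partial>lborel)\<bar> \<le> \<epsilon> * BV_norm u"
      using T_approx_step[OF f(1) \<epsilon>] by blast
    let ?S = "\<lambda>u. \<integral>x. step (2 ^ n) c x * u x \<partial>lborel"
    have near: "\<bar>\<alpha> u - ?S u\<bar> \<le> 2 * \<epsilon> * BV_norm u" if u: "u \<in> BV_cube" for u
    proof -
      have "\<bar>\<alpha> u - T f u\<bar> \<le> dual_norm (\<lambda>u. \<alpha> u - T f u) * BV_norm u"
        by (rule abs_le_dual_norm[OF BV_dual_diff[OF ad T_BV_dual[OF f(1)]] u])
      also have "\<dots> \<le> \<epsilon> * BV_norm u" using f(2) BV_norm_nonneg by (intro mult_right_mono) auto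
      finally have "\<bar>\<alpha> u - T f u\<bar> \<le> \<epsilon> * BV_norm u" .
      then have "\<bar>\<alpha> u - ?S u\<bar> \<le> \<epsilon> * BV_norm u + \<epsilon> * BV_norm u" using nc[OF u] by linarith
      then show ?thesis by simp
    qed
    have "dual_norm (R m) \<le> 2 * \<epsilon> * (1 + C)" if m: "2 ^ (n * CARD('n)) \<le> m" for m
    proof (rule dual_norm_le)
      fix u :: "real^'n \<Rightarrow> real" assume u: "u \<in> BV_cube"
      have "R m u = (\<alpha> u - ?S u) - (\<alpha> (partial K m u) - ?S (partial K m u))"
        unfolding R_def dual_partial[OF ad u] step_partial[OF u m] by simp
      then have "\<bar>R m u\<bar> \<le> \<bar>\<alpha> u - ?S u\<bar> + \<bar>\<alpha> (partial K m u) - ?S (partial K m u)\<bar>" by linarith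
      also have "\<dots> \<le> 2 * \<epsilon> * BV_norm u + 2 * \<epsilon> * BV_norm (partial K m u)"
        by (intro add_mono near u partial_BV[OF enum D])
      also have "\<dots> \<le> 2 * \<epsilon> * BV_norm u + 2 * \<epsilon> * (C * BV_norm u)"
        using partial_bounded[OF enum D u, of m] \<epsilon> by (intro add_left_mono mult_left_mono) (auto simp: C_def)
      finally show "\<bar>R m u\<bar> \<le> 2 * \<epsilon> * (1 + C) * BV_norm u" by (simp add: algebra_simps)
    qed (use \<epsilon> C0 in simp)
    moreover have "2 * \<epsilon> * (1 + C) < e"
    proof -
      define z where "z = 1 + C"
      have "z \<noteq> 0" using C0 by (simp add: z_def)
      then have "2 * \<epsilon> * z = e / 2" by (simp add: \<epsilon>_def z_def[symmetric])
      then have "2 * \<epsilon> * (1 + C) = e / 2" by (simp only: z_def)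
      then show ?thesis using e by simp
    qed
    ultimately have "dual_norm (R m) < e" if "2 ^ (n * CARD('n)) \<le> m" for m
      using that le_less_trans by blast
    then have "norm (dual_norm (R m) - 0) < e" if "2 ^ (n * CARD('n)) \<le> m" for m
      using dual_norm_nonneg[OF Rd[of m]] that by simp
    then show ?thesis by blast
  qed
  then have "(\<lambda>m. dual_norm (R m)) \<longlonglongrightarrow> 0" by (rule LIMSEQ_I)
  then show ?thesis by (simp add: R_def[abs_def])
qed

text \<open>Evaluation at a basis function is continuous in the dual norm and picks out one coefficient.\<close>

lemma expansion_unique:
  assumes a: "\<alpha> \<in> SCH" and lim: "(\<lambda>m. dual_norm (\<lambda>u. \<alpha> u - (\<Sum>j<m. b j * T (haar_seq K j) u))) \<longlonglongrightarrow> 0"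
  shows "b i = \<alpha> (haar_seq K i)"
proof -
  have ad: "\<alpha> \<in> BV_dual" using a by (simp add: SCH_def)
  define R where "R m u = \<alpha> u - (\<Sum>j<m. b j * T (haar_seq K j) u)" for m u
  have Rd: "R m \<in> BV_dual" for m
    unfolding R_def by (intro BV_dual_diff ad BV_dual_sum T_haar_dual)
  let ?h = "haar_seq K i"
  have h: "?h \<in> BV_cube" by (rule haar_seq_BV[OF enum D])
  have val: "R m ?h = \<alpha> ?h - b i" if "i < m" for m
  proof -
    have "(\<Sum>j<m. b j * T (haar_seq K j) ?h) = (\<Sum>j<m. if i = j then b j else 0)"
      by (intro sum.cong refl) (simp add: T_haar_haar)
    then show ?thesis using that by (simp add: R_def)
  qed
  have "(\<lambda>m. dual_norm (R m) * BV_norm ?h) \<longlonglongrightarrow> 0 * BV_norm ?h"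
    using lim by (intro tendsto_intros) (simp add: R_def[abs_def])
  moreover have "eventually (\<lambda>m. \<bar>\<alpha> ?h - b i\<bar> \<le> dual_norm (R m) * BV_norm ?h) sequentially"
    using abs_le_dual_norm[OF Rd h] val by (intro eventually_sequentiallyI[of "Suc i"]) (metis Suc_le_lessD)
  ultimately have "\<bar>\<alpha> ?h - b i\<bar> \<le> 0 * BV_norm ?h"
    by (rule tendsto_lowerbound) simp
  then show ?thesis by simp
qed

end

theorem theorem5p5:
  fixes K :: "nat \<Rightarrow> nat \<Rightarrow> (real^'n::finite) set"
  assumes "dyadic_enumeration K"
  shows "schauder_basis SCH dual_norm (\<lambda>j. T (haar_seq K j)) \<and>
    (\<forall>\<alpha>\<in>SCH. (\<lambda>m. dual_norm (\<lambda>u. \<alpha> u - (\<Sum>j<m. \<alpha> (haar_seq K j) * T (haar_seq K j) u)))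
      \<longlonglongrightarrow> 0)"
proof -
  obtain D where D: "2 ^ CARD('n) = Suc D" by (cases "(2::nat) ^ CARD('n)") auto
  note conv = expansion_converges[OF assms D] and uniq = expansion_unique[OF assms D]
  have "\<exists>!a :: nat \<Rightarrow> real. (\<lambda>m. dual_norm (\<lambda>u. \<alpha> u - (\<Sum>j<m. a j * T (haar_seq K j) u))) \<longlonglongrightarrow> 0" if a: "\<alpha> \<in> SCH" for \<alpha>
  proof (rule ex1I)
    show "(\<lambda>m. dual_norm (\<lambda>u. \<alpha> u - (\<Sum>j<m. \<alpha> (haar_seq K j) * T (haar_seq K j) u))) \<longlonglongrightarrow> 0" by (rule conv[OF a])
    fix b :: "nat \<Rightarrow> real"
    assume "(\<lambda>m. dual_norm (\<lambda>u. \<alpha> u - (\<Sum>j<m. b j * T (haar_seq K j) u))) \<longlonglongrightarrow> 0"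
    from uniq[OF a this] show "b = (\<lambda>j. \<alpha> (haar_seq K j))" by (intro ext)
  qed
  then show ?thesis using T_haar_SCH[OF assms D] conv by (simp add: schauder_basis_def)
qed

end
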